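(* Let $\hat G$ be a $C_{-4}$-critical signed graph with underlying graph $G$. If $\hat G$ is not (switching) isomorphic to $\hat W$, then $$|E(G)|\ge \frac{4|V(G)|}{3}.$$
   Context: All graphs are finite and simple. A signed graph $\hat G=(G,\sigma)$ is a graph $G$ with a signature $\sigma:E(G)\to\{+,-\}$. Switching at a set $X\subseteq V(G)$ means flipping the signs of all edges with exactly one end in $X$; two signatures on $G$ are (switching) equivalent if one is obtained from the other by switching. A homomorphism $(G,\sigma)\to(H,\pi)$ exists if and only if there are a signature $\sigma'$ equivalent to $\sigma$ and a map $f:V(G)\to V(H)$ such that for every edge $uv$ of $G$, $f(u)f(v)$ is an edge of $H$ with $\pi(f(u)f(v))=\sigma'(uv)$. Two signed graphs are (switching) isomorphic if, after a switching of one of them, there is a graph isomorphism between them preserving signs of edges. A subgraph of $(G,\sigma)$ is a subgraph of $G$ with the restricted signature. $C_{-4}$ is the signed 4-cycle on $u_1,u_2,u_3,u_4$ with positive edges $u_1u_2,u_2u_3,u_3u_4$ and negative edge $u_4u_1$. A signed bipartite (simple) graph is $C_{-4}$-critical if it admits no homomorphism to $C_{-4}$ but each of its proper subgraphs does (in particular a $C_{-4}$-critical signed graph is bipartite and simple). $\hat W$ is the signed bipartite graph with vertex set $\{x_1,x_2,x_3,x_4\}\cup\{y_1,y_2,y_3\}$, positive edges $x_1y_1,x_1y_2,x_1y_3,x_2y_2,x_3y_3,x_4y_1$ and negative edges $x_2y_1,x_3y_2,x_4y_3$. *)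

theory Defs
  imports Complex_Main
begin

datatype sign = Positive | Negative

fun flip :: "sign \<Rightarrow> sign" where
  "flip Positive = Negative"
| "flip Negative = Positive"

text \<open>An edge is the two-element set of its ends. Only the values of \<open>sgn_of\<close> on edges
  carry meaning; the notions below never look at its values elsewhere.\<close>

record 'a signed_graph =
  verts :: "'a set"
  edges :: "'a set set"
  sgn_of :: "'a set \<Rightarrow> sign"

definition simple_signed_graph :: "'a signed_graph \<Rightarrow> bool" where
  "simple_signed_graph G \<longleftrightarrow>
     finite (verts G) \<and> (\<forall>e\<in>edges G. e \<subseteq> verts G \<and> card e = 2)"

definition bipartite :: "'a signed_graph \<Rightarrow> bool" where
  "bipartite G \<longleftrightarrow>
     (\<exists>A B. A \<union> B = verts G \<and> A \<inter> B = {} \<and>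
        (\<forall>e\<in>edges G. \<exists>a\<in>A. \<exists>b\<in>B. e = {a, b}))"

text \<open>An edge \<open>e\<close> has exactly one end in \<open>X\<close> iff \<open>card (e \<inter> X) = 1\<close>.\<close>

definition switch_sign :: "'a set \<Rightarrow> ('a set \<Rightarrow> sign) \<Rightarrow> 'a set \<Rightarrow> sign" where
  "switch_sign X s e = (if card (e \<inter> X) = 1 then flip (s e) else s e)"

definition switching_equivalent ::
  "'a signed_graph \<Rightarrow> ('a set \<Rightarrow> sign) \<Rightarrow> ('a set \<Rightarrow> sign) \<Rightarrow> bool" where
  "switching_equivalent G s s' \<longleftrightarrow>
     (\<exists>X\<subseteq>verts G. \<forall>e\<in>edges G. s' e = switch_sign X s e)"

definition homomorphic :: "'a signed_graph \<Rightarrow> 'b signed_graph \<Rightarrow> bool" where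
  "homomorphic G H \<longleftrightarrow>
     (\<exists>s' f. switching_equivalent G (sgn_of G) s' \<and> f ` verts G \<subseteq> verts H \<and>
        (\<forall>u v. {u, v} \<in> edges G \<longrightarrow>
           {f u, f v} \<in> edges H \<and> sgn_of H {f u, f v} = s' {u, v}))"

definition switching_isomorphic :: "'a signed_graph \<Rightarrow> 'b signed_graph \<Rightarrow> bool" where
  "switching_isomorphic G H \<longleftrightarrow>
     (\<exists>s' f. switching_equivalent G (sgn_of G) s' \<and> bij_betw f (verts G) (verts H) \<and>
        (\<forall>u\<in>verts G. \<forall>v\<in>verts G.
           ({u, v} \<in> edges G \<longleftrightarrow> {f u, f v} \<in> edges H) \<and>
           ({u, v} \<in> edges G \<longrightarrow> sgn_of H {f u, f v} = s' {u, v})))"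

definition signed_subgraph :: "'a signed_graph \<Rightarrow> 'a signed_graph \<Rightarrow> bool" where
  "signed_subgraph H G \<longleftrightarrow>
     simple_signed_graph H \<and> verts H \<subseteq> verts G \<and> edges H \<subseteq> edges G \<and>
     (\<forall>e\<in>edges H. sgn_of H e = sgn_of G e)"

definition proper_signed_subgraph :: "'a signed_graph \<Rightarrow> 'a signed_graph \<Rightarrow> bool" where
  "proper_signed_subgraph H G \<longleftrightarrow>
     signed_subgraph H G \<and> (verts H \<noteq> verts G \<or> edges H \<noteq> edges G)"

definition graph_of_signed_edges ::
  "'a set \<Rightarrow> 'a set set \<Rightarrow> 'a set set \<Rightarrow> 'a signed_graph" where
  "graph_of_signed_edges V P N =
     \<lparr>verts = V, edges = P \<union> N, sgn_of = (\<lambda>e. if e \<in> N then Negative else Positive)\<rparr>"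

datatype c4_vertex = U1 | U2 | U3 | U4

definition C_minus_4 :: "c4_vertex signed_graph" where
  "C_minus_4 = graph_of_signed_edges {U1, U2, U3, U4}
     {{U1, U2}, {U2, U3}, {U3, U4}}
     {{U4, U1}}"

datatype w_vertex = X1 | X2 | X3 | X4 | Y1 | Y2 | Y3

definition W_hat :: "w_vertex signed_graph" where
  "W_hat = graph_of_signed_edges {X1, X2, X3, X4, Y1, Y2, Y3}
     {{X1, Y1}, {X1, Y2}, {X1, Y3}, {X2, Y2}, {X3, Y3}, {X4, Y1}}
     {{X2, Y1}, {X3, Y2}, {X4, Y3}}"

definition C_minus_4_critical :: "'a signed_graph \<Rightarrow> bool" where
  "C_minus_4_critical G \<longleftrightarrow>
     simple_signed_graph G \<and> bipartite G \<and> \<not> homomorphic G C_minus_4 \<and>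
     (\<forall>H. proper_signed_subgraph H G \<longrightarrow> homomorphic H C_minus_4)"

end

theory Submission
  imports Defs
begin

text \<open>
  A homomorphism to \<open>C\<^sub>-\<^sub>4\<close> is a colouring by the integers modulo 8, the parity being given by the
  side of the bipartition, in which colours differ by \<open>\<plusminus>1\<close> along positive edges and by \<open>\<plusminus>3\<close> along
  negative ones. A vertex of degree 2 then only forbids one of \<open>c a = c b\<close>, \<open>c a = c b + 4\<close> for its
  two neighbours; two such vertices are never adjacent. By a weighted count of edges, the density
  bound follows once each set of \<open>n\<close> vertices of degree 3 meets at least \<open>n\<close> edges avoiding the
  2-vertices, and this can only fail for a tree of 3-vertices all of whose other neighbours have
  degree 2. Colour the rest of the graph and extend: from the leaves up, every subtree excludes at
  most one colour of its parent (its message, the midpoint of the two messages it receives), so the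
  root sees at most three of the four colours of its parity excluded. The only difficulty is a
  2-vertex tying two vertices of the tree to each other. Such ties are removed by induction: a
  minimal subtree that is not a path with ties leading out of it is cut off, and the ends of its
  ties, as well as its parent, each lose one colour. The choice of these colours is always possible
  except for two sibling leaves tied to each other, which leads to \<open>W\<close>.
\<close>

section \<open>Colours modulo 8\<close>

text \<open>The modulus 8 comes from the double cover: the vertices of
  \<open>C\<^sub>-\<^sub>4\<close>, each in two copies that are 4 apart, form an 8-cycle, and
  switching a vertex of the graph adds 4 to its colour. Cutting off a subtree keeps the degrees of
  what is left: a tie end that excluded one colour still excludes one, and the parent exchanges a
  branch for one excluded colour. So a subtree can be cut off as soon as exclusions at the far ends
  of its ties confine its message to one fixed value. For a path with outgoing ties they confine it
  only to two values that are 2 apart. Two such pairs can be made to coincide, and then have a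
  single midpoint; so has such a pair with a colour that is excluded outright. This is why minimal
  subtrees that are not such paths are removed, and not leaves. \<open>W\<close> appears as a star
  whose three leaves are pairwise tied: they would need three different colours next to that of the
  centre, where there are only two.\<close>

datatype col = C0 | C1 | C2 | C3 | C4 | C5 | C6 | C7

fun up :: "col \<Rightarrow> col" where
  "up C0 = C1" | "up C1 = C2" | "up C2 = C3" | "up C3 = C4"
| "up C4 = C5" | "up C5 = C6" | "up C6 = C7" | "up C7 = C0"

fun opp :: "col \<Rightarrow> col" where
  "opp C0 = C4" | "opp C1 = C5" | "opp C2 = C6" | "opp C3 = C7"
| "opp C4 = C0" | "opp C5 = C1" | "opp C6 = C2" | "opp C7 = C3"

fun even_col :: "col \<Rightarrow> bool" where
  "even_col C0 = True" | "even_col C1 = False" | "even_col C2 = True" | "even_col C3 = False"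
| "even_col C4 = True" | "even_col C5 = False" | "even_col C6 = True" | "even_col C7 = False"

text \<open>The shift by 4 carries the signs: \<open>near c (opp_if True d)\<close> says that the
  colours differ by 3 modulo 8.\<close>

definition opp_if :: "bool \<Rightarrow> col \<Rightarrow> col" where
  "opp_if s c = (if s then opp c else c)"

definition near :: "col \<Rightarrow> col \<Rightarrow> bool" where
  "near c d \<longleftrightarrow> d = up c \<or> c = up d"

text \<open>For colours of equal parity this is the case that remains besides equal and opposite.
  Hence it does not change when 4 is added on either side.\<close>

definition dist2 :: "col \<Rightarrow> col \<Rightarrow> bool" where
  "dist2 a b \<longleftrightarrow> b = up (up a) \<or> a = up (up b)"

text \<open>A colour of the parent is blocked exactly when both colours next to it are excluded. So
  the two exclusions must be 2 apart, with the blocked colour in between; \<open>None\<close> means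
  that nothing is blocked.\<close>

fun mid :: "col option \<Rightarrow> col option \<Rightarrow> col option" where
  "mid (Some a) (Some b) =
     (if b = up (up a) then Some (up a) else if a = up (up b) then Some (up b) else None)"
| "mid None _ = None"
| "mid _ None = None"

lemma mid_None2 [simp]: "mid a None = None"
  by (cases a) auto

lemma mid_commute: "mid a b = mid b a"
proof (cases a; cases b)
  fix x y assume "a = Some x" "b = Some y"
  then show ?thesis by (cases x; cases y; simp)
qed auto

lemma near_sym: "near c d \<longleftrightarrow> near d c"
  by (auto simp: near_def)

lemma near_even_col: "near c d \<Longrightarrow> even_col d \<longleftrightarrow> \<not> even_col c"
  by (cases c; cases d; simp add: near_def)

lemma even_col_opp_if [simp]: "even_col (opp_if s c) = even_col c"
  by (cases c; simp add: opp_if_def)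

lemma opp_if_opp_if [simp]: "opp_if s (opp_if s' c) = opp_if (s \<noteq> s') c"
  by (cases c; cases s; cases s'; simp add: opp_if_def)

lemma opp_if_False [simp]: "opp_if False c = c"
  by (simp add: opp_if_def)

lemma opp_if_eq_iff: "opp_if s a = b \<longleftrightarrow> a = opp_if s b"
  by (cases a; cases b; cases s; simp add: opp_if_def)

lemma near_opp_if [simp]: "near (opp_if s a) (opp_if s b) = near a b"
  by (cases a; cases b; cases s; simp add: opp_if_def near_def)

lemma near_opp_if_swap: "near (opp_if s a) b = near a (opp_if s b)"
  by (cases a; cases b; cases s; simp add: opp_if_def near_def)

lemma dist2_sym: "dist2 a b = dist2 b a"
  by (auto simp: dist2_def)

lemma dist2_irrefl [simp]: "\<not> dist2 a a"
  by (cases a; simp add: dist2_def)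

lemma dist2_opp_if [simp]: "dist2 (opp_if s a) b = dist2 a b" "dist2 a (opp_if s b) = dist2 a b"
  by (cases a; cases b; cases s; simp add: opp_if_def dist2_def)+

lemma mid_None_iff: "mid (Some a) (Some b) = None \<longleftrightarrow> \<not> dist2 a b"
  by (simp add: dist2_def)

lemma mid_choice:
  assumes "mid m1 m2 \<noteq> Some e"
  obtains d where "near e d" "m1 \<noteq> Some d" "m2 \<noteq> Some d"
proof -
  \<comment> \<open>\<open>up (up (up (opp e)))\<close> is e - 1, as 3 + 4 = -1 modulo 8; these are
    the two colours near e.\<close>
  let ?d1 = "up e" and ?d2 = "up (up (up (opp e)))"
  have n: "near e ?d1" "near e ?d2" by (cases e; simp add: near_def)+
  have "(m1 \<noteq> Some ?d1 \<and> m2 \<noteq> Some ?d1) \<or> (m1 \<noteq> Some ?d2 \<and> m2 \<noteq> Some ?d2)"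
    using assms
    by (cases e; auto split: if_splits)
  then show ?thesis using n that by blast
qed

lemma near_choice: obtains d where "near e d" "d \<noteq> z"
  using mid_choice[of "Some z" None e] by auto

lemma near_dist2_choice: obtains d where "near e d" "\<not> dist2 d m"
proof -
  have "\<not> dist2 (up e) m \<or> \<not> dist2 (up (up (up (opp e)))) m"
    by (cases e; cases m; simp add: dist2_def)
  moreover have "near e (up e)" "near e (up (up (up (opp e))))" by (cases e; simp add: near_def)+
  ultimately show ?thesis using that by blast
qed

lemma near_dist2: "near e d \<Longrightarrow> near e d' \<Longrightarrow> d = d' \<or> dist2 d d'"
  by (cases e; cases d; simp add: near_def; cases d'; simp add: dist2_def)

text \<open>The inner midpoint is u + 1 for y = u + 2 and u - 1 for y = u - 2. These two are
  themselves 2 apart, so d is 2 away from at most one of them: from u + 1 if d is u + 3 or u - 1,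
  from u - 1 if d is u + 1 or u - 3.\<close>

lemma mid_mid_unique:
  "mid (Some d) (mid (Some y) (Some u)) \<noteq> None \<Longrightarrow>
    y = (if d = up (up (up u)) \<or> up d = u then up (up u) else up (up (opp u)))"
  by (cases d; cases u; simp; cases y; simp)

text \<open>Two steps from e lie e, e + 2 and e - 2. If e is not u, then e is 2 away from m, so e +
  2 and e - 2 are m and m + 4; these are not 2 away from m, and both would have to be u.\<close>

lemma two_step_bad:
  assumes "\<And>d. near e d \<Longrightarrow> \<forall>c. near d c \<longrightarrow> dist2 c m \<or> c = u"
  shows "e = u"
proof -
  let ?d1 = "up e" and ?d2 = "up (up (up (opp e)))"
  have "near e ?d1" "near e ?d2" by (cases e; simp add: near_def)+
  from assms[OF this(1)] assms[OF this(2)]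
  have "(dist2 e m \<or> e = u) \<and> (dist2 (up (up e)) m \<or> up (up e) = u) \<and> (dist2 (up (up (opp e))) m \<or>
      up (up (opp e)) = u)"
    by (cases e; simp add: near_def)
  then show ?thesis
    by (cases e; cases m; simp add: dist2_def)
qed

section \<open>Trees of constraints\<close>

text \<open>A cubic tree seen from a parent. Apart from its subtrees a vertex has stubs: \<open>Ban g\<close> excludes the
  colour \<open>g\<close> (a 2-vertex whose other neighbour is already coloured), and \<open>Tie w s\<close> excludes the colour of
  the tree vertex \<open>w\<close>, shifted by 4 if \<open>s\<close>. A tie is recorded at both of its ends.\<close>

datatype 'v item = Ban col | Tie 'v bool | Node 'v "'v item" "'v item"

datatype 'v con = Near 'v 'v | Link 'v 'v bool | Exc 'v col

text \<open>\<open>Near\<close> is recorded in both directions, so that the set of constraints does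
  not depend on the choice of the root.\<close>

fun cons :: "'v \<Rightarrow> 'v item \<Rightarrow> 'v con set" where
  "cons q (Ban g) = {Exc q g}"
| "cons q (Tie w s) = {Link q w s}"
| "cons q (Node v l r) = {Near q v, Near v q} \<union> cons v l \<union> cons v r"

fun lab :: "'v item \<Rightarrow> 'v set" where
  "lab (Node v l r) = insert v (lab l \<union> lab r)"
| "lab _ = {}"

fun dist_lab :: "'v item \<Rightarrow> bool" where
  "dist_lab (Node v l r) \<longleftrightarrow> v \<notin> lab l \<union> lab r \<and> lab l \<inter> lab r = {} \<and> dist_lab l \<and> dist_lab r"
| "dist_lab _ \<longleftrightarrow> True"

fun tgt :: "'v item \<Rightarrow> 'v set" where
  "tgt (Ban g) = {}"
| "tgt (Tie w s) = {w}"
| "tgt (Node v l r) = tgt l \<union> tgt r"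

fun sat :: "('v \<Rightarrow> col) \<Rightarrow> 'v con \<Rightarrow> bool" where
  "sat f (Near x v) \<longleftrightarrow> near (f x) (f v)"
| "sat f (Link x w s) \<longleftrightarrow> f x \<noteq> opp_if s (f w)"
| "sat f (Exc x g) \<longleftrightarrow> f x \<noteq> g"

fun par_con :: "('v \<Rightarrow> bool) \<Rightarrow> 'v con \<Rightarrow> bool" where
  "par_con par (Near x v) \<longleftrightarrow> par x \<noteq> par v"
| "par_con par (Link x w s) \<longleftrightarrow> par x = par w"
| "par_con par (Exc x g) \<longleftrightarrow> even_col g = par x"

fun vars :: "'v con \<Rightarrow> 'v set" where
  "vars (Near x v) = {x, v}"
| "vars (Link x w s) = {x, w}"
| "vars (Exc x g) = {x}"

text \<open>The only colour of the parent (if any) from which the subtree cannot be coloured, ties into \<open>Y\<close>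
  being ignored.\<close>

fun msg :: "'v set \<Rightarrow> ('v \<Rightarrow> col) \<Rightarrow> 'v item \<Rightarrow> col option" where
  "msg Y f (Ban g) = Some g"
| "msg Y f (Tie w s) = (if w \<in> Y then None else Some (opp_if s (f w)))"
| "msg Y f (Node v l r) = mid (msg Y f l) (msg Y f r)"

fun crossing :: "'v set \<Rightarrow> 'v \<Rightarrow> 'v item \<Rightarrow> 'v set" where
  "crossing Y q (Ban g) = {}"
| "crossing Y q (Tie w s) = (if w \<in> Y then {q} else {})"
| "crossing Y q (Node v l r) = crossing Y v l \<union> crossing Y v r"

fun is_tie :: "'v item \<Rightarrow> bool" where
  "is_tie (Tie w s) \<longleftrightarrow> True"
| "is_tie _ \<longleftrightarrow> False"

fun caterpillar :: "'v item \<Rightarrow> bool" where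
  "caterpillar (Node v l r) \<longleftrightarrow> is_tie l \<and> is_tie r \<or> is_tie l \<and> caterpillar r \<or>
      caterpillar l \<and> is_tie r"
| "caterpillar _ \<longleftrightarrow> False"

definition par_ok :: "('v \<Rightarrow> bool) \<Rightarrow> ('v \<Rightarrow> col) \<Rightarrow> bool" where
  "par_ok par f \<longleftrightarrow> (\<forall>x. even_col (f x) = par x)"

text \<open>Ties into Y are exempt so that siblings tied to each other can be coloured one after the
  other: the first ignores these ties, and the second satisfies them through its own copies.\<close>

definition extends :: "('v \<Rightarrow> bool) \<Rightarrow> ('v \<Rightarrow> col) \<Rightarrow> 'v \<Rightarrow> 'v item \<Rightarrow> 'v set \<Rightarrow> ('v \<Rightarrow> col) \<Rightarrow> bool" where
  "extends par f q t Y f2 \<longleftrightarrow> (\<forall>x. x \<notin> lab t \<longrightarrow> f2 x = f x) \<and> par_ok par f2 \<and>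
     (\<forall>k\<in>cons q t. sat f2 k \<or> (\<exists>x w s. k = Link x w s \<and> w \<in> Y))"

text \<open>If the targets outside \<open>Y\<close> are coloured as in \<open>f0\<close>, then from every colour of the parent
  outside \<open>B\<close> the tree has a colouring with property \<open>Q\<close> that ignores the ties into \<open>Y\<close>.\<close>

definition colourable :: "('v \<Rightarrow> bool) \<Rightarrow> 'v item \<Rightarrow> 'v set \<Rightarrow> ('v \<Rightarrow> col) \<Rightarrow> (('v \<Rightarrow> col) \<Rightarrow> bool) \<Rightarrow>
    col set \<Rightarrow> bool" where
  "colourable par t Y f0 Q B \<longleftrightarrow> (\<forall>f q. (\<forall>w\<in>tgt t - Y. f w = f0 w) \<longrightarrow> par_ok par f \<longrightarrow> q \<notin> lab t \<longrightarrow>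
     (\<forall>k\<in>cons q t. par_con par k) \<longrightarrow> f q \<notin> B \<longrightarrow> (\<exists>f2. extends par f q t Y f2 \<and> Q f2))"

lemma sat_cong: "(\<And>x. x \<in> vars k \<Longrightarrow> f x = g x) \<Longrightarrow> sat f k = sat g k"
  by (cases k) auto

lemma vars_cons: "k \<in> cons q t \<Longrightarrow> vars k \<subseteq> insert q (lab t \<union> tgt t)"
  by (induction q t rule: cons.induct) auto

lemma Link_cons: "Link x w s \<in> cons q t \<Longrightarrow> w \<in> tgt t \<and> (x = q \<or> x \<in> lab t)"
  by (induction q t rule: cons.induct) auto

lemma Link_cons_Node: "Link x w s \<in> cons q (Node v l r) \<Longrightarrow>
    w \<in> tgt (Node v l r) \<and> x \<in> lab (Node v l r)"
  using Link_cons[of x w s v l] Link_cons[of x w s v r] by auto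

lemma tgt_Link: "w \<in> tgt t \<Longrightarrow> \<exists>x s. Link x w s \<in> cons q t"
  by (induction q t rule: cons.induct) auto

lemma crossing_iff: "x \<in> crossing Y q t \<longleftrightarrow> (\<exists>w s. Link x w s \<in> cons q t \<and> w \<in> Y)"
  by (induction q t rule: cons.induct) auto

lemma finite_lab [simp]: "finite (lab t)"
  by (induction t) auto

lemma msg_cong: "(\<And>w. w \<in> tgt t - Y \<Longrightarrow> f w = g w) \<Longrightarrow> msg Y f t = msg Y g t"
proof (induction t)
  case (Node v l r)
  have "msg Y f l = msg Y g l" "msg Y f r = msg Y g r"
    using Node by auto
  then show ?case by simp
qed auto

lemma msg_None:
  assumes "tgt t \<inter> Y \<noteq> {}"
  shows "msg Y f t = None"
  using assms
proof (induction t)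
  case (Node v l r)
  then consider "tgt l \<inter> Y \<noteq> {}" | "tgt r \<inter> Y \<noteq> {}" by auto
  then show ?case using Node.IH by cases simp_all
qed auto

lemma caterpillar_Node: "caterpillar t \<Longrightarrow> \<exists>v l r. t = Node v l r"
  by (cases t) auto

lemma caterpillar_induct [consumes 1, case_names leaf step swap]:
  assumes "caterpillar t"
    and leaf: "\<And>v w s w' s'. P (Node v (Tie w s) (Tie w' s'))"
    and step: "\<And>v w s r. caterpillar r \<Longrightarrow> P r \<Longrightarrow> P (Node v (Tie w s) r)"
    and swap: "\<And>v l r. P (Node v l r) \<Longrightarrow> P (Node v r l)"
  shows "P t"
  using assms(1)
proof (induction t)
  case (Node v l r)
  then consider "is_tie l" "is_tie r" | "is_tie l" "caterpillar r" | "caterpillar l" "is_tie r"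
      by auto
  then show ?case
  proof cases
    case 1 then show ?thesis using leaf by (cases l; cases r; auto)
  next
    case 2 then show ?thesis using step Node.IH(2) by (cases l; auto)
  next
    case 3
    then have "P (Node v r l)" using step Node.IH(1) by (cases r; auto)
    then show ?thesis by (rule swap)
  qed
qed auto

lemma pokD: "par_ok par f \<Longrightarrow> even_col (f x) = par x"
  by (simp add: par_ok_def)

section \<open>Combining colourings of subtrees\<close>

lemma colourable_mono:
  assumes "colourable par t Y f0 Q B" "\<And>f. Q f \<Longrightarrow> Q' f" "B \<subseteq> B'"
  shows "colourable par t Y f0 Q' B'"
  unfolding colourable_def
proof (intro allI impI)
  fix f q
  assume h: "\<forall>w\<in>tgt t - Y. f w = f0 w" "par_ok par f" "q \<notin> lab t" "\<forall>k\<in>cons q t. par_con par k"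
      "f q \<notin> B'"
  then have "f q \<notin> B" using assms(3) by auto
  then show "\<exists>f2. extends par f q t Y f2 \<and> Q' f2"
    using assms(1)[unfolded colourable_def, rule_format, of f q] h assms(2) by auto
qed

lemma colourable_swap: "colourable par (Node v l r) Y f0 Q B = colourable par (Node v r l) Y f0 Q B"
  unfolding colourable_def extends_def by (simp add: Un_commute Un_left_commute conj_commute)

text \<open>The root takes a colour d, then l is coloured, then r. By \<open>dep\<close> the last
  step cannot spoil what was achieved on l, and as no target lies in the tree, the targets keep the
  colours of f0. The properties may depend on d because steering will also compare a lower vertex
  with v.\<close>

lemma colourable_Node:
  assumes d: "dist_lab (Node v l r)" and noint: "tgt (Node v l r) \<inter> lab (Node v l r) = {}"
    and l: "\<And>d. colourable par l Y f0 (Ql d) (Bl d)"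
        and r: "\<And>d. colourable par r Y f0 (Qr d) (Br d)"
    and dep: "\<And>d f g. Ql d f \<Longrightarrow> (\<And>x. x \<in> lab l \<Longrightarrow> g x = f x) \<Longrightarrow> Ql d g"
    and A: "\<And>e. e \<notin> B \<Longrightarrow> \<exists>d. near e d \<and> d \<in> A \<and> d \<notin> Bl d \<and> d \<notin> Br d"
  shows "colourable par (Node v l r) Y f0 (\<lambda>f. f v \<in> A \<and> Ql (f v) f \<and> Qr (f v) f) B"
  unfolding colourable_def
proof (intro allI impI)
  fix f q
  assume ag: "\<forall>w\<in>tgt (Node v l r) - Y. f w = f0 w" and pk: "par_ok par f"
      and q: "q \<notin> lab (Node v l r)"
    and pa: "\<forall>k\<in>cons q (Node v l r). par_con par k" and e: "f q \<notin> B"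
  from A[OF e] obtain d where d1: "near (f q) d" "d \<in> A" "d \<notin> Bl d" "d \<notin> Br d" by blast
  define f1 where "f1 = f(v := d)"
  have "par q \<noteq> par v" using pa[rule_format, of "Near q v"] by simp
  then have pk1: "par_ok par f1"
      using pk d1(1) near_even_col[OF d1(1)] by (auto simp: par_ok_def f1_def)
  have vl: "v \<notin> tgt l" "v \<notin> tgt r" using noint by auto
  have "\<exists>f2. extends par f1 v l Y f2 \<and> Ql d f2"
  proof (rule l[of d, unfolded colourable_def, rule_format])
    show "f1 w = f0 w" if "w \<in> tgt l - Y" for w using that ag vl by (auto simp: f1_def)
    show "par_ok par f1" by (rule pk1)
    show "v \<notin> lab l" using d by auto
    show "par_con par k" if "k \<in> cons v l" for k using pa that by auto
    show "f1 v \<notin> Bl d" using d1 by (auto simp: f1_def)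
  qed
  then obtain f2 where f2: "extends par f1 v l Y f2" "Ql d f2" by blast
  have a2: "f2 x = f1 x" if "x \<notin> lab l" for x using f2 that by (simp add: extends_def)
  have "\<exists>f3. extends par f2 v r Y f3 \<and> Qr d f3"
  proof (rule r[of d, unfolded colourable_def, rule_format])
    fix w assume w: "w \<in> tgt r - Y"
    then have "w \<notin> lab l" "w \<noteq> v" using noint by auto
    then show "f2 w = f0 w" using w ag a2 by (auto simp: f1_def)
  next
    show "par_ok par f2" using f2 by (simp add: extends_def)
    show "v \<notin> lab r" using d by auto
    show "par_con par k" if "k \<in> cons v r" for k using pa that by auto
    show "f2 v \<notin> Br d" using a2[of v] d d1 by (auto simp: f1_def)
  qed
  then obtain f3 where f3: "extends par f2 v r Y f3" "Qr d f3" by blast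
  have a3: "f3 x = f2 x" if "x \<notin> lab r" for x using f3 that by (simp add: extends_def)
  have f3v: "f3 v = d" using a3[of v] a2[of v] d by (auto simp: f1_def)
  have f3q: "f3 q = f q" using a3[of q] a2[of q] q by (auto simp: f1_def)
  have "extends par f q (Node v l r) Y f3"
    unfolding extends_def
  proof (intro conjI allI impI ballI)
    fix x assume "x \<notin> lab (Node v l r)"
    then show "f3 x = f x" using a3[of x] a2[of x] by (auto simp: f1_def)
  next
    show "par_ok par f3" using f3 by (simp add: extends_def)
  next
    fix k assume k: "k \<in> cons q (Node v l r)"
    then consider "k = Near q v \<or> k = Near v q" | "k \<in> cons v l" | "k \<in> cons v r" by auto
    then show "sat f3 k \<or> (\<exists>x w s. k = Link x w s \<and> w \<in> Y)"
    proof cases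
      case 1
      then show ?thesis using d1(1) f3v f3q by (auto simp: near_sym)
    next
      case 2
      have "sat f3 k = sat f2 k"
      proof (rule sat_cong)
        fix x assume "x \<in> vars k"
        then have "x \<in> insert v (lab l \<union> tgt l)" using vars_cons[OF 2] by auto
        then have "x \<notin> lab r" using d noint by auto
        then show "f3 x = f2 x" by (rule a3)
      qed
      then show ?thesis using f2 2 by (auto simp: extends_def)
    next
      case 3
      then show ?thesis using f3 by (auto simp: extends_def)
    qed
  qed
  moreover have "Ql d f3"
  proof (rule dep[OF f2(2)])
    fix x assume "x \<in> lab l"
    then have "x \<notin> lab r" using d by auto
    then show "f3 x = f2 x" by (rule a3)
  qed
  ultimately show "\<exists>f2. extends par f q (Node v l r) Y f2 \<and> f2 v \<in> A \<and> Ql (f2 v) f2 \<and> Qr (f2 v) f2"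
    using d1(2) f3(2) by (intro exI[of _ f3]) (simp add: f3v)
qed

lemma colourable_Ban: "colourable par (Ban g) Y f0 (\<lambda>_. True) {g}"
  unfolding colourable_def extends_def
proof (intro allI impI)
  fix f :: "'a \<Rightarrow> col" and q
  assume "par_ok par f" "f q \<notin> {g}"
  then show "\<exists>f2. ((\<forall>x. x \<notin> lab (Ban g) \<longrightarrow> f2 x = f x) \<and> par_ok par f2 \<and>
      (\<forall>k\<in>cons q (Ban g). sat f2 k \<or> (\<exists>x w s. k = Link x w s \<and> w \<in> Y))) \<and> True"
    by (intro exI[of _ f]) auto
qed

lemma colourable_Tie: "colourable par (Tie w s) Y f0 (\<lambda>_. True) {c. w \<notin> Y \<and> c = opp_if s (f0 w)}"
  unfolding colourable_def extends_def
proof (intro allI impI)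
  fix f :: "'a \<Rightarrow> col" and q
  assume "par_ok par f" "f q \<notin> {c. w \<notin> Y \<and> c = opp_if s (f0 w)}" "\<forall>w\<in>tgt (Tie w s) - Y. f w = f0 w"
  then show "\<exists>f2. ((\<forall>x. x \<notin> lab (Tie w s) \<longrightarrow> f2 x = f x) \<and> par_ok par f2 \<and>
      (\<forall>k\<in>cons q (Tie w s). sat f2 k \<or> (\<exists>x w s. k = Link x w s \<and> w \<in> Y))) \<and> True"
    by (intro exI[of _ f]; cases "w \<in> Y") simp_all
qed

text \<open>A parent colour other than the message leaves the root a colour outside both messages
  from below, by \<open>mid_choice\<close>; the branches then follow by induction.\<close>

lemma colourable_msg:
  assumes "dist_lab t" "tgt t \<inter> lab t = {}"
  shows "colourable par t Y f0 (\<lambda>_. True) {e. msg Y f0 t = Some e}"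
  using assms
proof (induction t)
  case (Ban g)
  show ?case by (rule colourable_mono[OF colourable_Ban]) auto
next
  case (Tie w s)
  show ?case by (rule colourable_mono[OF colourable_Tie]) auto
next
  case (Node v l r)
  have il: "colourable par l Y f0 (\<lambda>_. True) {e. msg Y f0 l = Some e}"
    by (rule Node.IH(1)) (use Node.prems in auto)
  have ir: "colourable par r Y f0 (\<lambda>_. True) {e. msg Y f0 r = Some e}"
    by (rule Node.IH(2)) (use Node.prems in auto)
  have "colourable par (Node v l r) Y f0 (\<lambda>f. f v \<in> UNIV \<and> True \<and>
      True) {e. msg Y f0 (Node v l r) = Some e}"
  proof (rule colourable_Node[OF Node.prems il ir])
    fix e assume "e \<notin> {e. msg Y f0 (Node v l r) = Some e}"
    then have "mid (msg Y f0 l) (msg Y f0 r) \<noteq> Some e" by simp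
    then obtain d where "near e d" "msg Y f0 l \<noteq> Some d" "msg Y f0 r \<noteq> Some d" by (rule mid_choice)
    then show "\<exists>d. near e d \<and> d \<in> UNIV \<and> d \<notin> {e. msg Y f0 l = Some e} \<and>
        d \<notin> {e. msg Y f0 r = Some e}"
      by auto
  qed auto
  then show ?case by simp
qed

section \<open>Two caterpillars tied to each other\<close>

text \<open>Below, \<open>Y\<close> is the vertex set of the sibling of the caterpillar \<open>X\<close>. One of the two is coloured first,
  ignoring the ties between them, in such a way that the message of the other becomes \<open>None\<close>. Whether this
  succeeds depends on the deepest tie of \<open>X\<close> into \<open>Y\<close> and on the stub of the vertex just above it.\<close>

definition agrees :: "'v set \<Rightarrow> ('v \<Rightarrow> col) \<Rightarrow> 'v item \<Rightarrow> ('v \<Rightarrow> col) \<Rightarrow> bool" where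
  "agrees Y f0 t g \<longleftrightarrow> (\<forall>w\<in>tgt t - Y. g w = f0 w)"

text \<open>The message is taken with the empty set in place of Y: the ties into the sibling now
  count, with the colours that g gives to their ends. Once it is \<open>None\<close>, X can be
  coloured from every colour of its parent.\<close>

definition null_when :: "'v set \<Rightarrow> ('v \<Rightarrow> col) \<Rightarrow> 'v item \<Rightarrow> (('v \<Rightarrow> col) \<Rightarrow> bool) \<Rightarrow> bool" where
  "null_when Y f0 X P \<longleftrightarrow> (\<forall>g. agrees Y f0 X g \<longrightarrow> P g \<longrightarrow> msg {} g X = None)"

definition null_but_one :: "'v set \<Rightarrow> ('v \<Rightarrow> col) \<Rightarrow> 'v item \<Rightarrow> bool" where
  "null_but_one Y f0 X \<longleftrightarrow> (\<exists>x'\<in>Y \<inter> tgt X. \<exists>a. null_when Y f0 X (\<lambda>g. g x' \<noteq> a))"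

definition null_unless_dist2 :: "'v set \<Rightarrow> ('v \<Rightarrow> col) \<Rightarrow> 'v item \<Rightarrow> bool" where
  "null_unless_dist2 Y f0 X \<longleftrightarrow> (\<exists>x'\<in>Y \<inter> tgt X. \<exists>m. null_when Y f0 X (\<lambda>g. \<not> dist2 (g x') m))"

definition null_unless_pair :: "'v set \<Rightarrow> ('v \<Rightarrow> col) \<Rightarrow> 'v item \<Rightarrow> bool" where
  "null_unless_pair Y f0 X \<longleftrightarrow> (\<exists>x1\<in>Y \<inter> tgt X. \<exists>x2\<in>Y \<inter> tgt X. null_when Y f0 X (\<lambda>g. \<not> dist2 (g x1)
      (g x2)))"

text \<open>For a colour of the parity of m, not to be 2 away from m means to be m or m + 4. This is
  what \<open>null_unless_dist2\<close> demands of the sibling.\<close>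

definition steerable_but_one :: "('v \<Rightarrow> bool) \<Rightarrow> 'v set \<Rightarrow> ('v \<Rightarrow> col) \<Rightarrow> 'v item \<Rightarrow> bool" where
  "steerable_but_one par Y f0 X \<longleftrightarrow> (\<forall>q. \<forall>x\<in>crossing Y q X. \<forall>m. \<exists>z. colourable par X Y f0 (\<lambda>f. \<not>
      dist2 (f x) m) {z})"

definition steerable :: "('v \<Rightarrow> bool) \<Rightarrow> 'v set \<Rightarrow> ('v \<Rightarrow> col) \<Rightarrow> 'v item \<Rightarrow> bool" where
  "steerable par Y f0 X \<longleftrightarrow> (\<forall>q. \<forall>x\<in>crossing Y q X. \<forall>m. colourable par X Y f0 (\<lambda>f. \<not> dist2 (f x)
      m) {})"

definition pair_steerable :: "('v \<Rightarrow> bool) \<Rightarrow> 'v set \<Rightarrow> ('v \<Rightarrow> col) \<Rightarrow> 'v item \<Rightarrow> bool" where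
  "pair_steerable par Y f0 X \<longleftrightarrow> (\<forall>q. \<forall>x1\<in>crossing Y q X. \<forall>x2\<in>crossing Y q X. colourable par X Y
      f0 (\<lambda>f. \<not> dist2 (f x1) (f x2)) {})"

definition top_crossing :: "'v set \<Rightarrow> 'v item \<Rightarrow> bool" where
  "top_crossing Y X \<longleftrightarrow> (\<exists>v w s t. (X = Node v (Tie w s) t \<or>
      X = Node v t (Tie w s)) \<and> w \<in> Y \<and> tgt t \<inter> Y = {})"

text \<open>The cases come from the deepest vertex tied into Y. Two such ties there lead to
  \<open>null_unless_pair\<close>. With one, \<open>top_crossing\<close> is the provisional state
  while that vertex is the root; one vertex further up it becomes \<open>null_but_one\<close> if the
  stub there is fixed, and \<open>steerable_but_one\<close> if that stub leads into Y as
  well.\<close>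

definition crossing_type :: "('v \<Rightarrow> bool) \<Rightarrow> 'v set \<Rightarrow> ('v \<Rightarrow> col) \<Rightarrow> 'v item \<Rightarrow> bool" where
  "crossing_type par Y f0 X \<longleftrightarrow> null_but_one Y f0 X \<or>
      null_unless_dist2 Y f0 X \<and> (steerable_but_one par Y f0 X \<or> top_crossing Y X) \<or>
     steerable par Y f0 X \<and> pair_steerable par Y f0 X \<and> null_unless_pair Y f0 X"

lemma crossing_type_swap: "crossing_type par Y f0 (Node v l r) \<Longrightarrow>
    crossing_type par Y f0 (Node v r l)"
proof -
  have a: "agrees Y f0 (Node v r l) = agrees Y f0 (Node v l r)"
    by (auto simp: agrees_def fun_eq_iff)
  have m: "msg {} g (Node v r l) = msg {} g (Node v l r)" for g
    by (simp add: mid_commute)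
  have c: "crossing Y q (Node v r l) = crossing Y q (Node v l r)" for q by auto
  have t: "tgt (Node v r l) = tgt (Node v l r)" by auto
  have k3: "top_crossing Y (Node v r l) = top_crossing Y (Node v l r)"
      unfolding top_crossing_def by auto
  show "crossing_type par Y f0 (Node v l r) \<Longrightarrow> crossing_type par Y f0 (Node v r l)"
    unfolding crossing_type_def null_but_one_def null_unless_dist2_def null_unless_pair_def
        null_when_def steerable_but_one_def steerable_def pair_steerable_def k3 a m c t
      colourable_swap[of par v r l] .
qed

lemma colourable_step:
  assumes "dist_lab (Node v (Tie w s) r)" "tgt (Node v (Tie w s) r) \<inter> lab (Node v (Tie w s) r) = {}"
    and "\<And>d. colourable par r Y f0 (Q d) (B d)"
    and A: "\<And>e. e \<notin> B' \<Longrightarrow> \<exists>d. near e d \<and> d \<in> A \<and> (w \<notin> Y \<longrightarrow> d \<noteq> opp_if s (f0 w)) \<and> d \<notin> B d"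
    and R: "\<And>f. f v \<in> A \<Longrightarrow> Q (f v) f \<Longrightarrow> R f"
  shows "colourable par (Node v (Tie w s) r) Y f0 R B'"
proof -
  have "colourable par (Node v (Tie w s) r) Y f0 (\<lambda>f. f v \<in> A \<and> True \<and> Q (f v) f) B'"
  proof (rule colourable_Node[where Ql = "\<lambda>_ _. True" and Qr = Q and Br = B
      and A = A, OF assms(1,2) colourable_Tie assms(3)])
    fix e assume "e \<notin> B'"
    from A[OF this] show "\<exists>d. near e d \<and> d \<in> A \<and> d \<notin> {c. w \<notin> Y \<and> c = opp_if s (f0 w)} \<and>
        d \<notin> B d" by blast
  qed
  then show ?thesis by (rule colourable_mono) (use R in auto)
qed

text \<open>Only the midpoint of a and b has both of its neighbours excluded.\<close>

lemma near_avoid_two: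
  obtains z where "\<And>e. e \<noteq> z \<Longrightarrow> \<exists>d. near e d \<and> d \<noteq> a \<and> d \<noteq> b"
proof (cases "mid (Some a) (Some b)")
  case None
  show ?thesis
  proof (rule that)
    fix e
    obtain d where "near e d" "Some a \<noteq> Some d" "Some b \<noteq> Some d"
      using mid_choice[of "Some a" "Some b" e] None by auto
    then show "\<exists>d. near e d \<and> d \<noteq> a \<and> d \<noteq> b" by auto
  qed
next
  case (Some z)
  show ?thesis
  proof (rule that)
    fix e assume "e \<noteq> z"
    then obtain d where "near e d" "Some a \<noteq> Some d" "Some b \<noteq> Some d"
      using mid_choice[of "Some a" "Some b" e] Some by auto
    then show "\<exists>d. near e d \<and> d \<noteq> a \<and> d \<noteq> b" by auto
  qed
qed

lemma agrees_step: "agrees Y f0 (Node v l r) g \<longleftrightarrow> agrees Y f0 l g \<and> agrees Y f0 r g"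
  by (auto simp: agrees_def)

lemma msg_agrees: "agrees Y f0 t g \<Longrightarrow> tgt t \<inter> Y = {} \<Longrightarrow> msg {} g t = msg {} f0 t"
  by (rule msg_cong) (auto simp: agrees_def)

text \<open>The tie at v is ignored, and a tie into Y further down makes the message of r
  \<open>None\<close>. So v has both colours next to that of its parent at its disposal, and one of
  them is not 2 away from m.\<close>

lemma steerable_top:
  assumes "dist_lab (Node v (Tie w s) r)" "tgt (Node v (Tie w s) r) \<inter> lab (Node v (Tie w s) r) = {}"
    and "w \<in> Y" "tgt r \<inter> Y \<noteq> {}"
  shows "colourable par (Node v (Tie w s) r) Y f0 (\<lambda>f. \<not> dist2 (f v) m) {}"
proof (rule colourable_step[where Q = "\<lambda>_ _. True" and B = "\<lambda>_. {}" and A = "{d. \<not> dist2 d m}"])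
  show "colourable par r Y f0 (\<lambda>_. True) {}" for d
    by (rule colourable_mono[OF colourable_msg]) (use assms msg_None[OF assms(4)] in auto)
  fix e show "\<exists>d. near e d \<and> d \<in> {d. \<not> dist2 d m} \<and> (w \<notin> Y \<longrightarrow> d \<noteq> opp_if s (f0 w)) \<and> d \<notin> {}"
    using near_dist2_choice[of e m] assms(3) by blast
qed (use assms in auto)

lemma crossing_type_leaf:
  assumes d: "dist_lab (Node v (Tie w s) (Tie w' s'))"
    and n: "tgt (Node v (Tie w s) (Tie w' s')) \<inter> lab (Node v (Tie w s) (Tie w' s')) = {}"
    and c: "w \<in> Y"
  shows "crossing_type par Y f0 (Node v (Tie w s) (Tie w' s'))"
proof (cases "w' \<in> Y")
  case True
  have steerable: "steerable par Y f0 (Node v (Tie w s) (Tie w' s'))"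
    unfolding steerable_def using steerable_top[OF d n c] True by auto
  have P: "colourable par (Node v (Tie w s) (Tie w' s')) Y f0 (\<lambda>_. True) {}"
    by (rule colourable_mono[OF steerable_top[OF d n c]]) (use True in auto)
  \<comment> \<open>Here v is the only vertex tied into Y, so its colour is compared with
    itself.\<close>
  have "pair_steerable par Y f0 (Node v (Tie w s) (Tie w' s'))"
    unfolding pair_steerable_def by (auto intro: colourable_mono[OF P])
  moreover have "null_unless_pair Y f0 (Node v (Tie w s) (Tie w' s'))"
    unfolding null_unless_pair_def null_when_def
    by (rule bexI[of _ w], rule bexI[of _ w'])
       (use c True in \<open>auto simp: mid_None_iff simp del: mid.simps\<close>)
  ultimately show ?thesis using steerable by (simp add: crossing_type_def)
next
  case False
  have "null_unless_dist2 Y f0 (Node v (Tie w s) (Tie w' s'))"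
    unfolding null_unless_dist2_def null_when_def
  proof (rule bexI[of _ w], rule exI[of _ "f0 w'"], intro allI impI)
    fix g assume "agrees Y f0 (Node v (Tie w s) (Tie w' s')) g" and "\<not> dist2 (g w) (f0 w')"
    moreover from this have "g w' = f0 w'" using False by (auto simp: agrees_def)
    ultimately have "\<not> dist2 (opp_if s (g w)) (opp_if s' (g w'))" by simp
    then show "msg {} g (Node v (Tie w s) (Tie w' s')) = None"
      by (simp add: mid_None_iff del: mid.simps)
  qed (use c in auto)
  moreover have "top_crossing Y (Node v (Tie w s) (Tie w' s'))"
    unfolding top_crossing_def using c False
        by (intro exI[of _ v] exI[of _ w] exI[of _ s] exI[of _ "Tie w' s'"]) auto
  ultimately show ?thesis by (simp add: crossing_type_def)
qed

text \<open>A message \<open>None\<close> from below stays \<open>None\<close>, so nullity passes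
  upwards. Steering passes upwards because avoiding two colours at v costs at most one colour of the
  parent and avoiding one costs none. Only a \<open>top_crossing\<close> of r has to be resolved,
  according to the stub of v.\<close>

lemma crossing_type_step:
  assumes d: "dist_lab (Node v (Tie w s) r)"
    and n: "tgt (Node v (Tie w s) r) \<inter> lab (Node v (Tie w s) r) = {}"
    and cr: "tgt r \<inter> Y \<noteq> {}" and K: "crossing_type par Y f0 r"
  shows "crossing_type par Y f0 (Node v (Tie w s) r)"
proof -
  let ?X = "Node v (Tie w s) r"
  have mN: "msg {} g r = None \<Longrightarrow> msg {} g ?X = None" for g by simp
  have ag: "agrees Y f0 ?X g \<Longrightarrow> agrees Y f0 r g" for g by (simp add: agrees_step)
  have nw: "null_when Y f0 r P \<Longrightarrow> null_when Y f0 ?X P" for P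
    unfolding null_when_def using mN ag by blast
  have L2s: "null_unless_dist2 Y f0 r \<Longrightarrow> null_unless_dist2 Y f0 ?X"
    unfolding null_unless_dist2_def using nw by fastforce
  have top: "w \<in> Y \<Longrightarrow> colourable par ?X Y f0 (\<lambda>f. \<not> dist2 (f v) m) {}" for m
    by (rule steerable_top[OF d n]) (use cr in auto)
  have topz: "w \<in> Y \<Longrightarrow> \<exists>z. colourable par ?X Y f0 (\<lambda>f. \<not> dist2 (f v) m) {z}" for m
    by (rule exI[of _ C0], rule colourable_mono[OF top]) auto
  have topT: "w \<in> Y \<Longrightarrow> colourable par ?X Y f0 (\<lambda>f. \<not> dist2 (f v) (f v)) {}"
    by (rule colourable_mono[OF top]) auto
  have low: "\<exists>z. colourable par ?X Y f0 Q {z}" if P: "colourable par r Y f0 Q {z0}" for Q z0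
  proof -
    obtain z where z: "\<And>e. e \<noteq> z \<Longrightarrow> \<exists>d. near e d \<and> d \<noteq> opp_if s (f0 w) \<and> d \<noteq> z0"
      using near_avoid_two[of "opp_if s (f0 w)" "z0"] by blast
    have "colourable par ?X Y f0 Q {z}"
      by (rule colourable_step[where Q = "\<lambda>_. Q" and B = "\<lambda>_. {z0}"
          and A = UNIV, OF d n P]) (use z in auto)
    then show ?thesis by blast
  qed
  have low0: "colourable par ?X Y f0 Q {}" if P: "colourable par r Y f0 Q {}" for Q
  proof (rule colourable_step[where Q = "\<lambda>_. Q" and B = "\<lambda>_. {}" and A = UNIV, OF d n P])
    fix e show "\<exists>d. near e d \<and> d \<in> UNIV \<and> (w \<notin> Y \<longrightarrow> d \<noteq> opp_if s (f0 w)) \<and> d \<notin> {}"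
      using near_choice[of e "opp_if s (f0 w)"] by blast
  qed auto
  consider "null_but_one Y f0 r" | "null_unless_dist2 Y f0 r"
      "steerable_but_one par Y f0 r" | "null_unless_dist2 Y f0 r" "top_crossing Y r"
    | "steerable par Y f0 r" "pair_steerable par Y f0 r" "null_unless_pair Y f0 r"
    using K by (auto simp: crossing_type_def)
  then show ?thesis
  proof cases
    case 1
    then have "null_but_one Y f0 ?X" unfolding null_but_one_def using nw by fastforce
    then show ?thesis by (simp add: crossing_type_def)
  next
    case 2
    have "steerable_but_one par Y f0 ?X"
      unfolding steerable_but_one_def
    proof (intro allI ballI)
      fix q x m assume "x \<in> crossing Y q ?X"
      then consider "x \<in> crossing Y v r" | "w \<in> Y" "x = v" by (auto split: if_splits)
      then show "\<exists>z. colourable par ?X Y f0 (\<lambda>f. \<not> dist2 (f x) m) {z}"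
      proof cases
        case 1 then show ?thesis using low 2(2) unfolding steerable_but_one_def by blast
      next
        case 2 then show ?thesis using topz by simp
      qed
    qed
    then show ?thesis using L2s 2 by (simp add: crossing_type_def)
  next
    case 4
    have "steerable par Y f0 ?X"
      unfolding steerable_def
    proof (intro allI ballI)
      fix q x m assume "x \<in> crossing Y q ?X"
      then consider "x \<in> crossing Y v r" | "w \<in> Y" "x = v" by (auto split: if_splits)
      then show "colourable par ?X Y f0 (\<lambda>f. \<not> dist2 (f x) m) {}"
      proof cases
        case 1 then show ?thesis using low0 4(1) unfolding steerable_def by blast
      next
        case 2 then show ?thesis using top by simp
      qed
    qed
    moreover have "pair_steerable par Y f0 ?X"
      unfolding pair_steerable_def
    proof (intro allI ballI)
      have vx: "colourable par ?X Y f0 (\<lambda>f. \<not> dist2 (f v) (f x)) {}" if "w \<in> Y"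
          "x \<in> crossing Y v r" for x
      proof (rule colourable_step[where Q = "\<lambda>d f. \<not> dist2 (f x) d" and B = "\<lambda>_. {}"
          and A = UNIV, OF d n])
        show "colourable par r Y f0 (\<lambda>f. \<not> dist2 (f x) d) {}" for d
          using 4(1) that unfolding steerable_def by blast
        fix e show "\<exists>d. near e d \<and> d \<in> UNIV \<and> (w \<notin> Y \<longrightarrow> d \<noteq> opp_if s (f0 w)) \<and> d \<notin> {}"
          using near_choice[of e "opp_if s (f0 w)"] by blast
      qed (auto simp: dist2_sym)
      fix q x1 x2 assume x: "x1 \<in> crossing Y q ?X" "x2 \<in> crossing Y q ?X"
      consider "x1 \<in> crossing Y v r" "x2 \<in> crossing Y v r" | "w \<in> Y" "x1 = v" "x2 = v"
        | "w \<in> Y" "x1 = v" "x2 \<in> crossing Y v r" | "w \<in> Y" "x2 = v" "x1 \<in> crossing Y v r"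
        using x by (auto split: if_splits)
      then show "colourable par ?X Y f0 (\<lambda>f. \<not> dist2 (f x1) (f x2)) {}"
      proof cases
        case 1 then show ?thesis using low0 4(2) unfolding pair_steerable_def by blast
      next
        case 2 then show ?thesis using topT by simp
      next
        case 3 then show ?thesis using vx by blast
      next
        case 4
          have e: "(\<lambda>f. \<not> dist2 (f x1) (f v)) = (\<lambda>f. \<not> dist2 (f v) (f x1))"
            by (rule ext) (simp add: dist2_sym[of "_ x1"])
          show ?thesis using vx[of x1] 4 by (simp add: e)
      qed
    qed
    moreover have "null_unless_pair Y f0 ?X"
      using 4(3) unfolding null_unless_pair_def using nw by fastforce
    ultimately show ?thesis by (simp add: crossing_type_def)
  next
    case 3
    from 3(2) obtain v1 w1 s1 t where r: "r = Node v1 (Tie w1 s1) t \<or> r = Node v1 t (Tie w1 s1)"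
      and w1: "w1 \<in> Y" and t: "tgt t \<inter> Y = {}" unfolding top_crossing_def by blast
    show ?thesis
    proof (cases "w \<in> Y")
      case True
      have "steerable_but_one par Y f0 ?X"
        unfolding steerable_but_one_def
      proof (intro allI ballI)
        fix q x m assume "x \<in> crossing Y q ?X"
        moreover have "crossing Y v1 t = {}" using t Link_cons by (fastforce simp: crossing_iff)
        ultimately consider "x = v" | "x = v1" using r by (auto split: if_splits)
        then show "\<exists>z. colourable par ?X Y f0 (\<lambda>f. \<not> dist2 (f x) m) {z}"
        proof cases
          case 1 then show ?thesis using topz True by simp
        next
          case 2
          \<comment> \<open>The root of r must not be 2 away from m and must differ from the message
            of t; B holds the colours of v from which this fails. There can be two of them, but by
            \<open>two_step_bad\<close> no parent colour other than u has both of its neighbours in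
            B.\<close>
          define B where "B = {e. \<forall>d. near e d \<longrightarrow> dist2 d m \<or> msg Y f0 t = Some d}"
          have sub: "dist_lab (Node v1 (Tie w1 s1) t)"
              "tgt (Node v1 (Tie w1 s1) t) \<inter> lab (Node v1 (Tie w1 s1) t) = {}"
            using r d n by auto
          have tt: "colourable par t Y f0 (\<lambda>_. True) {e. msg Y f0 t = Some e}"
            by (rule colourable_msg) (use sub in auto)
          have "colourable par (Node v1 (Tie w1 s1) t) Y f0 (\<lambda>f. \<not> dist2 (f v1) m) B"
            by (rule colourable_step[where Q = "\<lambda>_ _. True"
                and B = "\<lambda>_. {e. msg Y f0 t = Some e}" and A = "{d. \<not> dist2 d m}", OF sub tt])
               (use w1 in \<open>auto simp: B_def\<close>)
          then have P: "colourable par r Y f0 (\<lambda>f. \<not> dist2 (f x) m) B"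
            using r colourable_swap 2 by metis
          obtain u where u: "\<And>d. msg Y f0 t = Some d \<Longrightarrow> d = u" by (cases "msg Y f0 t") auto
          have "colourable par ?X Y f0 (\<lambda>f. \<not> dist2 (f x) m) {u}"
          proof (rule colourable_step[where Q = "\<lambda>_ f. \<not> dist2 (f x) m" and B = "\<lambda>_. B"
              and A = UNIV, OF d n P])
            fix e assume "e \<notin> {u}"
            then obtain d where "near e d" "d \<notin> B"
              using two_step_bad[of e m u] u unfolding B_def by blast
            then show "\<exists>d. near e d \<and> d \<in> UNIV \<and> (w \<notin> Y \<longrightarrow> d \<noteq> opp_if s (f0 w)) \<and> d \<notin> B"
              using True by blast
          qed auto
          then show ?thesis by blast
        qed
      qed
      then show ?thesis using L2s 3 by (simp add: crossing_type_def)
    next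
      case False
      have "null_but_one Y f0 ?X"
      proof (cases "msg {} f0 t")
        case None
        show ?thesis unfolding null_but_one_def null_when_def
        proof (rule bexI[of _ w1], intro exI allI impI)
          fix g assume "agrees Y f0 ?X g"
          then have "msg {} g t = None" using msg_agrees[OF _ t] None r ag
              by (auto simp: agrees_step)
          then show "msg {} g ?X = None" using r by auto
        qed (use w1 r in auto)
      next
        case (Some u)
        define D where "D = opp_if s (f0 w)"
        \<comment> \<open>The only value of the tie at w1 for which \<open>mid_mid_unique\<close>
          permits a message at all.\<close>
        define a where "a = (if D = up (up (up u)) \<or> up D = u then up (up u) else up (up (opp u)))"
        show ?thesis unfolding null_but_one_def null_when_def
        proof (rule bexI[of _ w1], rule exI[of _ "opp_if s1 a"], intro allI impI)
          fix g assume g: "agrees Y f0 ?X g" and ne: "g w1 \<noteq> opp_if s1 a"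
          then have "msg {} g t = Some u"
              using msg_agrees[OF _ t] Some r ag by (auto simp: agrees_step)
          then have mr: "msg {} g r = mid (Some (opp_if s1 (g w1))) (Some u)"
            using r by (metis empty_iff mid_commute msg.simps(2,3))
          have "g w = f0 w" using g False by (auto simp: agrees_def)
          then have "msg {} g ?X = mid (Some D) (mid (Some (opp_if s1 (g w1))) (Some u))"
            using mr by (simp add: D_def)
          moreover have "opp_if s1 (g w1) \<noteq> a" using ne opp_if_eq_iff by metis
          ultimately show "msg {} g ?X = None"
            using mid_mid_unique[of D "opp_if s1 (g w1)" u] unfolding a_def by argo
        qed (use w1 r in auto)
      qed
      then show ?thesis by (simp add: crossing_type_def)
    qed
  qed
qed

lemma crossing_type_top:
  assumes "w \<in> Y" "tgt r \<inter> Y = {}"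
  shows "crossing_type par Y f0 (Node v (Tie w s) r)"
proof -
  obtain u where u: "\<And>d. msg {} f0 r = Some d \<Longrightarrow> d = u" by (cases "msg {} f0 r") auto
  have "null_unless_dist2 Y f0 (Node v (Tie w s) r)"
    unfolding null_unless_dist2_def null_when_def
  proof (rule bexI[of _ w], rule exI[of _ u], intro allI impI)
    fix g assume "agrees Y f0 (Node v (Tie w s) r) g" and nd: "\<not> dist2 (g w) u"
    then have m: "msg {} g r = msg {} f0 r"
        using msg_agrees[OF _ assms(2)] by (auto simp: agrees_step)
    show "msg {} g (Node v (Tie w s) r) = None"
    proof (cases "msg {} f0 r")
      case (Some d)
      then have "\<not> dist2 (opp_if s (g w)) d" using nd u by simp
      then show ?thesis using Some m by (simp add: mid_None_iff del: mid.simps)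
    qed (simp add: m)
  qed (use assms in auto)
  moreover have "top_crossing Y (Node v (Tie w s) r)"
      unfolding top_crossing_def using assms by blast
  ultimately show ?thesis by (simp add: crossing_type_def)
qed

lemma crossing_type_caterpillar:
  assumes "caterpillar X"
  shows "dist_lab X \<longrightarrow> tgt X \<inter> lab X = {} \<longrightarrow> tgt X \<inter> Y \<noteq> {} \<longrightarrow> crossing_type par Y f0 X"
  using assms
proof (induction rule: caterpillar_induct)
  case (leaf v w s w' s')
  show ?case
  proof (intro impI)
    assume h: "dist_lab (Node v (Tie w s) (Tie w' s'))"
      "tgt (Node v (Tie w s) (Tie w' s')) \<inter> lab (Node v (Tie w s) (Tie w' s')) = {}"
      "tgt (Node v (Tie w s) (Tie w' s')) \<inter> Y \<noteq> {}"
    then consider "w \<in> Y" | "w' \<in> Y" by auto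
    then show "crossing_type par Y f0 (Node v (Tie w s) (Tie w' s'))"
    proof cases
      case 1 then show ?thesis using h by (intro crossing_type_leaf) auto
    next
      case 2 then show ?thesis using h by (intro crossing_type_swap[OF crossing_type_leaf]) auto
    qed
  qed
next
  case (step v w s r)
  show ?case
  proof (intro impI)
    assume h: "dist_lab (Node v (Tie w s) r)"
        "tgt (Node v (Tie w s) r) \<inter> lab (Node v (Tie w s) r) = {}"
      "tgt (Node v (Tie w s) r) \<inter> Y \<noteq> {}"
    show "crossing_type par Y f0 (Node v (Tie w s) r)"
    proof (cases "tgt r \<inter> Y = {}")
      case True then show ?thesis using h by (intro crossing_type_top) auto
    next
      case False
      then have "crossing_type par Y f0 r" using step.IH h by auto
      then show ?thesis using h False by (intro crossing_type_step) auto
    qed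
  qed
next
  case (swap v l r)
  then show ?case using crossing_type_swap[of par Y f0 v l r] by auto
qed

text \<open>The vertex x has to avoid a and at most one more colour, from its other tie or from
  below; each vertex above avoids the value of its stub and the bad colour handed up to it. Two
  exclusions block at most one colour of the parent.\<close>

lemma avoid_one:
  assumes "caterpillar X"
  shows "dist_lab X \<longrightarrow> tgt X \<inter> lab X = {} \<longrightarrow> x \<in> crossing Y q X \<longrightarrow>
      (\<exists>z. colourable par X Y f0 (\<lambda>f. f x \<noteq> a) {z})"
  using assms
proof (induction rule: caterpillar_induct)
  case (leaf v w s w' s')
  have "\<exists>z. colourable par (Node v (Tie w s) (Tie w' s')) Y f0 (\<lambda>f. f v \<noteq> a) {z}"
    if h: "dist_lab (Node v (Tie w s) (Tie w' s'))"
      "tgt (Node v (Tie w s) (Tie w' s')) \<inter> lab (Node v (Tie w s) (Tie w' s')) = {}"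
          "w \<in> Y" for w s w' s'
  proof -
    obtain z where z: "\<And>e. e \<noteq> z \<Longrightarrow> \<exists>d. near e d \<and> d \<noteq> opp_if s' (f0 w') \<and> d \<noteq> a"
      using near_avoid_two[of "opp_if s' (f0 w')" "a"] by blast
    have "colourable par (Node v (Tie w s) (Tie w' s')) Y f0 (\<lambda>f. f v \<noteq> a) {z}"
      by (rule colourable_step[where A =
          "{d. d \<noteq> a}", OF h(1,2) colourable_Tie]) (use z h(3) in auto)
    then show ?thesis by blast
  qed
  from this[of w s w' s'] this[of w' s' w s] show ?case
    by (auto simp: colourable_swap[of par v "Tie w' s'" "Tie w s"] split: if_splits)
next
  case (step v w s r)
  show ?case
  proof (intro impI)
    assume h: "dist_lab (Node v (Tie w s) r)"
        "tgt (Node v (Tie w s) r) \<inter> lab (Node v (Tie w s) r) = {}"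
      and x: "x \<in> crossing Y q (Node v (Tie w s) r)"
    obtain v1 l1 r1 where r: "r = Node v1 l1 r1" using caterpillar_Node[OF step.hyps] by blast
    from x consider "x \<in> crossing Y q r" | "x = v" "w \<in> Y" using r by (auto split: if_splits)
    then show "\<exists>z. colourable par (Node v (Tie w s) r) Y f0 (\<lambda>f. f x \<noteq> a) {z}"
    proof cases
      case 1
      then obtain z0 where P: "colourable par r Y f0 (\<lambda>f. f x \<noteq> a) {z0}" using step.IH h by auto
      obtain z where z: "\<And>e. e \<noteq> z \<Longrightarrow> \<exists>d. near e d \<and> d \<noteq> opp_if s (f0 w) \<and> d \<noteq> z0"
        using near_avoid_two[of "opp_if s (f0 w)" "z0"] by blast
      have "colourable par (Node v (Tie w s) r) Y f0 (\<lambda>f. f x \<noteq> a) {z}"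
        by (rule colourable_step[where A = UNIV, OF h P]) (use z in auto)
      then show ?thesis by blast
    next
      case 2
      obtain u where u: "\<And>d. msg Y f0 r = Some d \<Longrightarrow> d = u" by (cases "msg Y f0 r") auto
      obtain z where z: "\<And>e. e \<noteq> z \<Longrightarrow> \<exists>d. near e d \<and> d \<noteq> a \<and> d \<noteq> u"
        using near_avoid_two[of "a" "u"] by blast
      have P: "colourable par r Y f0 (\<lambda>_. True) {e. msg Y f0 r = Some e}"
        by (rule colourable_msg) (use h in auto)
      have "colourable par (Node v (Tie w s) r) Y f0 (\<lambda>f. f x \<noteq> a) {z}"
        by (rule colourable_step[where A = "{d. d \<noteq> a}", OF h P]) (use z u 2 in blast)+
      then show ?thesis by blast
    qed
  qed
next
  case (swap v l r)
  then show ?case using colourable_swap[of par v l r] by (auto simp: Un_commute)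
qed

section \<open>Colouring two siblings with ties between them\<close>

lemma vars_nonlink: "k \<in> cons q t \<Longrightarrow> vars k \<subseteq> insert q (lab t) \<or>
    (\<exists>x w s. k = Link x w s \<and> x \<in> insert q (lab t) \<and> w \<in> tgt t)"
  by (induction q t rule: cons.induct) auto

lemma near_dist2_pair: obtains d d' where "near e d" "near e d'" "dist2 d d'"
proof -
  have "near e (up e)" "near e (up (up (up (opp e))))" "dist2 (up e) (up (up (up (opp e))))"
    by (cases e; simp add: near_def dist2_def)+
  then show ?thesis using that by blast
qed

text \<open>Up to adding 4 there are only two colours of each parity, and \<open>dist2\<close>
  relates different ones.\<close>

lemma dist2_no_triangle: "dist2 a b \<Longrightarrow> dist2 b c \<Longrightarrow> dist2 a c \<Longrightarrow> False"
  by (cases a; cases b; cases c; simp add: dist2_def)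

lemma pre_swap: "extends par f q (Node y l r) Y f2 = extends par f q (Node y r l) Y f2"
  unfolding extends_def by (simp add: Un_commute Un_left_commute conj_commute)

text \<open>Each tie between the siblings is listed at both ends, so whichever sibling is coloured
  last answers for all of them.\<close>

definition cross :: "('v \<Rightarrow> bool) \<Rightarrow> ('v \<Rightarrow> col) \<Rightarrow> 'v \<Rightarrow> 'v \<Rightarrow> 'v item \<Rightarrow> 'v item \<Rightarrow> bool" where
  "cross par f q y X X' \<longleftrightarrow> caterpillar X \<and> caterpillar X' \<and> dist_lab (Node y X X') \<and>
      tgt X \<inter> lab X = {} \<and> tgt X' \<inter> lab X' = {} \<and>
     y \<notin> tgt X \<and> y \<notin> tgt X' \<and> q \<notin> lab (Node y X X') \<and> tgt X \<inter> lab X' \<noteq> {} \<and> tgt X' \<inter> lab X \<noteq> {} \<and>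
     par_ok par f \<and> (\<forall>k\<in>cons q (Node y X X'). par_con par k) \<and>
     (\<forall>x w s. Link x w s \<in> cons y X \<longrightarrow> w \<in> lab X' \<longrightarrow> Link w x s \<in> cons y X') \<and>
     (\<forall>x w s. Link x w s \<in> cons y X' \<longrightarrow> w \<in> lab X \<longrightarrow> Link w x s \<in> cons y X)"

lemma cross_sym: "cross par f q y X X' \<Longrightarrow> cross par f q y X' X"
proof -
  have "dist_lab (Node y X' X) = dist_lab (Node y X X')" "lab (Node y X' X) = lab (Node y X X')"
    "cons q (Node y X' X) = cons q (Node y X X')" by auto
  then show "cross par f q y X X' \<Longrightarrow> cross par f q y X' X"
    unfolding cross_def by argo
qed

text \<open>Colour y, then X' without its ties into X, then X, whose message is \<open>None\<close>
  by then. One bad colour z of y is harmless, since y has two colours next to that of q.\<close>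

lemma cross_color:
  assumes c: "cross par f q y X X'"
    and P: "colourable par X' (lab X) f Q {z}"
    and M: "\<And>g. agrees (lab X') f X g \<Longrightarrow> Q g \<Longrightarrow> msg {} g X = None"
  shows "\<exists>f2. extends par f q (Node y X X') {} f2"
proof -
  have dist_lab: "dist_lab (Node y X X')" and yt: "y \<notin> tgt X" "y \<notin> tgt X'"
      and q: "q \<notin> lab (Node y X X')"
    and pk: "par_ok par f" and pa: "\<forall>k\<in>cons q (Node y X X'). par_con par k"
    and i: "tgt X \<inter> lab X = {}" "tgt X' \<inter> lab X' = {}"
    and sym: "\<And>x w s. Link x w s \<in> cons y X' \<Longrightarrow> w \<in> lab X \<Longrightarrow> Link w x s \<in> cons y X"
    using c unfolding cross_def by blast+
  obtain d where d: "near (f q) d" "d \<noteq> z" by (rule near_choice)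
  define f1 where "f1 = f(y := d)"
  have "par q \<noteq> par y" using pa[rule_format, of "Near q y"] by simp
  then have pk1: "par_ok par f1" using pk near_even_col[OF d(1)] by (auto simp: par_ok_def f1_def)
  have "\<exists>f2. extends par f1 y X' (lab X) f2 \<and> Q f2"
  proof (rule P[unfolded colourable_def, rule_format])
    show "f1 w = f w" if "w \<in> tgt X' - lab X" for w using that yt by (auto simp: f1_def)
    show "par_ok par f1" by (rule pk1)
    show "y \<notin> lab X'" using dist_lab by auto
    show "par_con par k" if "k \<in> cons y X'" for k using pa that by auto
    show "f1 y \<notin> {z}" using d by (auto simp: f1_def)
  qed
  then obtain f2 where f2: "extends par f1 y X' (lab X) f2" "Q f2" by blast
  have a2: "f2 x = f1 x" if "x \<notin> lab X'" for x using f2 that by (simp add: extends_def)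
  have m: "msg {} f2 X = None"
  proof (rule M[OF _ f2(2)])
    show "agrees (lab X') f X f2" unfolding agrees_def
    proof
      fix w assume "w \<in> tgt X - lab X'"
      then show "f2 w = f w" using a2[of w] yt by (auto simp: f1_def)
    qed
  qed
  have "\<exists>f3. extends par f2 y X {} f3 \<and> True"
  proof (rule colourable_msg[of X, unfolded colourable_def, rule_format,
      where f = f2 and ?f0.0 = f2])
    show "dist_lab X" "tgt X \<inter> lab X = {}" "y \<notin> lab X" using dist_lab i by auto
    show "par_ok par f2" using f2 by (simp add: extends_def)
    show "par_con par k" if "k \<in> cons y X" for k using pa that by auto
  qed (use m in auto)
  then obtain f3 where f3: "extends par f2 y X {} f3" by blast
  have a3: "f3 x = f2 x" if "x \<notin> lab X" for x using f3 that by (simp add: extends_def)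
  have s3: "sat f3 k" if "k \<in> cons y X" for k using f3 that by (auto simp: extends_def)
  have f3y: "f3 y = d" using a3[of y] a2[of y] dist_lab by (auto simp: f1_def)
  have f3q: "f3 q = f q" using a3[of q] a2[of q] q by (auto simp: f1_def)
  have "extends par f q (Node y X X') {} f3"
    unfolding extends_def
  proof (intro conjI allI impI ballI)
    fix x assume "x \<notin> lab (Node y X X')"
    then show "f3 x = f x" using a3[of x] a2[of x] by (auto simp: f1_def)
  next
    show "par_ok par f3" using f3 by (simp add: extends_def)
  next
    fix k assume k: "k \<in> cons q (Node y X X')"
    then consider "k = Near q y \<or> k = Near y q" | "k \<in> cons y X" | "k \<in> cons y X'" by auto
    then have "sat f3 k"
    proof cases
      case 1 then show ?thesis using d(1) f3y f3q by (auto simp: near_sym)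
    next
      case 2 then show ?thesis by (rule s3)
    next
      case 3
      show ?thesis
      proof (cases "\<exists>x w s. k = Link x w s \<and> w \<in> lab X")
        case True
        then obtain x w s where k: "k = Link x w s" "w \<in> lab X" by blast
        then have "sat f3 (Link w x s)" using sym 3 s3 by blast
        then show ?thesis using k by (auto simp: opp_if_eq_iff)
      next
        case False
        have "sat f3 k = sat f2 k"
        proof (rule sat_cong)
          fix x assume "x \<in> vars k"
          then have "x \<notin> lab X" using vars_nonlink[OF 3] False dist_lab by auto
          then show "f3 x = f2 x" by (rule a3)
        qed
        then show ?thesis using f2 3 False unfolding extends_def by blast
      qed
    qed
    then show "sat f3 k \<or> (\<exists>x w s. k = Link x w s \<and> w \<in> {})" by simp
  qed
  then show ?thesis by blast
qed

lemma cross_crossing: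
  assumes "cross par f q y X X'" "x' \<in> lab X' \<inter> tgt X"
  shows "x' \<in> crossing (lab X) y X'"
proof -
  from assms(2) obtain x s where "Link x x' s \<in> cons y X" using tgt_Link[of x' X y] by blast
  moreover have "caterpillar X" using assms(1) unfolding cross_def by blast
  then obtain v l r where "X = Node v l r" using caterpillar_Node by blast
  ultimately have "x \<in> lab X" using Link_cons_Node by metis
  moreover have "Link x' x s \<in> cons y X'"
    using \<open>Link x x' s \<in> cons y X\<close> assms(2) assms(1)[unfolded cross_def] by blast
  ultimately show ?thesis by (auto simp: crossing_iff)
qed

text \<open>In each case the nullity of X asks for a colouring of X' of a certain kind, and the
  other property says that X' has one. For \<open>null_but_one\<close> every caterpillar will do, by
  \<open>avoid_one\<close>.\<close>

lemma cross_half: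
  assumes c: "cross par f q y X X'" and KX: "crossing_type par (lab X') f X"
      and KX': "crossing_type par (lab X) f X'"
    and "null_but_one (lab X') f X \<or>
        null_unless_dist2 (lab X') f X \<and> (steerable_but_one par (lab X) f X' \<or>
        steerable par (lab X) f X') \<or>
      null_unless_pair (lab X') f X \<and> pair_steerable par (lab X) f X'"
  shows "\<exists>f2. extends par f q (Node y X X') {} f2"
  using assms(4)
proof (elim disjE conjE)
  assume "null_but_one (lab X') f X"
  then obtain x' a where x': "x' \<in> lab X' \<inter> tgt X"
    and M: "\<And>g. agrees (lab X') f X g \<Longrightarrow> g x' \<noteq> a \<Longrightarrow>
        msg {} g X = None" unfolding null_but_one_def null_when_def by blast
  have "caterpillar X'" "dist_lab X'" "tgt X' \<inter> lab X' = {}" using c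
      unfolding cross_def dist_lab.simps by blast+
  then obtain z where "colourable par X' (lab X) f (\<lambda>f. f x' \<noteq> a) {z}"
    using avoid_one[where X = X' and x = x' and Y = "lab X" and par = par and ?f0.0 = f
        and a = a] cross_crossing[OF c x']
    by blast
  from cross_color[OF c this M] show ?thesis by blast
next
  assume "null_unless_dist2 (lab X') f X"
  then obtain x' m where x': "x' \<in> lab X' \<inter> tgt X"
    and M: "\<And>g. agrees (lab X') f X g \<Longrightarrow> \<not> dist2 (g x') m \<Longrightarrow>
        msg {} g X = None" unfolding null_unless_dist2_def null_when_def by blast
  { assume k: "steerable_but_one par (lab X) f X'"
    obtain z where "colourable par X' (lab X) f (\<lambda>f. \<not> dist2 (f x') m) {z}"
      using k[unfolded steerable_but_one_def, rule_format, OF cross_crossing[OF c x'], of m]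
          by blast
    from cross_color[OF c this M] show ?thesis by blast
  next
    assume k: "steerable par (lab X) f X'"
    have "colourable par X' (lab X) f (\<lambda>f. \<not> dist2 (f x') m) {}"
      using k[unfolded steerable_def, rule_format, OF cross_crossing[OF c x'], of m] .
    \<comment> \<open>\<open>cross_color\<close> expects a single bad colour; with none present,
      \<open>C0\<close> is an arbitrary choice.\<close>
    then have "colourable par X' (lab X) f (\<lambda>f. \<not> dist2 (f x') m) {C0}"
        by (rule colourable_mono) auto
    from cross_color[OF c this M] show ?thesis by blast
  }
next
  assume "null_unless_pair (lab X') f X" and ld: "pair_steerable par (lab X) f X'"
  then obtain x1 x2 where x: "x1 \<in> lab X' \<inter> tgt X" "x2 \<in> lab X' \<inter> tgt X"
    and M: "\<And>g. agrees (lab X') f X g \<Longrightarrow> \<not> dist2 (g x1) (g x2) \<Longrightarrow>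
        msg {} g X = None" unfolding null_unless_pair_def null_when_def by blast
  have "colourable par X' (lab X) f (\<lambda>f. \<not> dist2 (f x1) (f x2)) {}"
    using ld[unfolded pair_steerable_def, rule_format,
        OF cross_crossing[OF c x(1)] cross_crossing[OF c x(2)]] .
  then have "colourable par X' (lab X) f (\<lambda>f. \<not> dist2 (f x1) (f x2)) {C0}"
      by (rule colourable_mono) auto
  from cross_color[OF c this M] show ?thesis by blast
qed

text \<open>Either sibling may be coloured first, and each combination of types fits one of the two
  orders unless both siblings are of the provisional type \<open>top_crossing\<close>.\<close>

lemma cross_ext:
  assumes c: "cross par f q y X X'"
  shows "(\<exists>f2. extends par f q (Node y X X') {} f2) \<or>
      top_crossing (lab X') X \<and> top_crossing (lab X) X'"
proof -
  have KX: "crossing_type par (lab X') f X"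
      using crossing_type_caterpillar[of X "lab X'" par f] c
      unfolding cross_def dist_lab.simps by blast
  have KX': "crossing_type par (lab X) f X'"
      using crossing_type_caterpillar[of X' "lab X" par f] c
      unfolding cross_def dist_lab.simps by blast
  have h: "null_but_one (lab X') f X \<or>
      null_unless_dist2 (lab X') f X \<and> (steerable_but_one par (lab X) f X' \<or>
      steerable par (lab X) f X') \<or>
      null_unless_pair (lab X') f X \<and> pair_steerable par (lab X) f X' \<Longrightarrow>
          \<exists>f2. extends par f q (Node y X X') {} f2"
    using cross_half[OF c KX KX'] by blast
  have h': "null_but_one (lab X) f X' \<or>
      null_unless_dist2 (lab X) f X' \<and> (steerable_but_one par (lab X') f X \<or>
      steerable par (lab X') f X) \<or>
      null_unless_pair (lab X) f X' \<and> pair_steerable par (lab X') f X \<Longrightarrow>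
          \<exists>f2. extends par f q (Node y X X') {} f2"
    using cross_half[OF cross_sym[OF c] KX' KX] by (simp only: pre_swap[of par f q y X X'])
  show ?thesis using KX KX' h h' unfolding crossing_type_def by argo
qed

section \<open>Ties to the root of a subtree and between its children\<close>

lemma msg_link_root:
  assumes "caterpillar X" "dist2 d d'"
  shows "y \<in> tgt X \<longrightarrow> msg {} (f(y := d)) X = None \<or> msg {} (f(y := d')) X = None"
  using assms(1)
\<comment> \<open>At the lowest vertex tied to y, the other value is either fixed, and then by
  \<open>dist2_no_triangle\<close> not 2 away from both d and d', or comes from y as well, and then
  there is no midpoint. A \<open>None\<close> there propagates to the top.\<close>
proof (induction rule: caterpillar_induct)
  case (leaf v w s w' s')
  show ?case
    using assms(2) dist2_no_triangle[of d d' "f w"] dist2_no_triangle[of d d' "f w'"]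
        by (auto simp: mid_None_iff dist2_sym simp del: mid.simps)
next
  case (step v w s r)
  show ?case
  proof (cases "y \<in> tgt r")
    case True then show ?thesis using step.IH by auto
  next
    case False
    show ?thesis
    proof (intro impI)
      assume "y \<in> tgt (Node v (Tie w s) r)"
      then have y: "y = w" using False by simp
      have r: "msg {} (f(y := c)) r = msg {} f r" for c
        using False by (intro msg_cong) auto
      have "msg {} (f(y := c)) (Node v (Tie w s) r) = mid (Some (opp_if s c)) (msg {} f r)" for c
        by (simp only: msg.simps r) (simp add: y)
      then show "msg {} (f(y := d)) (Node v (Tie w s) r) = None \<or>
          msg {} (f(y := d')) (Node v (Tie w s) r) = None"
        using assms(2) dist2_no_triangle[of d d' "the (msg {} f r)"]
        by (cases "msg {} f r") (auto simp: mid_None_iff dist2_sym simp del: mid.simps msg.simps)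
    qed
  qed
next
  case (swap v l r)
  then show ?case by (auto simp: mid_commute)
qed

text \<open>The two colours available to y are 2 apart, so \<open>msg_link_root\<close> makes the
  message of X \<open>None\<close> for one of them. The stub of y itself is settled by its copy in
  X.\<close>

lemma root_link_ext:
  assumes dist_lab: "dist_lab (Node y (Tie x s) X)" and X: "caterpillar X" "tgt X \<inter> lab X = {}"
    and L: "Link x y s \<in> cons y X" and q: "q \<notin> lab (Node y (Tie x s) X)"
    and pk: "par_ok par f" and pa: "\<forall>k\<in>cons q (Node y (Tie x s) X). par_con par k"
  shows "\<exists>f2. extends par f q (Node y (Tie x s) X) {} f2"
proof -
  have yX: "y \<in> tgt X" using Link_cons[OF L] by blast
  obtain d where d: "near (f q) d" "msg {} (f(y := d)) X = None"
    using near_dist2_pair[of "f q"] msg_link_root[OF X(1), of _ _ y f] yX by metis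
  define f1 where "f1 = f(y := d)"
  have "par q \<noteq> par y" using pa[rule_format, of "Near q y"] by simp
  then have pk1: "par_ok par f1" using pk near_even_col[OF d(1)] by (auto simp: par_ok_def f1_def)
  have "\<exists>f3. extends par f1 y X {} f3 \<and> True"
  proof (rule colourable_msg[of X, unfolded colourable_def, rule_format,
      where f = f1 and ?f0.0 = f1])
    show "dist_lab X" "tgt X \<inter> lab X = {}" "y \<notin> lab X" using dist_lab X by auto
    show "par_ok par f1" by (rule pk1)
    show "par_con par k" if "k \<in> cons y X" for k using pa that by auto
  qed (use d in \<open>auto simp: f1_def\<close>)
  then obtain f3 where f3: "extends par f1 y X {} f3" by blast
  have a3: "f3 z = f1 z" if "z \<notin> lab X" for z using f3 that by (simp add: extends_def)
  have s3: "sat f3 k" if "k \<in> cons y X" for k using f3 that by (auto simp: extends_def)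
  have f3y: "f3 y = d" using a3[of y] dist_lab by (auto simp: f1_def)
  have f3q: "f3 q = f q" using a3[of q] q by (auto simp: f1_def)
  have "extends par f q (Node y (Tie x s) X) {} f3"
    unfolding extends_def
  proof (intro conjI allI impI ballI)
    fix z assume "z \<notin> lab (Node y (Tie x s) X)"
    then show "f3 z = f z" using a3[of z] by (auto simp: f1_def)
  next
    show "par_ok par f3" using f3 by (simp add: extends_def)
  next
    fix k assume k: "k \<in> cons q (Node y (Tie x s) X)"
    have "sat f3 (Link x y s)" using s3 L by blast
    then have "sat f3 (Link y x s)" by (auto simp: opp_if_eq_iff)
    then show "sat f3 k \<or> (\<exists>x w s. k = Link x w s \<and> w \<in> {})"
      using k s3 d(1) f3y f3q by (auto simp: near_sym)
  qed
  then show ?thesis by blast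
qed

text \<open>If s holds, the tie forbids opposite colours, which two colours next to d never are.
  Otherwise a and a' must be d - 1 and d + 1, one of which is e. The other can be e + 2 or e - 2, by
  the choice of d, and so avoids its message; thus only m = m' = e is fatal.\<close>

lemma cherry_colors:
  assumes "s \<or> m \<noteq> Some e \<or> m' \<noteq> Some e"
  shows "\<exists>d a a'. near e d \<and> near d a \<and> near d a' \<and> m \<noteq> Some a \<and> m' \<noteq> Some a' \<and> a \<noteq> opp_if s a'"
proof (cases s)
  case True
  obtain d where d: "near e d" using near_choice by blast
  obtain a where a: "near d a" "m \<noteq> Some a" using mid_choice[of m None d] by auto
  obtain a' where a': "near d a'" "m' \<noteq> Some a'" using mid_choice[of m' None d] by auto
  have "a \<noteq> opp_if s a'"
    using near_dist2[OF a(1) a'(1)] True by (cases a; cases a'; simp add: dist2_def opp_if_def)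
  then show ?thesis using d a a' by blast
next
  case False
  have *: "\<exists>d b. near e d \<and> near d e \<and> near d b \<and> b \<noteq> e \<and> k \<noteq> Some b" for k
  proof -
    have n: "near e (up e)" "near (up e) e" "near (up e) (up (up e))"
      "near e (up (up (up (opp e))))" "near (up (up (up (opp e)))) e"
      "near (up (up (up (opp e)))) (up (up (opp e)))" "up (up e) \<noteq> up (up (opp e))"
      "up (up e) \<noteq> e" "up (up (opp e)) \<noteq> e"
      by (cases e; simp add: near_def)+
    then show ?thesis by (cases "k = Some (up (up e))") blast+
  qed
  show ?thesis
  proof (cases "m = Some e")
    case True
    then have "m' \<noteq> Some e" using assms False by blast
    then show ?thesis using *[of m] False by fastforce
  next
    case m: False
    then show ?thesis using *[of m'] False by fastforce
  qed
qed

lemma cherry_ext: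
  fixes t t' :: "'v item" and y v v' :: 'v and s :: bool
  defines "Z \<equiv> Node y (Node v (Tie v' s) t) (Node v' (Tie v s) t')"
  assumes dist_lab: "dist_lab Z" and t: "tgt t \<inter> lab Z = {}" "tgt t' \<inter> lab Z = {}"
      and q: "q \<notin> lab Z"
    and pk: "par_ok par f" and pa: "\<forall>k\<in>cons q Z. par_con par k"
    and m: "s \<or> msg {} f t \<noteq> Some (f q) \<or> msg {} f t' \<noteq> Some (f q)"
  shows "\<exists>f2. extends par f q Z {} f2"
proof -
  obtain d a a' where d: "near (f q) d" "near d a" "near d a'" "msg {} f t \<noteq> Some a"
    "msg {} f t' \<noteq> Some a'" "a \<noteq> opp_if s a'" using cherry_colors[OF m] by blast
  define f1 where "f1 = f(y := d, v := a, v' := a')"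
  have dd: "y \<noteq> v" "y \<noteq> v'" "v \<noteq> v'" "y \<notin> lab t" "y \<notin> lab t'" "v \<notin> lab t" "v \<notin> lab t'"
    "v' \<notin> lab t" "v' \<notin> lab t'" "lab t \<inter> lab t' = {}" "dist_lab t" "dist_lab t'"
    using dist_lab by (auto simp: Z_def)
  have qq: "q \<noteq> y" "q \<noteq> v" "q \<noteq> v'" "q \<notin> lab t" "q \<notin> lab t'" using q by (auto simp: Z_def)
  have tt: "tgt t \<inter> lab t = {}" "tgt t' \<inter> lab t' = {}" "tgt t \<inter> {y,v,v'} = {}"
      "tgt t' \<inter> {y,v,v'} = {}"
    "tgt t' \<inter> lab t = {}" "tgt t \<inter> lab t' = {}"
    using t by (auto simp: Z_def)
  have "par q \<noteq> par y" "par y \<noteq> par v" "par y \<noteq> par v'"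
    using pa[rule_format, of "Near q y"] pa[rule_format, of "Near y v"] pa[rule_format,
        of "Near y v'"]
    by (auto simp: Z_def)
  then have pk1: "par_ok par f1"
      using pk d(1-3)[THEN near_even_col] by (auto simp: par_ok_def f1_def)
  have m1: "msg {} f1 t = msg {} f t" using tt by (intro msg_cong) (auto simp: f1_def)
  have "\<exists>f3. extends par f1 v t {} f3 \<and> True"
  proof (rule colourable_msg[of t, unfolded colourable_def, rule_format,
      where f = f1 and ?f0.0 = f1])
    show "dist_lab t" "tgt t \<inter> lab t = {}" "v \<notin> lab t" using dd tt by auto
    show "par_ok par f1" by (rule pk1)
    show "par_con par k" if "k \<in> cons v t" for k using pa that by (auto simp: Z_def)
    show "f1 v \<notin> {e. msg {} f1 t = Some e}" using d dd m1 by (auto simp: f1_def)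
  qed auto
  then obtain f2 where f2: "extends par f1 v t {} f2" by blast
  have a2: "f2 z = f1 z" if "z \<notin> lab t" for z using f2 that by (simp add: extends_def)
  have s2: "sat f2 k" if "k \<in> cons v t" for k using f2 that by (auto simp: extends_def)
  have m2: "msg {} f2 t' = msg {} f t'"
  proof (rule msg_cong)
    fix w assume "w \<in> tgt t' - {}"
    then have "w \<notin> lab t" "w \<noteq> y" "w \<noteq> v" "w \<noteq> v'" using tt by blast+
    then show "f2 w = f w" using a2[of w] by (simp add: f1_def)
  qed
  have "\<exists>f3. extends par f2 v' t' {} f3 \<and> True"
  proof (rule colourable_msg[of t', unfolded colourable_def, rule_format,
      where f = f2 and ?f0.0 = f2])
    show "dist_lab t'" "tgt t' \<inter> lab t' = {}" "v' \<notin> lab t'" using dd tt by auto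
    show "par_ok par f2" using f2 by (simp add: extends_def)
    show "par_con par k" if "k \<in> cons v' t'" for k using pa that by (auto simp: Z_def)
    show "f2 v' \<notin> {e. msg {} f2 t' = Some e}" using d dd m2 a2[of v'] by (auto simp: f1_def)
  qed auto
  then obtain f3 where f3: "extends par f2 v' t' {} f3" by blast
  have a3: "f3 z = f2 z" if "z \<notin> lab t'" for z using f3 that by (simp add: extends_def)
  have s3: "sat f3 k" if "k \<in> cons v' t'" for k using f3 that by (auto simp: extends_def)
  have s23: "sat f3 k" if "k \<in> cons v t" for k
  proof -
    have "sat f3 k = sat f2 k"
    proof (rule sat_cong)
      fix x assume "x \<in> vars k"
      then have "x \<notin> lab t'" using vars_cons[OF that] dd tt by auto
      then show "f3 x = f2 x" by (rule a3)
    qed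
    then show ?thesis using s2 that by simp
  qed
  have vals: "f3 y = d" "f3 v = a" "f3 v' = a'" "f3 q = f q"
    using a3 a2 dd qq by (auto simp: f1_def)
  have "extends par f q Z {} f3"
    unfolding extends_def
  proof (intro conjI allI impI ballI)
    fix z assume "z \<notin> lab Z"
    then show "f3 z = f z" using a3[of z] a2[of z] by (auto simp: f1_def Z_def)
  next
    show "par_ok par f3" using f3 by (simp add: extends_def)
  next
    fix k assume k: "k \<in> cons q Z"
    have "a' \<noteq> opp_if s a" using d(6) by (auto simp: opp_if_eq_iff)
    then have "sat f3 k" using k s3 s23 d vals by (auto simp: near_sym Z_def)
    then show "sat f3 k \<or> (\<exists>x w s. k = Link x w s \<and> w \<in> {})" by simp
  qed
  then show ?thesis by blast
qed

section \<open>Messages controlled by excluded colours\<close>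

text \<open>One colour b x serves all ties of x, as seen from x. At the far end of a tie this demand
  is an excluded colour, which takes the place of the stub that is lost there.\<close>

definition avoid :: "('v \<Rightarrow> col) \<Rightarrow> ('v \<Rightarrow> col) \<Rightarrow> 'v \<Rightarrow> 'v item \<Rightarrow> bool" where
  "avoid b f q t \<longleftrightarrow> (\<forall>x w s. Link x w s \<in> cons q t \<longrightarrow> opp_if s (f w) \<noteq> b x)"

definition default_col :: "('v \<Rightarrow> bool) \<Rightarrow> 'v \<Rightarrow> col" where
  "default_col par x = (if par x then C0 else C1)"

lemma par_ok_default_col: "par_ok par (default_col par)"
  by (simp add: par_ok_def default_col_def)

text \<open>As z' is z - 3, both b and c are among z - 1, z + 1, z + 3, whose midpoints are z and z
  + 2.\<close>

lemma mid_excl3: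
  "even_col b = even_col z' \<Longrightarrow> even_col c = even_col z' \<Longrightarrow> z' = up (opp z) \<Longrightarrow> b \<noteq> z' \<Longrightarrow> c \<noteq> z' \<Longrightarrow>
   mid (Some b) (Some c) \<in> {None, Some z, Some (up (up z))}"
  by (cases z; cases b; simp; cases c; simp)

text \<open>Here m is \<open>None\<close>, z - 1 or z + 1, while b is z - 1, z + 1 or z + 3.\<close>

lemma mid_excl1:
  "even_col b = even_col z' \<Longrightarrow> z' = up (opp z) \<Longrightarrow> b \<noteq> z' \<Longrightarrow>
   m \<in> {None, Some (up (up (up (opp z)))), Some (up (up (up (up (up (opp z))))))} \<Longrightarrow>
   mid (Some b) m \<in> {None, Some z, Some (up (up z))}"
  by (cases z; cases b; auto)

text \<open>One excluded colour per vertex keeps the message within a pair of colours all along the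
  path. The pair may be placed anywhere, and this is what counts later: two pairs are made equal to
  get a single midpoint, or disjoint to keep two messages apart.\<close>

lemma msg_two_values:
  assumes "caterpillar t"
  shows "\<forall>q z. dist_lab t \<longrightarrow> (\<forall>k\<in>cons q t. par_con par k) \<longrightarrow> even_col z = par q \<longrightarrow>
    (\<exists>b. par_ok par b \<and> (\<forall>f. par_ok par f \<longrightarrow> avoid b f q t \<longrightarrow>
        msg {} f t \<in> {None, Some z, Some (up (up z))}))"
  using assms
proof (induction rule: caterpillar_induct)
  case (leaf v w s w' s')
  show ?case
  proof (intro allI impI)
    fix q z
    assume pa: "\<forall>k\<in>cons q (Node v (Tie w s) (Tie w' s')). par_con par k" and z: "even_col z = par q"
    let ?z = "up (opp z)"
    have p: "par q \<noteq> par v" "par v = par w" "par v = par w'" using pa by auto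
    have ez: "even_col ?z = par v" using p z by (cases z; simp)
    define b where "b = (default_col par)(v := ?z)"
    have "par_ok par b" using par_ok_default_col[of par] ez by (auto simp: par_ok_def b_def)
    moreover have "msg {} f (Node v (Tie w s) (Tie w' s')) \<in> {None, Some z, Some (up (up z))}"
      if f: "par_ok par f" and av: "avoid b f q (Node v (Tie w s) (Tie w' s'))" for f
    proof -
      have "opp_if s (f w) \<noteq> ?z" "opp_if s' (f w') \<noteq> ?z" using av by (auto simp: avoid_def b_def)
      then have "mid (Some (opp_if s (f w))) (Some (opp_if s' (f w'))) \<in> {None, Some z,
          Some (up (up z))}"
        using f p ez by (intro mid_excl3[of _ ?z]) (auto simp: par_ok_def)
      then show ?thesis by simp
    qed
    ultimately show "\<exists>b. par_ok par b \<and> (\<forall>f. par_ok par f \<longrightarrow>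
        avoid b f q (Node v (Tie w s) (Tie w' s')) \<longrightarrow>
        msg {} f (Node v (Tie w s) (Tie w' s')) \<in> {None, Some z, Some (up (up z))})" by blast
  qed
next
  case (step v w s r)
  show ?case
  proof (intro allI impI)
    fix q z
    assume d: "dist_lab (Node v (Tie w s) r)"
        and pa: "\<forall>k\<in>cons q (Node v (Tie w s) r). par_con par k" and z: "even_col z = par q"
    \<comment> \<open>The tie of v must avoid z - 3, and the child is asked for a message in {z - 1,
      z + 1}, that is, for the pair that starts at ?y = z - 1.\<close>
    let ?z = "up (opp z)" and ?y = "up (up (up (opp z)))"
    have p: "par q \<noteq> par v" "par v = par w" using pa by auto
    have ez: "even_col ?z = par v" "even_col ?y = par v" using p z by (cases z; simp)+
    from step.IH d pa ez obtain b0 where b0: "par_ok par b0"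
      "\<And>f. par_ok par f \<Longrightarrow> avoid b0 f v r \<Longrightarrow> msg {} f r \<in> {None, Some ?y, Some (up (up ?y))}"
      by (metis (no_types, lifting) UnCI cons.simps(3) dist_lab.simps(1))
    define b where "b = b0(v := ?z)"
    obtain v1 l1 r1 where r: "r = Node v1 l1 r1" using caterpillar_Node[OF step.hyps] by blast
    have "par_ok par b" using b0(1) ez by (auto simp: par_ok_def b_def)
    moreover have "msg {} f (Node v (Tie w s) r) \<in> {None, Some z, Some (up (up z))}"
      if f: "par_ok par f" and av: "avoid b f q (Node v (Tie w s) r)" for f
    proof -
      have "avoid b0 f v r" unfolding avoid_def
      proof (intro allI impI)
        fix x w0 s0 assume L: "Link x w0 s0 \<in> cons v r"
        then have "x \<noteq> v" using Link_cons_Node[of x w0 s0 v v1 l1 r1] r d by auto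
        moreover have "Link x w0 s0 \<in> cons q (Node v (Tie w s) r)" using L by simp
        ultimately show "opp_if s0 (f w0) \<noteq> b0 x"
          using av[unfolded avoid_def, rule_format, of x w0 s0] by (simp add: b_def)
      qed
      then have m: "msg {} f r \<in> {None, Some ?y, Some (up (up ?y))}" using b0(2) f by blast
      have "opp_if s (f w) \<noteq> ?z" using av by (auto simp: avoid_def b_def)
      then have "mid (Some (opp_if s (f w))) (msg {} f r) \<in> {None, Some z, Some (up (up z))}"
        using f p ez m by (intro mid_excl1[of _ ?z]) (auto simp: par_ok_def)
      then show ?thesis by simp
    qed
    ultimately show "\<exists>b. par_ok par b \<and> (\<forall>f. par_ok par f \<longrightarrow> avoid b f q (Node v (Tie w s) r) \<longrightarrow>
        msg {} f (Node v (Tie w s) r) \<in> {None, Some z, Some (up (up z))})" by blast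
  qed
next
  case (swap v l r)
  have "avoid b f q (Node v r l) = avoid b f q (Node v l r)" for b f q
    by (auto simp: avoid_def)
  moreover have "cons q (Node v r l) = cons q (Node v l r)" for q by auto
  moreover have "msg {} f (Node v r l) = msg {} f (Node v l r)" for f by (simp add: mid_commute)
  moreover have "dist_lab (Node v r l) = dist_lab (Node v l r)" by auto
  ultimately show ?case using swap by presburger
qed

section \<open>Cutting off a subtree\<close>

fun plug :: "('v \<times> 'v item) list \<Rightarrow> 'v item \<Rightarrow> 'v item" where
  "plug [] Z = Z"
| "plug ((v, sb) # k) Z = Node v sb (plug k Z)"

fun hole :: "'v \<Rightarrow> ('v \<times> 'v item) list \<Rightarrow> 'v" where
  "hole q [] = q"
| "hole q ((v, sb) # k) = hole v k"

fun ctx_cons :: "'v \<Rightarrow> ('v \<times> 'v item) list \<Rightarrow> 'v con set" where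
  "ctx_cons q [] = {}"
| "ctx_cons q ((v, sb) # k) = {Near q v, Near v q} \<union> cons v sb \<union> ctx_cons v k"

fun ctx_labels :: "('v \<times> 'v item) list \<Rightarrow> 'v set" where
  "ctx_labels [] = {}"
| "ctx_labels ((v, sb) # k) = insert v (lab sb \<union> ctx_labels k)"

fun map_stubs :: "('v \<Rightarrow> 'v \<Rightarrow> bool \<Rightarrow> 'v item) \<Rightarrow> 'v \<Rightarrow> 'v item \<Rightarrow> 'v item" where
  "map_stubs F q (Ban g) = Ban g"
| "map_stubs F q (Tie w s) = F q w s"
| "map_stubs F q (Node v l r) = Node v (map_stubs F v l) (map_stubs F v r)"

fun map_ctx :: "('v \<Rightarrow> 'v \<Rightarrow> bool \<Rightarrow> 'v item) \<Rightarrow> ('v \<times> 'v item) list \<Rightarrow> ('v \<times> 'v item) list" where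
  "map_ctx F [] = []"
| "map_ctx F ((v, sb) # k) = (v, map_stubs F v sb) # map_ctx F k"

fun map_con :: "('v \<Rightarrow> 'v \<Rightarrow> bool \<Rightarrow> 'v item) \<Rightarrow> 'v con \<Rightarrow> 'v con set" where
  "map_con F (Link x w s) = cons x (F x w s)"
| "map_con F k = {k}"

definition stub_valued :: "('v \<Rightarrow> 'v \<Rightarrow> bool \<Rightarrow> 'v item) \<Rightarrow> bool" where
  "stub_valued F \<longleftrightarrow> (\<forall>x w s. lab (F x w s) = {})"

definition rooted :: "'v \<Rightarrow> 'v item \<Rightarrow> 'v item \<Rightarrow> 'v item \<Rightarrow> 'v con set \<Rightarrow> 'v set \<Rightarrow> bool" where
  "rooted v a b c C V \<longleftrightarrow> v \<notin> lab a \<union> lab b \<union> lab c \<and> lab a \<inter> lab b = {} \<and> lab a \<inter> lab c = {} \<and>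
     lab b \<inter> lab c = {} \<and> dist_lab a \<and> dist_lab b \<and> dist_lab c \<and>
         V = insert v (lab a \<union> lab b \<union> lab c) \<and>
     C = cons v a \<union> cons v b \<union> cons v c"

definition is_tree :: "'v con set \<Rightarrow> 'v set \<Rightarrow> bool" where
  "is_tree C V \<longleftrightarrow> (\<exists>v a b c. rooted v a b c C V)"

definition wf_cons :: "('v \<Rightarrow> bool) \<Rightarrow> 'v con set \<Rightarrow> 'v set \<Rightarrow> bool" where
  "wf_cons par C V \<longleftrightarrow> is_tree C V \<and> (\<forall>k\<in>C. par_con par k) \<and>
     (\<forall>x w s. Link x w s \<in> C \<longrightarrow> Link w x s \<in> C \<and> x \<noteq> w)"

definition solvable :: "('v \<Rightarrow> bool) \<Rightarrow> 'v con set \<Rightarrow> bool" where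
  "solvable par C \<longleftrightarrow> (\<exists>f. par_ok par f \<and> (\<forall>k\<in>C. sat f k))"

text \<open>Such a system has no solution: the leaves q, u and u' would need three different colours
  next to that of p.\<close>

definition is_W :: "'v con set \<Rightarrow> 'v set \<Rightarrow> bool" where
  "is_W C V \<longleftrightarrow> (\<forall>x g. Exc x g \<notin> C) \<and> (\<exists>q p u u'. distinct [q, p, u, u'] \<and> V = {q, p, u, u'} \<and>
     {Near p q, Near p u, Near p u', Link q u False, Link q u' False, Link u u' False} \<subseteq> C)"

definition smaller_solvable :: "('v \<Rightarrow> bool) \<Rightarrow> 'v set \<Rightarrow> bool" where
  "smaller_solvable par V \<longleftrightarrow> (\<forall>C' V'. card V' < card V \<longrightarrow> wf_cons par C' V' \<longrightarrow>
      solvable par C' \<or> is_W C' V')"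

text \<open>The clause on \<open>is_tree\<close> says that a cubic tree remains when Z shrinks to a
  stub N and the ties outside are replaced by the stubs of F. The last clause serves to recognise
  \<open>W\<close>: if q has ties in \<open>Co\<close> to two targets, then q is all that lies
  outside Z.\<close>

definition splits_off :: "'v con set \<Rightarrow> 'v set \<Rightarrow> 'v con set \<Rightarrow> 'v \<Rightarrow> 'v item \<Rightarrow> bool" where
  "splits_off C V Co q Z \<longleftrightarrow> C = Co \<union> cons q Z \<and> dist_lab Z \<and> lab Z \<subseteq> V \<and> q \<in> V - lab Z \<and> finite V \<and>
     (\<forall>k\<in>Co. (\<exists>x w s. k = Link x w s \<and> x \<in> V - lab Z) \<or>
        (\<not> (\<exists>x w s. k = Link x w s) \<and> vars k \<subseteq> V - lab Z)) \<and>
     (\<forall>F N. stub_valued F \<longrightarrow> lab N = {} \<longrightarrow> is_tree (cons q N \<union> \<Union>(map_con F ` Co)) (V - lab Z)) \<and>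
     ((\<forall>w w' s s'. Link q w s \<in> Co \<longrightarrow> Link q w' s' \<in> Co \<longrightarrow> w = w') \<or>
      (\<exists>a b. lab a = {} \<and> lab b = {} \<and> Co = cons q a \<union> cons q b \<and> V = insert q (lab Z)))"

section \<open>Contexts, replacement of stubs, and change of the root\<close>

lemma cons_plug: "cons q (plug k Z) = ctx_cons q k \<union> cons (hole q k) Z"
  by (induction k arbitrary: q rule: ctx_labels.induct) auto

lemma lab_plug: "lab (plug k Z) = ctx_labels k \<union> lab Z"
  by (induction k rule: ctx_labels.induct) auto

lemma hole_in: "hole q k \<in> insert q (ctx_labels k)"
  by (induction k arbitrary: q rule: ctx_labels.induct) auto

lemma hole_in': "k \<noteq> [] \<Longrightarrow> hole q k \<in> ctx_labels k"
proof -
  assume "k \<noteq> []"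
  then obtain v sb kk where "k = (v, sb) # kk" by (cases k rule: ctx_labels.cases) auto
  then show ?thesis using hole_in[of v kk] by auto
qed

lemma dist_lab_plug: "dist_lab (plug k Z) \<Longrightarrow> dist_lab Z \<and> ctx_labels k \<inter> lab Z = {}"
  by (induction k rule: ctx_labels.induct) (auto simp: lab_plug)

lemma lab_empty: "lab t = {} \<Longrightarrow> (\<exists>g. t = Ban g) \<or> (\<exists>w s. t = Tie w s)"
  by (cases t) auto

lemma dist_lab_stub: "lab t = {} \<Longrightarrow> dist_lab t"
  by (cases t) auto

lemma cons_map_stubs: "cons q (map_stubs F q t) = \<Union>(map_con F ` cons q t)"
  by (induction F q t rule: map_stubs.induct) auto

lemma lab_map_stubs: "stub_valued F \<Longrightarrow> lab (map_stubs F q t) = lab t"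
  by (induction F q t rule: map_stubs.induct) (auto simp: stub_valued_def)

lemma dist_lab_map_stubs: "stub_valued F \<Longrightarrow> dist_lab t \<Longrightarrow> dist_lab (map_stubs F q t)"
  by (induction F q t rule: map_stubs.induct) (auto simp: lab_map_stubs stub_valued_def
      dist_lab_stub)

lemma ctx_cons_map_ctx: "ctx_cons q (map_ctx F k) = \<Union>(map_con F ` ctx_cons q k)"
  by (induction k arbitrary: q rule: ctx_labels.induct) (auto simp: cons_map_stubs)

lemma hole_map_ctx: "hole q (map_ctx F k) = hole q k"
  by (induction k arbitrary: q rule: ctx_labels.induct) auto

lemma ctx_labels_map_ctx: "stub_valued F \<Longrightarrow> ctx_labels (map_ctx F k) = ctx_labels k"
  by (induction k rule: ctx_labels.induct) (auto simp: lab_map_stubs)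

lemma dist_lab_plug_map_ctx: "stub_valued F \<Longrightarrow> lab N = {} \<Longrightarrow> dist_lab (plug k Z) \<Longrightarrow>
    dist_lab (plug (map_ctx F k) N)"
  by (induction k rule: ctx_labels.induct) (auto simp: lab_plug ctx_labels_map_ctx lab_map_stubs
      dist_lab_map_stubs dist_lab_stub)

lemma ctx_cons_vars: "k \<in> ctx_cons q kk \<Longrightarrow>
    (\<not> (\<exists>x w s. k = Link x w s) \<and> vars k \<subseteq> insert q (ctx_labels kk)) \<or>
    (\<exists>x w s. k = Link x w s \<and> x \<in> insert q (ctx_labels kk))"
proof (induction kk arbitrary: q rule: ctx_labels.induct)
  case (2 v sb kk)
  from 2(2) consider "k = Near q v \<or> k = Near v q" | "k \<in> cons v sb" | "k \<in> ctx_cons v kk" by auto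
  then show ?case
  proof cases
    case 1 then show ?thesis by auto
  next
    case 2 then show ?thesis by (cases k) (use vars_nonlink[OF 2] in auto)
  next
    case 3 then show ?thesis using 2(1)[OF 3] by auto
  qed
qed auto

lemma cons_stub_link: "Link q w s \<in> cons q t \<Longrightarrow> q \<notin> lab t \<Longrightarrow> t = Tie w s"
  by (cases t) (use Link_cons_Node in fastforce)+

text \<open>The last vertex of a nonempty context spends two of its three places on its parent and
  on the hole, so a single stub is left for its ties.\<close>

lemma ctx_cons_end:
  assumes "dist_lab (plug kk Z)" "kk \<noteq> []"
  shows "\<exists>w0. \<forall>w s. Link (hole v kk) w s \<in> ctx_cons v kk \<longrightarrow> w = w0"
  using assms
proof (induction kk arbitrary: v rule: ctx_labels.induct)
  case (2 v1 sb kk)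
  show ?case
  proof (cases "kk = []")
    case True
    then have "v1 \<notin> lab sb" using 2 by auto
    moreover obtain w0 where "\<And>w s. sb = Tie w s \<Longrightarrow> w = w0" by (cases sb) auto
    ultimately have "Link v1 w s \<in> cons v1 sb \<Longrightarrow> w = w0" for w s using cons_stub_link by metis
    then show ?thesis using True by (intro exI[of _ w0]) auto
  next
    case False
    have d: "dist_lab (plug kk Z)" using 2 by auto
    obtain w0 where w0: "\<And>w s. Link (hole v1 kk) w s \<in> ctx_cons v1 kk \<Longrightarrow> w = w0"
      using 2(1)[OF d False] by blast
    have e: "hole v1 kk \<in> ctx_labels kk" using hole_in'[OF False] .
    have "Link (hole v1 kk) w s \<notin> cons v1 sb" for w s
    proof
      assume "Link (hole v1 kk) w s \<in> cons v1 sb"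
      then have "hole v1 kk \<in> insert v1 (lab sb)" using Link_cons by fastforce
      then show False using e 2 by (auto simp: lab_plug)
    qed
    then show ?thesis using w0 by (intro exI[of _ w0]) auto
  qed
qed auto

lemma splits_off_plug:
  assumes c: "rooted v a b (plug k Z) C V" and st: "lab a = {}" "lab b = {}"
  shows "splits_off C V (cons v a \<union> cons v b \<union> ctx_cons v k) (hole v k) Z"
proof -
  have d: "dist_lab (plug k Z)" and v: "v \<notin> ctx_labels k" "v \<notin> lab Z"
      and V: "V = insert v (ctx_labels k \<union> lab Z)"
    and C: "C = cons v a \<union> cons v b \<union> ctx_cons v k \<union> cons (hole v k) Z"
    using c st by (auto simp: rooted_def lab_plug cons_plug)
  have dZ: "dist_lab Z" "ctx_labels k \<inter> lab Z = {}" using dist_lab_plug[OF d] by auto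
  have VZ: "V - lab Z = insert v (ctx_labels k)" using V v dZ by auto
  have fin: "finite V" using V lab_plug[of k Z] by (metis finite_insert finite_lab)
  have a: "(\<not> (\<exists>x w s. kk = Link x w s) \<and> vars kk \<subseteq> insert v (ctx_labels k)) \<or>
     (\<exists>x w s. kk = Link x w s \<and> x \<in> insert v (ctx_labels k))"
    if "kk \<in> cons v a \<union> cons v b \<union> ctx_cons v k" for kk
  proof -
    from that consider "kk \<in> cons v a" | "kk \<in> cons v b" | "kk \<in> ctx_cons v k" by auto
    then show ?thesis
    proof cases
      case 1 then show ?thesis by (cases kk) (use vars_nonlink[OF 1] st in auto)
    next
      case 2 then show ?thesis by (cases kk) (use vars_nonlink[OF 2] st in auto)
    next
      case 3 then show ?thesis using ctx_cons_vars[OF 3] by auto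
    qed
  qed
  have t: "is_tree (cons (hole v k) N \<union> \<Union>(map_con F ` (cons v a \<union> cons v b \<union>
      ctx_cons v k))) (V - lab Z)"
    if F: "stub_valued F" "lab N = {}" for F N
  proof -
    have "rooted v (map_stubs F v a) (map_stubs F v b) (plug (map_ctx F k) N)
      (cons (hole v k) N \<union> \<Union>(map_con F ` (cons v a \<union> cons v b \<union> ctx_cons v k))) (V - lab Z)"
      using c st dist_lab_plug_map_ctx[OF F d] v dZ(2)
      by (auto simp: rooted_def lab_map_stubs[OF F(1)] lab_plug ctx_labels_map_ctx[OF F(1)] F VZ
          dist_lab_map_stubs[OF F(1)]
          cons_plug cons_map_stubs ctx_cons_map_ctx hole_map_ctx)
    then show ?thesis unfolding is_tree_def by blast
  qed
  \<comment> \<open>If the hole hangs at the root v, both stubs of v lie outside Z; otherwise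
    \<open>ctx_cons_end\<close> applies.\<close>
  have u: "(\<forall>w w' s s'. Link (hole v k) w s \<in> cons v a \<union> cons v b \<union> ctx_cons v k \<longrightarrow>
        Link (hole v k) w' s' \<in> cons v a \<union> cons v b \<union> ctx_cons v k \<longrightarrow> w = w') \<or>
      (\<exists>a' b'. lab a' = {} \<and> lab b' = {} \<and>
          cons v a \<union> cons v b \<union> ctx_cons v k = cons (hole v k) a' \<union> cons (hole v k) b' \<and>
        V = insert (hole v k) (lab Z))"
  proof (cases "k = []")
    case True then show ?thesis using st V by auto
  next
    case False
    have e: "hole v k \<noteq> v" using hole_in'[OF False, of v] v by auto
    then have "Link (hole v k) w s \<notin> cons v a \<union> cons v b" for w s
      using Link_cons[of "hole v k" w s v a] Link_cons[of "hole v k" w s v b] st by auto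
    then show ?thesis using ctx_cons_end[OF d False, of v] by blast
  qed
  show ?thesis unfolding splits_off_def
  proof (intro conjI)
    show "C = cons v a \<union> cons v b \<union> ctx_cons v k \<union> cons (hole v k) Z" by (rule C)
    show "lab Z \<subseteq> V" using V by auto
    show "hole v k \<in> V - lab Z" unfolding VZ by (rule hole_in)
    show "\<forall>kk\<in>cons v a \<union> cons v b \<union> ctx_cons v k. (\<exists>x w s. kk = Link x w s \<and> x \<in> V - lab Z) \<or>
        (\<not> (\<exists>x w s. kk = Link x w s) \<and> vars kk \<subseteq> V - lab Z)"
      unfolding VZ using a by blast
    show "\<forall>F N. stub_valued F \<longrightarrow> lab N = {} \<longrightarrow>
        is_tree (cons (hole v k) N \<union> \<Union>(map_con F ` (cons v a \<union> cons v b \<union>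
            ctx_cons v k))) (V - lab Z)"
      using t by blast
  qed (rule dZ(1), rule fin, rule u)
qed

lemma rooted_perm: "rooted v a b c C V \<Longrightarrow> rooted v b a c C V" "rooted v a b c C V \<Longrightarrow>
    rooted v a c b C V"
  by (auto simp: rooted_def)

lemma rooted_reroot: "rooted v a b (Node w l r) C V \<Longrightarrow> rooted w (Node v a b) l r C V"
  by (auto simp: rooted_def)

text \<open>Walk into a nonempty branch and make each vertex reached the root: what lies behind is
  gathered in one item, and the part ahead shrinks until a vertex has two stubs.\<close>

lemma reroot_leaf_aux:
  assumes "rooted v a b c C V" "lab c \<noteq> {}"
  shows "\<exists>v a b c. rooted v a b c C V \<and> lab a = {} \<and> lab b = {}"
  using assms
proof (induction c arbitrary: v a b)
  case (Node w l r)
  have c: "rooted w (Node v a b) l r C V" using rooted_reroot[OF Node.prems(1)] .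
  show ?case
  proof (cases "lab r = {}")
    case True
    show ?thesis
    proof (cases "lab l = {}")
      case False then show ?thesis using Node.IH(1)[OF rooted_perm(2)[OF c]] by blast
    next
      case l: True
      have "rooted w l r (Node v a b) C V" using c by (auto simp: rooted_def)
      then show ?thesis using True l by blast
    qed
  next
    case False
    then show ?thesis using Node.IH(2)[OF c] by blast
  qed
qed auto

lemma reroot_leaf:
  assumes "is_tree C V"
  shows "\<exists>v a b c. rooted v a b c C V \<and> lab a = {} \<and> lab b = {}"
proof -
  obtain v a b c where c: "rooted v a b c C V" using assms by (auto simp: is_tree_def)
  have c2: "rooted v b c a C V" "rooted v a c b C V" using c by (auto simp: rooted_def)
  show ?thesis
    using reroot_leaf_aux[OF c] reroot_leaf_aux[OF c2(1)] reroot_leaf_aux[OF c2(2)] c by blast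
qed

text \<open>This allows children to be swapped, as contexts always have their hole on the
  right.\<close>

definition item_equiv :: "'v item \<Rightarrow> 'v item \<Rightarrow> bool" where
  "item_equiv t t' \<longleftrightarrow> (\<forall>q. cons q t = cons q t') \<and> lab t = lab t' \<and> dist_lab t = dist_lab t'"

definition pure :: "'v item \<Rightarrow> bool" where
  "pure t \<longleftrightarrow> caterpillar t \<and> tgt t \<inter> lab t = {}"

lemma minimal_nonpure:
  "lab t = {} \<or> pure t \<or> (\<exists>k y l r. item_equiv t (plug k (Node y l r)) \<and> \<not> pure (Node y l r) \<and>
     (lab l = {} \<or> pure l) \<and> (lab r = {} \<or> pure r))"
proof (induction t)
  case (Node v l r)
  show ?case
  proof (cases "(lab l = {} \<or> pure l) \<and> (lab r = {} \<or> pure r)")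
    case True
    have "item_equiv (Node v l r) (plug [] (Node v l r))" by (simp add: item_equiv_def)
    then show ?thesis using True by blast
  next
    case False
    then consider "\<not> (lab l = {} \<or> pure l)" | "\<not> (lab r = {} \<or> pure r)" by blast
    then show ?thesis
    proof cases
      case 1
      then obtain k y l' r' where k: "item_equiv l (plug k (Node y l' r'))" "\<not> pure (Node y l' r')"
        "lab l' = {} \<or> pure l'" "lab r' = {} \<or> pure r'" using Node.IH(1) by blast
      have "item_equiv (Node v l r) (plug ((v, r) # k) (Node y l' r'))"
        using k(1) unfolding item_equiv_def by auto
      then show ?thesis using k by blast
    next
      case 2
      then obtain k y l' r' where k: "item_equiv r (plug k (Node y l' r'))" "\<not> pure (Node y l' r')"
        "lab l' = {} \<or> pure l'" "lab r' = {} \<or> pure r'" using Node.IH(2) by blast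
      have "item_equiv (Node v l r) (plug ((v, l) # k) (Node y l' r'))"
        using k(1) unfolding item_equiv_def by auto
      then show ?thesis using k by blast
    qed
  qed
qed auto

section \<open>The reduction to a smaller tree\<close>

lemma splits_offD_link:
  assumes "splits_off C V Co q Z" "Link x w s \<in> Co"
  shows "x \<in> V" "x \<notin> lab Z"
proof -
  have "\<forall>k\<in>Co. (\<exists>x w s. k = Link x w s \<and> x \<in> V - lab Z) \<or>
        (\<not> (\<exists>x w s. k = Link x w s) \<and> vars k \<subseteq> V - lab Z)"
    using assms(1) unfolding splits_off_def by argo
  from bspec[OF this assms(2)] show "x \<in> V" "x \<notin> lab Z" by auto
qed

lemma splitD: "splits_off C V Co q Z \<Longrightarrow> C = Co \<union> cons q Z"
  unfolding splits_off_def by argo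

lemma splits_off_item_cong:
  "splits_off C V Co q Z \<Longrightarrow> cons q Z' = cons q Z \<Longrightarrow> lab Z' = lab Z \<Longrightarrow> dist_lab Z' = dist_lab Z \<Longrightarrow>
      splits_off C V Co q Z'"
  unfolding splits_off_def by simp

lemma wf_cons_split_back:
  assumes "wf_cons par C V" "splits_off C V Co q (Node y l r)" "Link x w s \<in> Co"
      "w \<in> lab (Node y l r)"
  shows "Link w x s \<in> cons q (Node y l r)" "x \<notin> lab (Node y l r)"
proof -
  have "Link x w s \<in> C" using splitD[OF assms(2)] assms(3) by blast
  then have "Link w x s \<in> C" using assms(1) unfolding wf_cons_def by blast
  moreover have "Link w x s \<notin> Co" using splits_offD_link[OF assms(2)] assms(4) by blast
  ultimately show "Link w x s \<in> cons q (Node y l r)" using splitD[OF assms(2)] by blast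
  show "x \<notin> lab (Node y l r)" using splits_offD_link[OF assms(2,3)] by blast
qed

lemma wf_cons_split_out:
  assumes "wf_cons par C V" "splits_off C V Co q (Node y l r)" "Link x w s \<in> C"
      "w \<notin> lab (Node y l r)"
  shows "Link w x s \<in> Co"
proof -
  have "Link w x s \<in> C" using assms(1,3) unfolding wf_cons_def by blast
  moreover have "Link w x s \<notin> cons q (Node y l r)" using Link_cons_Node assms(4) by metis
  ultimately show ?thesis using splitD[OF assms(2)] by blast
qed

text \<open>The smaller system contains an excluded colour and so is not the exception; hence it has
  a solution, which extends over Z by \<open>ext\<close>. The ties from outside into Z, which F
  replaces by other stubs, hold because Z lists them as well.\<close>

lemma reduce:
  fixes Z :: "'v item"
  assumes IH: "smaller_solvable par V"
    and wf_cons: "wf_cons par C V" and sp: "splits_off C V Co q Z" and Z: "Z = Node y l r"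
    and F: "stub_valued F" and N: "lab N = {}"
    and keep: "\<And>x w s. w \<notin> lab Z \<Longrightarrow> F x w s = Tie w s"
    and par: "\<And>k. k \<in> cons q N \<Longrightarrow> par_con par k"
      "\<And>x w s k. Link x w s \<in> Co \<Longrightarrow> k \<in> cons x (F x w s) \<Longrightarrow> par_con par k"
    and C': "C' = cons q N \<union> \<Union>(map_con F ` Co)"
    and sym: "\<And>x w s. Link x w s \<in> C' \<Longrightarrow> Link w x s \<in> C' \<and> x \<noteq> w"
    and exc: "Exc x0 g0 \<in> C'"
    and ext: "\<And>f. par_ok par f \<Longrightarrow> \<forall>k\<in>C'. sat f k \<Longrightarrow> \<exists>f'. extends par f q Z {} f'"
  shows "solvable par C"
proof -
  have V: "lab Z \<subseteq> V" "finite V" "C = Co \<union> cons q Z"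
    and Co: "\<And>k. k \<in> Co \<Longrightarrow> (\<exists>x w s. k = Link x w s \<and> x \<in> V - lab Z) \<or>
        (\<not> (\<exists>x w s. k = Link x w s) \<and> vars k \<subseteq> V - lab Z)"
    and t: "is_tree C' (V - lab Z)"
    using sp F N C' unfolding splits_off_def by blast+
  have "y \<in> V" "y \<notin> V - lab Z" using V Z by auto
  then have "card (V - lab Z) < card V" using V by (intro psubset_card_mono) auto
  moreover have "wf_cons par C' (V - lab Z)"
    unfolding wf_cons_def
  proof (intro conjI t ballI)
    fix k assume "k \<in> C'"
    then consider "k \<in> cons q N" | k0 where "k0 \<in> Co" "k \<in> map_con F k0" unfolding C' by blast
    then show "par_con par k"
    proof cases
      case 2
      have "k0 \<in> C" using 2 V by auto
      then have "par_con par k0" using wf_cons by (auto simp: wf_cons_def)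
      then show ?thesis using 2 par(2) by (cases k0) auto
    qed (rule par(1))
  qed (use sym in blast)
  ultimately have "solvable par C' \<or>
      is_W C' (V - lab Z)" using IH unfolding smaller_solvable_def by blast
  then obtain f where f: "par_ok par f" "\<forall>k\<in>C'. sat f k"
    using exc unfolding is_W_def solvable_def by blast
  from ext[OF f] obtain f' where f': "extends par f q Z {} f'" by blast
  have off: "f' x = f x" if "x \<notin> lab Z" for x using f' that by (simp add: extends_def)
  have Zs: "sat f' k" if "k \<in> cons q Z" for k using f' that by (auto simp: extends_def)
  have "sat f' k" if k: "k \<in> Co" for k
  proof (cases "\<exists>x w s. k = Link x w s")
    case True
    then obtain x w s where kl: "k = Link x w s" by blast
    then have x: "x \<notin> lab Z" using Co[OF k] by auto
    show ?thesis
    proof (cases "w \<in> lab Z")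
      case True
      then have "Link w x s \<in> cons q Z"
          using wf_cons_split_back[OF wf_cons sp[unfolded Z]] k kl Z by blast
      then have "sat f' (Link w x s)" by (rule Zs)
      then show ?thesis using kl by (auto simp: opp_if_eq_iff)
    next
      case False
      then have "k \<in> C'" using keep k kl unfolding C' by (auto intro!: bexI[of _ k])
      then have "sat f k" using f by blast
      then show ?thesis using kl off[OF x] off[OF False] by simp
    qed
  next
    case False
    then have "vars k \<subseteq> V - lab Z" using Co[OF k] by auto
    moreover have "k \<in> map_con F k" using False by (cases k) auto
    then have "k \<in> C'" unfolding C' using k by blast
    then have "sat f k" using f by blast
    ultimately show ?thesis using off sat_cong[of k f' f] by blast
  qed
  then have "\<forall>k\<in>C. sat f' k" using V Zs by auto
  then show ?thesis using f' unfolding solvable_def extends_def by blast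
qed

text \<open>A tie from outside into \<open>Z\<close> at \<open>x\<close> is replaced by an excluded colour, so that the message value of
  that tie differs from \<open>b x\<close>. The excluded colours also keep the smaller tree from being the exception \<open>W\<close>.\<close>

lemma reduce_plain:
  fixes Z :: "'v item"
  assumes IH: "smaller_solvable par V"
    and wf_cons: "wf_cons par C V" and sp: "splits_off C V Co q Z" and Z: "Z = Node y l r"
    and b: "par_ok par b" and mu: "even_col mu = par q"
    and ext: "\<And>f. par_ok par f \<Longrightarrow> (\<And>x w s. Link x w s \<in> cons q Z \<Longrightarrow> w \<notin> lab Z \<Longrightarrow>
        opp_if s (f w) \<noteq> b x) \<Longrightarrow>
       f q \<noteq> mu \<Longrightarrow> \<exists>f'. extends par f q Z {} f'"
  shows "solvable par C"
proof -
  define F where "F = (\<lambda>(x::'v) w s. if w \<in> lab Z then Ban (opp_if s (b w)) else Tie w s)"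
  define C' where "C' = cons q (Ban mu) \<union> \<Union>(map_con F ` Co)"
  have link: "Link x w s \<in> C' \<longleftrightarrow> Link x w s \<in> Co \<and> w \<notin> lab Z" for x w s
  proof
    assume "Link x w s \<in> C'"
    then obtain k0 where k0: "k0 \<in> Co" "Link x w s \<in> map_con F k0" unfolding C'_def by auto
    then show "Link x w s \<in> Co \<and> w \<notin> lab Z" by (cases k0) (auto simp: F_def split: if_splits)
  next
    assume "Link x w s \<in> Co \<and> w \<notin> lab Z"
    then show "Link x w s \<in> C'" unfolding C'_def F_def by (auto intro!: bexI[of _ "Link x w s"])
  qed
  have C: "C = Co \<union> cons q Z" using sp by (simp add: splits_off_def)
  show ?thesis
  proof (rule reduce[OF IH wf_cons sp Z, where F = F and N = "Ban mu" and ?x0.0 = q and ?g0.0 = mu])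
    show "stub_valued F" by (simp add: stub_valued_def F_def)
    show "F x w s = Tie w s" if "w \<notin> lab Z" for x w s using that by (simp add: F_def)
    show "par_con par k" if "k \<in> cons q (Ban mu)" for k using that mu by auto
    show "par_con par k" if "Link x w s \<in> Co" "k \<in> cons x (F x w s)" for x w s k
    proof -
      have "par_con par (Link x w s)" using wf_cons C that unfolding wf_cons_def by blast
      then show ?thesis using that b by (auto simp: F_def par_ok_def split: if_splits)
    qed
    show "Link w x s \<in> C' \<and> x \<noteq> w" if "Link x w s \<in> C'" for x w s
    proof -
      have 1: "Link x w s \<in> Co" "w \<notin> lab Z" using that link by auto
      then have "Link x w s \<in> C" using C by auto
      then have "Link w x s \<in> Co" "x \<noteq> w"
          using wf_cons_split_out[OF wf_cons sp[unfolded Z]] 1 Z wf_cons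
        by (auto simp: wf_cons_def)
      moreover have "x \<notin> lab Z" using splits_offD_link[OF sp 1(1)] by blast
      ultimately show ?thesis using link by blast
    qed
    show "\<exists>f'. extends par f q Z {} f'" if f: "par_ok par f" "\<forall>k\<in>C'. sat f k" for f
    proof (rule ext[OF f(1)])
      fix x w s assume L: "Link x w s \<in> cons q Z" "w \<notin> lab Z"
      then have "Link w x s \<in> Co" using wf_cons_split_out[OF wf_cons sp[unfolded Z]] C Z by blast
      moreover have "x \<in> lab Z" using L Link_cons_Node Z by metis
      ultimately have "Exc w (opp_if s (b x)) \<in> C'"
        unfolding C'_def F_def by (auto intro!: bexI[of _ "Link w x s"])
      then have "sat f (Exc w (opp_if s (b x)))" using f by blast
      then show "opp_if s (f w) \<noteq> b x" by (auto simp: opp_if_eq_iff)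
    next
      have "Exc q mu \<in> C'" by (simp add: C'_def)
      then have "sat f (Exc q mu)" using f(2) by blast
      then show "f q \<noteq> mu" by simp
    qed
  qed (auto simp: C'_def)
qed

text \<open>If this holds, Z can be cut off: with mu excluded at q, the colouring always extends to
  Z.\<close>

definition one_msg :: "('v \<Rightarrow> bool) \<Rightarrow> 'v \<Rightarrow> 'v item \<Rightarrow> bool" where
  "one_msg par q Z \<longleftrightarrow> (\<exists>b mu. par_ok par b \<and> even_col mu = par q \<and>
     (\<forall>f. par_ok par f \<longrightarrow> avoid b f q Z \<longrightarrow> msg {} f Z \<in> {None, Some mu}))"

lemma one_msg_swap: "one_msg par q (Node y l r) \<Longrightarrow> one_msg par q (Node y r l)"
proof -
  have "avoid b f q (Node y r l) = avoid b f q (Node y l r)" for b f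
    by (auto simp: avoid_def)
  moreover have "msg {} f (Node y r l) = msg {} f (Node y l r)" for f by (simp add: mid_commute)
  ultimately show "one_msg par q (Node y l r) \<Longrightarrow> one_msg par q (Node y r l)"
    unfolding one_msg_def by presburger
qed

lemma avoid_Node: "avoid b f q (Node y l r) \<longleftrightarrow> avoid b f y l \<and> avoid b f y r"
  by (auto simp: avoid_def)

text \<open>Of the two colours 2 away from g only g - 2 is left, with midpoint g - 1.\<close>

lemma mid_excl2: "b \<noteq> up (up g) \<Longrightarrow> mid (Some g) (Some b) \<in> {None, Some (up (up (up (opp g))))}"
  by (cases g; cases b; simp)

text \<open>Beside the excluded colour g, a tie is kept away from g + 2, and a caterpillar is
  confined to g and g + 2, of which g gives no midpoint.\<close>

lemma one_msg_Ban:
  assumes d: "dist_lab (Node y (Ban g) r)" and r: "lab r = {} \<or> caterpillar r"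
    and pa: "\<forall>k\<in>cons q (Node y (Ban g) r). par_con par k"
  shows "one_msg par q (Node y (Ban g) r)"
proof -
  have p: "par q \<noteq> par y" "even_col g = par y"
    using pa[rule_format, of "Near q y"] pa[rule_format, of "Exc y g"] by simp_all
  consider h where "r = Ban h" | w s where "r = Tie w s" | "caterpillar r"
      using r lab_empty by blast
  then show ?thesis
  proof cases
    case 1
    then have h: "even_col h = par y" using pa[rule_format, of "Exc y h"] by simp
    \<comment> \<open>Both exclusions are fixed here; if they have no midpoint, any colour of the
      right parity can be mu.\<close>
    define mu where "mu = (if mid (Some g) (Some h) =
        None then default_col par q else the (mid (Some g) (Some h)))"
    have "even_col mu = par q"
    proof (cases "mid (Some g) (Some h)")
      case None then show ?thesis using par_ok_default_col[of par] by (simp add: mu_def par_ok_def)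
    next
      case (Some m)
      then have "even_col m \<noteq> even_col g" by (cases g; cases h; auto)
      then show ?thesis using Some p by (simp add: mu_def)
    qed
    moreover have "msg {} f (Node y (Ban g) r) \<in> {None, Some mu}" for f
      using 1 by (cases "mid (Some g) (Some h)") (auto simp: mu_def simp del: mid.simps)
    ultimately show ?thesis unfolding one_msg_def using par_ok_default_col by blast
  next
    case 2
    define b where "b = (default_col par)(y := up (up g))"
    have "par_ok par b" using par_ok_default_col[of par] p
        by (cases g) (auto simp: par_ok_def b_def)
    moreover have "even_col (up (up (up (opp g)))) = par q" using p by (cases g) auto
    moreover have "msg {} f (Node y (Ban g) r) \<in> {None, Some (up (up (up (opp g))))}"
      if "avoid b f q (Node y (Ban g) r)" for f
    proof -
      have "opp_if s (f w) \<noteq> up (up g)" using that 2 by (auto simp: avoid_def b_def)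
      from mid_excl2[OF this] show ?thesis using 2 by (simp del: mid.simps)
    qed
    ultimately show ?thesis unfolding one_msg_def by blast
  next
    case 3
    have "dist_lab r" "\<forall>k\<in>cons y r. par_con par k" using d pa by auto
    then obtain b where b: "par_ok par b" "\<And>f. par_ok par f \<Longrightarrow> avoid b f y r \<Longrightarrow>
        msg {} f r \<in> {None, Some g, Some (up (up g))}"
      using msg_two_values[OF 3, of par, rule_format, of y g] p by blast
    have "even_col (up g) = par q" using p by (cases g) auto
    moreover have "msg {} f (Node y (Ban g) r) \<in> {None, Some (up g)}"
      if "par_ok par f" "avoid b f q (Node y (Ban g) r)" for f
    proof -
      have "msg {} f r \<in> {None, Some g, Some (up (up g))}"
          using b(2)[OF that(1)] that(2)[unfolded avoid_Node] by blast
      then show ?thesis by (cases g) auto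
    qed
    ultimately show ?thesis unfolding one_msg_def using b by blast
  qed
qed

text \<open>Both messages are confined to the same pair z, z + 2, whose only midpoint is z + 1. The
  two choices of b can be merged since the ties start in disjoint label sets.\<close>

lemma one_msg_caterpillar:
  assumes d: "dist_lab (Node y l r)" and l: "caterpillar l" and r: "caterpillar r"
    and pa: "\<forall>k\<in>cons q (Node y l r). par_con par k"
  shows "one_msg par q (Node y l r)"
proof -
  define z where "z = default_col par y"
  have z: "even_col z = par y" using par_ok_default_col[of par] by (simp add: z_def par_ok_def)
  have p: "par q \<noteq> par y" using pa[rule_format, of "Near q y"] by simp
  have d2: "dist_lab l" "dist_lab r" "\<forall>k\<in>cons y l. par_con par k" "\<forall>k\<in>cons y r. par_con par k"
      using d pa by auto
  obtain b1 where b1: "par_ok par b1" "\<And>f. par_ok par f \<Longrightarrow> avoid b1 f y l \<Longrightarrow>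
      msg {} f l \<in> {None, Some z, Some (up (up z))}"
    using msg_two_values[OF l, of par, rule_format, of y z] d2 z by blast
  obtain b2 where b2: "par_ok par b2" "\<And>f. par_ok par f \<Longrightarrow> avoid b2 f y r \<Longrightarrow>
      msg {} f r \<in> {None, Some z, Some (up (up z))}"
    using msg_two_values[OF r, of par, rule_format, of y z] d2 z by blast
  define b where "b = (\<lambda>x. if x \<in> lab l then b1 x else b2 x)"
  have "par_ok par b" using b1 b2 by (auto simp: par_ok_def b_def)
  moreover have "even_col (up z) = par q" using z p by (cases z) auto
  moreover have "msg {} f (Node y l r) \<in> {None, Some (up z)}"
    if f: "par_ok par f" and av: "avoid b f q (Node y l r)" for f
  proof -
    have "avoid b1 f y l" unfolding avoid_def
    proof (intro allI impI)
      fix x w s assume L: "Link x w s \<in> cons y l"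
      then have "x \<in> lab l" using caterpillar_Node[OF l] Link_cons_Node by metis
      then show "opp_if s (f w) \<noteq> b1 x"
        using av[unfolded avoid_def, rule_format, of x w s] L by (simp add: b_def)
    qed
    then have m1: "msg {} f l \<in> {None, Some z, Some (up (up z))}" using b1(2) f by blast
    have "avoid b2 f y r" unfolding avoid_def
    proof (intro allI impI)
      fix x w s assume L: "Link x w s \<in> cons y r"
      then have "x \<in> lab r" using caterpillar_Node[OF r] Link_cons_Node by metis
      then have "x \<notin> lab l" using d by auto
      then show "opp_if s (f w) \<noteq> b2 x"
        using av[unfolded avoid_def, rule_format, of x w s] L by (simp add: b_def)
    qed
    then have "msg {} f r \<in> {None, Some z, Some (up (up z))}" using b2(2) f by blast
    then show ?thesis using m1 by (cases z) auto
  qed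
  ultimately show ?thesis unfolding one_msg_def by blast
qed

lemma one_msg:
  assumes d: "dist_lab (Node y l r)" and pa: "\<forall>k\<in>cons q (Node y l r). par_con par k"
    and n: "\<not> caterpillar (Node y l r)" and l: "lab l = {} \<or> caterpillar l" and r: "lab r = {} \<or>
        caterpillar r"
  shows "one_msg par q (Node y l r)"
proof -
  have "cons q (Node y r l) = cons q (Node y l r)" by auto
  then have sw: "\<forall>k\<in>cons q (Node y r l). par_con par k" using pa by (simp only:)
  have sd: "dist_lab (Node y r l)" using d by auto
  consider g where "l = Ban g" | g where "r = Ban g" | "caterpillar l" "caterpillar r"
    using l r n lab_empty by (cases l; cases r) auto
  then show ?thesis
  proof cases
    case 1
    show ?thesis unfolding 1 by (rule one_msg_Ban[OF d[unfolded 1] r pa[unfolded 1]])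
  next
    case 2
    have "one_msg par q (Node y (Ban g) l)"
        by (rule one_msg_Ban[OF sd[unfolded 2] l sw[unfolded 2]])
    then show ?thesis unfolding 2 by (rule one_msg_swap)
  next
    case 3 then show ?thesis using one_msg_caterpillar[OF d _ _ pa] by blast
  qed
qed

lemma msg_ext:
  assumes "dist_lab t" "tgt t \<inter> lab t = {}" "par_ok par f" "q \<notin> lab t" "\<forall>k\<in>cons q t. par_con par k"
    "msg {} f t \<noteq> Some (f q)"
  shows "\<exists>f2. extends par f q t {} f2"
  using colourable_msg[OF assms(1,2), of par "{}" f, unfolded colourable_def, rule_format,
      of f q] assms(3-6) by auto

section \<open>The exceptional branching\<close>

definition cherry :: "'v \<Rightarrow> 'v \<Rightarrow> 'v \<Rightarrow> bool \<Rightarrow> 'v item \<Rightarrow> 'v item \<Rightarrow> 'v item" where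
  "cherry y v v' s t t' = Node y (Node v (Tie v' s) t) (Node v' (Tie v s) t')"

lemma cherry_sym:
  "cons q (cherry y v' v s t' t) = cons q (cherry y v v' s t t')"
  "lab (cherry y v' v s t' t) = lab (cherry y v v' s t t')"
  "dist_lab (cherry y v' v s t' t) = dist_lab (cherry y v v' s t t')"
  by (auto simp: cherry_def)

context
  fixes par :: "'v \<Rightarrow> bool" and C :: "'v con set" and V Co q
    and y v v' :: 'v and s :: bool and t t' Z :: "'v item"
  assumes IH: "smaller_solvable par V"
    and wf_cons: "wf_cons par C V" and Z: "Z = cherry y v v' s t t'" and sp: "splits_off C V Co q Z"
    and tt: "tgt t \<inter> lab Z = {}" "tgt t' \<inter> lab Z = {}"
begin

lemma Z_Node: "Z = Node y (Node v (Tie v' s) t) (Node v' (Tie v s) t')"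
  using Z by (simp add: cherry_def)

lemma Z_facts: "dist_lab Z" "q \<notin> lab Z" "\<forall>k\<in>cons q Z. par_con par k" "C = Co \<union> cons q Z"
proof -
  show C: "C = Co \<union> cons q Z" using sp by (rule splitD)
  show "dist_lab Z" "q \<notin> lab Z" using sp unfolding splits_off_def by blast+
  show "\<forall>k\<in>cons q Z. par_con par k" using wf_cons C unfolding wf_cons_def by blast
qed

lemma Z_ext: "par_ok par f \<Longrightarrow> s \<or> msg {} f t \<noteq> Some (f q) \<or> msg {} f t' \<noteq> Some (f q) \<Longrightarrow>
   \<exists>f2. extends par f q Z {} f2"
  using cherry_ext[of y v v' s t t' q par f] tt Z_facts unfolding Z_Node by blast

lemma Z_par: "par q \<noteq> par y" "par y \<noteq> par v" "par y \<noteq> par v'"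
  using bspec[OF Z_facts(3), of "Near q y"] bspec[OF Z_facts(3), of "Near y v"]
    bspec[OF Z_facts(3), of "Near y v'"] unfolding Z_Node by simp_all

lemma Z_parc: "\<forall>k\<in>cons v t. par_con par k" "\<forall>k\<in>cons v' t'. par_con par k"
proof -
  have "cons v t \<subseteq> cons q Z" "cons v' t' \<subseteq> cons q Z" unfolding Z_Node by auto
  then show "\<forall>k\<in>cons v t. par_con par k" "\<forall>k\<in>cons v' t'. par_con par k" using Z_facts(3) by blast+
qed

lemma solvable_always:
  assumes "\<And>f. par_ok par f \<Longrightarrow> s \<or> msg {} f t \<noteq> Some (f q) \<or> msg {} f t' \<noteq> Some (f q)"
  shows "solvable par C"
proof (rule reduce_plain[OF IH wf_cons sp Z_Node, of "default_col par" "default_col par q"])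
  show "par_ok par (default_col par)" by (rule par_ok_default_col)
  show "even_col (default_col par q) = par q" by (rule pokD[OF par_ok_default_col])
  show "\<exists>f'. extends par f q Z {} f'" if "par_ok par f" for f using Z_ext assms that by blast
qed

text \<open>\<open>Z_ext\<close> fails only if both messages equal the colour of q. Two caterpillars
  are confined to the disjoint pairs {z + 4, z + 6} and {z, z + 2}. If t is a tie, z is excluded for
  its value and z + 2 at q, which deals with both messages of t'.\<close>

lemma solvable_caterpillar_right:
  assumes "caterpillar t'" and t: "caterpillar t \<or> (\<exists>c s1. t = Tie c s1)"
  shows "solvable par C"
proof -
  define z where "z = default_col par v"
  have z: "even_col z = par v" "even_col z = par v'"
      using par_ok_default_col[of par] Z_par by (auto simp: z_def par_ok_def)
  have d: "dist_lab t" "dist_lab t'" "v \<notin> lab t" "v \<notin> lab t'" "lab t \<inter> lab t' = {}"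
    using Z_facts(1) unfolding Z_Node by auto
  note d = d Z_parc
  obtain b' where b': "par_ok par b'" "\<And>f. par_ok par f \<Longrightarrow> avoid b' f v' t' \<Longrightarrow>
      msg {} f t' \<in> {None, Some z, Some (up (up z))}"
    using msg_two_values[OF assms(1), of par, rule_format, of v' z] d z by blast
  have zz: "even_col (opp z) = par v" using z by (cases z) auto
  have src': "x \<in> lab t'" if "Link x w s0 \<in> cons v' t'" for x w s0
    using caterpillar_Node[OF assms(1)] Link_cons_Node that by metis
  have out: "w \<notin> lab Z" if "Link x w s0 \<in> cons v t \<or> Link x w s0 \<in> cons v' t'" for x w s0
    using that Link_cons tt by (metis disjoint_iff)
  have inZ: "Link x w s0 \<in> cons q Z" if "Link x w s0 \<in> cons v t \<or>
      Link x w s0 \<in> cons v' t'" for x w s0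
    using that unfolding Z_Node by auto
  from t show ?thesis
  proof
    assume pt: "caterpillar t"
    obtain b0 where b0: "par_ok par b0" "\<And>f. par_ok par f \<Longrightarrow> avoid b0 f v t \<Longrightarrow>
        msg {} f t \<in> {None, Some (opp z), Some (up (up (opp z)))}"
      using msg_two_values[OF pt, of par, rule_format, of v "opp z"] d zz by blast
    have src: "x \<in> lab t" if "Link x w s0 \<in> cons v t" for x w s0
      using caterpillar_Node[OF pt] Link_cons_Node that by metis
    define b where "b = (\<lambda>x. if x \<in> lab t then b0 x else b' x)"
    show ?thesis
    proof (rule reduce_plain[OF IH wf_cons sp Z_Node, of b "default_col par q"])
      show "par_ok par b" using b' b0 by (auto simp: par_ok_def b_def)
      show "even_col (default_col par q) = par q"
          using par_ok_default_col[of par] by (simp add: par_ok_def)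
      fix f assume f: "par_ok par f" and av: "\<And>x w s. Link x w s \<in> cons q Z \<Longrightarrow> w \<notin> lab Z \<Longrightarrow>
          opp_if s (f w) \<noteq> b x"
      have av': "opp_if s0 (f w) \<noteq> b x" if "Link x w s0 \<in> cons v t \<or>
          Link x w s0 \<in> cons v' t'" for x w s0
        using av[OF inZ[OF that] out[OF that]] .
      have "avoid b0 f v t" unfolding avoid_def
      proof (intro allI impI)
        fix x w s0 assume L: "Link x w s0 \<in> cons v t"
        then show "opp_if s0 (f w) \<noteq> b0 x" using av'[of x w s0] src[OF L] by (simp add: b_def)
      qed
      then have m: "msg {} f t \<in> {None, Some (opp z), Some (up (up (opp z)))}" using b0 f by blast
      have "avoid b' f v' t'" unfolding avoid_def
      proof (intro allI impI)
        fix x w s0 assume L: "Link x w s0 \<in> cons v' t'"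
        then have "x \<notin> lab t" using src' d by blast
        then show "opp_if s0 (f w) \<noteq> b' x" using av'[of x w s0] L by (simp add: b_def)
      qed
      then have m': "msg {} f t' \<in> {None, Some z, Some (up (up z))}" using b' f by blast
      have "msg {} f t \<noteq> Some (f q) \<or> msg {} f t' \<noteq> Some (f q)"
        using m m' by (cases z) auto
      then show "\<exists>f'. extends par f q Z {} f'" using Z_ext[OF f] by blast
    qed
  next
    assume "\<exists>c s1. t = Tie c s1"
    then obtain c s1 where t: "t = Tie c s1" by blast
    define b where "b = b'(v := z)"
    show ?thesis
    proof (rule reduce_plain[OF IH wf_cons sp Z_Node, of b "up (up z)"])
      show "par_ok par b" using b' z by (auto simp: par_ok_def b_def)
      show "even_col (up (up z)) = par q" using z Z_par by (cases z) auto
      fix f assume f: "par_ok par f" and av: "\<And>x w s. Link x w s \<in> cons q Z \<Longrightarrow> w \<notin> lab Z \<Longrightarrow>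
          opp_if s (f w) \<noteq> b x"
        and mu: "f q \<noteq> up (up z)"
      have "opp_if s1 (f c) \<noteq> z" using av[of v c s1] inZ[of v c s1] out[of v c s1] t
          by (simp add: b_def)
      then have m: "msg {} f t \<noteq> Some z" using t by simp
      have "avoid b' f v' t'" unfolding avoid_def
      proof (intro allI impI)
        fix x w s0 assume L: "Link x w s0 \<in> cons v' t'"
        then have "x \<noteq> v" using src' d by blast
        then show "opp_if s0 (f w) \<noteq> b' x" using av[of x w s0] inZ[of x w s0] out[of x w s0] L
          by (simp add: b_def)
      qed
      then have m': "msg {} f t' \<in> {None, Some z, Some (up (up z))}" using b' f by blast
      have "msg {} f t \<noteq> Some (f q) \<or> msg {} f t' \<noteq> Some (f q)"
        using m m' mu by auto
      then show "\<exists>f'. extends par f q Z {} f'" using Z_ext[OF f] by blast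
    qed
  qed
qed

text \<open>The bad event is that \<open>opp_if s1 (f c)\<close> and \<open>opp_if s2 (f c')\<close>
  both equal f q. The stubs set free at q, c and c' are spent on ruling it out: by a tie between c
  and c' if they differ, and by a tie between q and c if c = c' is not q. If c = c' = q, the event
  cannot occur when s1 or s2 holds; otherwise the system is the exception.\<close>

lemma solvable_cherry:
  assumes t: "t = Tie c s1" and t': "t' = Tie c' s2"
  shows "solvable par C \<or> is_W C V"
proof (cases s)
  case True
  then show ?thesis using solvable_always by blast
next
  case s: False
  have dd: "y \<noteq> v" "y \<noteq> v'" "v \<noteq> v'" using Z_facts(1) unfolding Z_Node by auto
  have labZ: "lab Z = {y, v, v'}" unfolding Z_Node using t t' by auto
  have c: "c \<notin> lab Z" "c' \<notin> lab Z" using tt t t' by auto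
  have lk: "Link x w g \<in> cons q Z \<longleftrightarrow>
      (x, w, g) \<in> {(v, v', False), (v, c, s1), (v', v, False), (v', c', s2)}" for x w g
    unfolding Z_Node using t t' s by auto
  have Lc: "Link c v s1 \<in> Co"
  proof (rule wf_cons_split_out[OF wf_cons sp[unfolded Z_Node]])
    show "Link v c s1 \<in> C" using lk Z_facts(4) by auto
  qed (use c Z_Node in auto)
  have Lc': "Link c' v' s2 \<in> Co"
  proof (rule wf_cons_split_out[OF wf_cons sp[unfolded Z_Node]])
    show "Link v' c' s2 \<in> C" using lk Z_facts(4) by auto
  qed (use c Z_Node in auto)
  have into_Z: "w = v \<and> x = c \<and> g = s1 \<or> w = v' \<and> x = c' \<and> g = s2"
    if "Link x w g \<in> Co" "w \<in> lab Z" for x w g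
  proof -
    have "Link w x g \<in> cons q Z" "x \<notin> lab Z"
      using wf_cons_split_back[OF wf_cons sp[unfolded Z_Node] that(1)] that(2) Z_Node by auto
    then show ?thesis using lk labZ by auto
  qed
  have parL: "par c = par v" "par c' = par v'"
    using bspec[OF Z_facts(3), of "Link v c s1"] bspec[OF Z_facts(3), of "Link v' c' s2"] lk
        by simp_all
  have Co_par: "par x = par w" if "Link x w g \<in> Co" for x w g
  proof -
    have "Link x w g \<in> C" using that Z_facts(4) by blast
    then have "par_con par (Link x w g)" using wf_cons unfolding wf_cons_def by blast
    then show ?thesis by simp
  qed
  have pq: "par c = par q" "par c' = par q" using parL Z_par by auto
  have dfl: "even_col (default_col par x) = par x" for x
      using par_ok_default_col[of par] by (simp add: par_ok_def)
  have mt: "msg {} f t = Some (opp_if s1 (f c))" "msg {} f t' = Some (opp_if s2 (f c'))" for f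
    using t t' by auto
  have keepCo: "Link w x g \<in> Co" "x \<notin> lab Z" "x \<noteq> w" if "Link x w g \<in> Co" "w \<notin> lab Z" for x w g
  proof -
    show "Link w x g \<in> Co" using wf_cons_split_out[OF wf_cons sp[unfolded Z_Node],
        of x w g] that Z_facts(4) Z_Node by auto
    show "x \<notin> lab Z" using splits_offD_link[OF sp that(1)] by blast
    show "x \<noteq> w" using that wf_cons Z_facts(4) unfolding wf_cons_def by blast
  qed
  \<comment> \<open>D consists of the new constraints on the freed stubs: N at q, A at c and B at
    c'. It has to contain an excluded colour, lest the smaller system be the exception.\<close>
  have relink: "solvable par C"
    if st: "lab A = {}" "lab B = {}" "lab N = {}"
      and D: "D = cons q N \<union> cons c A \<union> cons c' B"
      and pD: "\<And>k. k \<in> D \<Longrightarrow> par_con par k"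
      and sD: "\<And>x w g. Link x w g \<in> D \<Longrightarrow> Link w x g \<in> D \<and> x \<noteq> w"
      and exc: "Exc x0 g0 \<in> D"
      and ext: "\<And>f. (\<And>k. k \<in> D \<Longrightarrow> sat f k) \<Longrightarrow> opp_if s1 (f c) \<noteq> f q \<or> opp_if s2 (f c') \<noteq> f q"
    for A B N :: "'v item" and D x0 g0
  proof -
    define F where "F = (\<lambda>x w g. if w = v then A else if w = v' then B
       else if w = y then Ban (default_col par x) else Tie w g)"
    define C' where "C' = cons q N \<union> \<Union>(map_con F ` Co)"
    have keep: "F x w g = Tie w g" if "w \<notin> lab Z" for x w g using that labZ by (auto simp: F_def)
    have new: "cons x (F x w g) \<subseteq> D" if "Link x w g \<in> Co" "w \<in> lab Z" for x w g
      using into_Z[OF that] dd by (auto simp: F_def D)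
    have DC': "D \<subseteq> C'"
    proof -
      have "cons c A \<subseteq> map_con F (Link c v s1)" "cons c' B \<subseteq> map_con F (Link c' v' s2)"
          using dd by (auto simp: F_def)
      then show ?thesis using Lc Lc' unfolding C'_def D by blast
    qed
    have link: "Link x w g \<in> C' \<longleftrightarrow> Link x w g \<in> Co \<and> w \<notin> lab Z \<or> Link x w g \<in> D" for x w g
    proof
      assume "Link x w g \<in> C'"
      then consider "Link x w g \<in> cons q N" | k0 where "k0 \<in> Co" "Link x w g \<in> map_con F k0"
          unfolding C'_def by auto
      then show "Link x w g \<in> Co \<and> w \<notin> lab Z \<or> Link x w g \<in> D"
      proof cases
        case 1 then show ?thesis by (simp add: D)
      next
        case 2
        then obtain x0 w0 s0 where k: "k0 = Link x0 w0 s0" by (cases k0) auto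
        then have e: "Link x w g \<in> cons x0 (F x0 w0 s0)" using 2 by simp
        show ?thesis
        proof (cases "w0 \<in> lab Z")
          case True then show ?thesis using new[of x0 w0 s0] 2 k e by blast
        next
          case False then show ?thesis using keep e k 2 by auto
        qed
      qed
    next
      have 2: "Link x w g \<in> map_con F (Link x w g)" if "w \<notin> lab Z" using that keep by simp
      assume "Link x w g \<in> Co \<and> w \<notin> lab Z \<or> Link x w g \<in> D"
      then show "Link x w g \<in> C'" using 2 DC' unfolding C'_def by blast
    qed
    show "solvable par C"
    proof (rule reduce[OF IH wf_cons sp Z_Node,
        where F = F and N = N and ?x0.0 = x0 and ?g0.0 = g0])
      show "stub_valued F" using st by (simp add: stub_valued_def F_def)
      show "par_con par k" if "k \<in> cons q N" for k using that pD D by blast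
      show "par_con par k" if k: "Link x w g \<in> Co" "k \<in> cons x (F x w g)" for x w g k
      proof (cases "w \<in> lab Z")
        case True then show ?thesis using new[OF k(1)] k(2) pD by blast
      next
        case False then show ?thesis using keep k Co_par[OF k(1)] by simp
      qed
      show "Link w x g \<in> C' \<and> x \<noteq> w" if "Link x w g \<in> C'" for x w g
        using that sD keepCo[of x w g] unfolding link by blast
      show "\<exists>f'. extends par f q Z {} f'" if f: "par_ok par f" "\<forall>k\<in>C'. sat f k" for f
        by (rule Z_ext[OF f(1)]) (use ext[of f] f(2) DC' in \<open>auto simp: mt\<close>)
      show "Exc x0 g0 \<in> C'" using exc DC' by blast
    qed (use st keep C'_def in simp_all)
  qed
  show ?thesis
  proof (cases "c = c'")
    case ne: False
    \<comment> \<open>The new tie must forbid that the two shifted colours agree, so its shift is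
      the difference of s1 and s2.\<close>
    define h where "h = (s1 \<noteq> s2)"
    have "solvable par C"
    proof (rule relink[of "Tie c' h" "Tie c h" "Ban (default_col par q)", OF _ _ _ refl])
      show "Exc q (default_col par q) \<in> cons q (Ban (default_col par q)) \<union> cons c (Tie c' h) \<union>
          cons c' (Tie c h)" by simp
      fix f :: "'v \<Rightarrow> col"
      assume "\<And>k. k \<in> cons q (Ban (default_col par q)) \<union> cons c (Tie c' h) \<union> cons c' (Tie c h) \<Longrightarrow>
          sat f k"
      from this[of "Link c c' h"] have "f c \<noteq> opp_if h (f c')" by simp
      then have "opp_if s1 (f c) \<noteq> opp_if s2 (f c')"
        unfolding h_def using opp_if_opp_if[of s1 s2 "f c'"] opp_if_eq_iff[of s1 "f c"
            "opp_if s2 (f c')"] by metis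
      then show "opp_if s1 (f c) \<noteq> f q \<or> opp_if s2 (f c') \<noteq> f q" by auto
    next
      fix x w g
      show "Link x w g \<in> cons q (Ban (default_col par q)) \<union> cons c (Tie c' h) \<union> cons c' (Tie c h) \<Longrightarrow>
          Link w x g \<in> cons q (Ban (default_col par q)) \<union> cons c (Tie c' h) \<union> cons c' (Tie c h) \<and>
              x \<noteq> w"
        using ne by (elim UnE) simp_all
    next
      fix k
      show "k \<in> cons q (Ban (default_col par q)) \<union> cons c (Tie c' h) \<union> cons c' (Tie c h) \<Longrightarrow>
          par_con par k"
        using pq dfl by (elim UnE) simp_all
    qed simp_all
    then show ?thesis ..
  next
    case cc: True
    show ?thesis
    proof (cases "c = q")
      case cq: False
      have "solvable par C"
      \<comment> \<open>The tie to q takes one of the two stubs freed at c; the other one receives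
        an arbitrary excluded colour.\<close>
      proof (rule relink[of "Tie q s1" "Ban (default_col par c)" "Tie c s1", OF _ _ _ refl])
        show "Exc c (default_col par c) \<in> cons q (Tie c s1) \<union> cons c (Tie q s1) \<union>
            cons c' (Ban (default_col par c))"
          using cc by simp
        fix f :: "'v \<Rightarrow> col"
        assume "\<And>k. k \<in> cons q (Tie c s1) \<union> cons c (Tie q s1) \<union>
            cons c' (Ban (default_col par c)) \<Longrightarrow> sat f k"
        from this[of "Link q c s1"] show "opp_if s1 (f c) \<noteq> f q \<or> opp_if s2 (f c') \<noteq> f q" by auto
      next
        fix x w g
        show "Link x w g \<in> cons q (Tie c s1) \<union> cons c (Tie q s1) \<union>
            cons c' (Ban (default_col par c)) \<Longrightarrow>
            Link w x g \<in> cons q (Tie c s1) \<union> cons c (Tie q s1) \<union>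
                cons c' (Ban (default_col par c)) \<and> x \<noteq> w"
          using cq by (elim UnE) simp_all
      next
        fix k
        show "k \<in> cons q (Tie c s1) \<union> cons c (Tie q s1) \<union> cons c' (Ban (default_col par c)) \<Longrightarrow>
            par_con par k"
          using pq dfl cc by (elim UnE) simp_all
      qed simp_all
      then show ?thesis ..
    next
      case cq: True
      show ?thesis
      proof (cases "s1 \<or> s2")
        case True
        have "opp_if True a \<noteq> a" for a by (cases a) (auto simp: opp_if_def)
        then have "solvable par C" using True cc cq by (intro solvable_always) (auto simp: mt)
        then show ?thesis ..
      next
        case False
        have Lq: "Link q v False \<in> Co" "Link q v' False \<in> Co" using Lc Lc' cc cq False by auto
        \<comment> \<open>q is tied to v and to v' by constraints outside Z, so the last clause of
          \<open>splits_off\<close> leaves no vertex but q outside Z.\<close>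
        then have "\<not> (\<forall>w w' s s'. Link q w s \<in> Co \<longrightarrow> Link q w' s' \<in> Co \<longrightarrow> w = w')" using dd by blast
        then obtain a b where ab: "lab a = {}" "lab b = {}" "Co = cons q a \<union> cons q b"
            "V = insert q (lab Z)"
          using sp unfolding splits_off_def by blast
        have "\<exists>w. a = Tie w False" "\<exists>w. b = Tie w False"
        proof -
          have q: "q \<notin> lab a" "q \<notin> lab b" using ab by auto
          have "a = Tie v False \<or> b = Tie v False" using Lq ab cons_stub_link q by (metis UnE)
          moreover have "a = Tie v' False \<or>
              b = Tie v' False" using Lq ab cons_stub_link q by (metis UnE)
          ultimately have *: "a = Tie v False \<and> b = Tie v' False \<or>
              a = Tie v' False \<and> b = Tie v False"
            using dd by auto
          then show "\<exists>w. a = Tie w False" "\<exists>w. b = Tie w False" by auto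
        qed
        then have "Exc x g \<notin> Co" for x g unfolding ab(3) by (elim exE) simp
        moreover have "Exc x g \<notin> cons q Z" for x g unfolding Z_Node using t t' by auto
        ultimately have "\<forall>x g. Exc x g \<notin> C" using Z_facts(4) by auto
        moreover have "distinct [q, y, v, v']" using dd Z_facts(2) labZ by auto
        moreover have "V = {q, y, v, v'}" using ab labZ by auto
        moreover have "{Near y q, Near y v, Near y v', Link q v False, Link q v' False,
            Link v v' False} \<subseteq> C"
          using Lq Z_facts(4) s unfolding Z_Node by auto
        ultimately have "is_W C V" unfolding is_W_def by blast
        then show ?thesis ..
      qed
    qed
  qed
qed

end

section \<open>Solvability of tree constraints\<close>

lemma four_colors: obtains d where "even_col d = p" "d \<noteq> a" "d \<noteq> b" "d \<noteq> c"
proof -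
  have "{d. even_col d = p} = (if p then {C0, C2, C4, C6} else {C1, C3, C5, C7})"
  proof (rule set_eqI)
    fix d show "d \<in> {d. even_col d = p} \<longleftrightarrow> d \<in> (if p then {C0, C2, C4, C6} else {C1, C3, C5, C7})"
      by (cases d; cases p; simp)
  qed
  then have "card {d. even_col d = p} = 4" by simp
  moreover have "card {a, b, c} \<le> 3" by (simp add: card_insert_if)
  ultimately have "\<not> {d. even_col d = p} \<subseteq> {a, b, c}"
      using card_mono[of "{a, b, c}" "{d. even_col d = p}"] by auto
  then show ?thesis using that by blast
qed

lemma rooted_source: "rooted v a b c C V \<Longrightarrow> Link x w s \<in> C \<Longrightarrow> x \<in> V"
  using Link_cons[of x w s v a] Link_cons[of x w s v b] Link_cons[of x w s v c]
      by (auto simp: rooted_def)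

text \<open>A tie would need a second vertex as its end. So there are three excluded colours,
  against four colours of the right parity.\<close>

lemma solvable_single:
  assumes wf_cons: "wf_cons par C V" and c: "rooted v a b c C V"
      and st: "lab a = {}" "lab b = {}" "lab c = {}"
  shows "solvable par C"
proof -
  have V: "V = {v}" and C: "C = cons v a \<union> cons v b \<union> cons v c"
      using c st by (auto simp: rooted_def)
  have nl: "Link x w s \<notin> C" for x w s
  proof
    assume L: "Link x w s \<in> C"
    then have "Link w x s \<in> C" "x \<noteq> w" using wf_cons unfolding wf_cons_def by blast+
    then show False using L rooted_source[OF c] V by blast
  qed
  have ex: "\<exists>g. t = Ban g" if "lab t = {}" "cons v t \<subseteq> C" for t
    using that nl lab_empty[OF that(1)] by auto
  obtain g1 g2 g3 where g: "a = Ban g1" "b = Ban g2" "c = Ban g3"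
    using ex[OF st(1)] ex[OF st(2)] ex[OF st(3)] C by blast
  obtain d where d: "even_col d = par v" "d \<noteq> g1" "d \<noteq> g2" "d \<noteq> g3" by (rule four_colors)
  have "par_ok par ((default_col par)(v := d))"
      using par_ok_default_col[of par] d by (auto simp: par_ok_def)
  then show ?thesis unfolding solvable_def
      using C g d by (intro exI[of _ "(default_col par)(v := d)"]) auto
qed

text \<open>The top vertex x of c has a tie that leaves c, and so leads to v. But tied vertices have
  equal parity, whereas x and v are adjacent.\<close>

lemma not_pure_root:
  assumes wf_cons: "wf_cons par C V" and c: "rooted v a b c C V"
      and st: "lab a = {}" "lab b = {}" and p: "pure c"
  shows False
proof -
  have pcc: "caterpillar c" and n: "tgt c \<inter> lab c = {}" using p by (auto simp: pure_def)
  obtain x l r where cn: "c = Node x l r" using caterpillar_Node[OF pcc] by blast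
  have C: "C = cons v a \<union> cons v b \<union> cons v c" and V: "V = insert v (lab c)"
      using c st by (auto simp: rooted_def)
  have "is_tie l \<or> is_tie r" using pcc cn by auto
  then obtain w s where "l = Tie w s \<or> r = Tie w s" by (cases l; cases r) auto
  then have L: "Link x w s \<in> C" "w \<in> tgt c" using C cn by auto
  then have "w \<notin> lab c" using n by blast
  moreover have "Link w x s \<in> C" using L(1) wf_cons unfolding wf_cons_def by blast
  then have "w \<in> V" using rooted_source[OF c] by blast
  ultimately have w: "w = v" using V by blast
  have par: "\<And>k. k \<in> C \<Longrightarrow> par_con par k" using wf_cons unfolding wf_cons_def by blast
  have "Near v x \<in> C" using C cn by auto
  then show False using par[OF L(1)] par[of "Near v x"] w by simp
qed

lemma splits_off_internal:
  assumes wf_cons: "wf_cons par C V" and sp: "splits_off C V Co q (Node y l r)"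
    and L: "Link x w s \<in> cons q (Node y l r)" "w \<in> lab (Node y l r)"
  shows "Link w x s \<in> cons q (Node y l r)" "x \<noteq> w" "x \<in> lab (Node y l r)"
proof -
  have C: "C = Co \<union> cons q (Node y l r)" by (rule splitD[OF sp])
  have "Link x w s \<in> C" using L C by blast
  then have "Link w x s \<in> C" and ne: "x \<noteq> w" using wf_cons unfolding wf_cons_def by blast+
  moreover have "Link w x s \<notin> Co" using splits_offD_link[OF sp] L(2) by blast
  ultimately show "Link w x s \<in> cons q (Node y l r)" using C by blast
  show "x \<noteq> w" by (rule ne)
  show "x \<in> lab (Node y l r)" using Link_cons_Node[OF L(1)] by blast
qed

lemma splits_off_facts:
  assumes wf_cons: "wf_cons par C V" and sp: "splits_off C V Co q Z"
  shows "dist_lab Z" "q \<notin> lab Z" "\<forall>k\<in>cons q Z. par_con par k"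
proof -
  show "dist_lab Z" "q \<notin> lab Z" using sp unfolding splits_off_def by blast+
  show "\<forall>k\<in>cons q Z. par_con par k" using wf_cons splitD[OF sp] unfolding wf_cons_def by blast
qed

lemma solvable_if_always_extends:
  fixes Z :: "'v item"
  assumes IH: "smaller_solvable par V"
    and wf_cons: "wf_cons par C V" and sp: "splits_off C V Co q Z" and Z: "Z = Node y l r"
    and ext: "\<And>f. par_ok par f \<Longrightarrow> \<exists>f'. extends par f q Z {} f'"
  shows "solvable par C"
proof (rule reduce_plain[OF IH wf_cons sp Z, of "default_col par" "default_col par q"])
  show "par_ok par (default_col par)" by (rule par_ok_default_col)
  show "even_col (default_col par q) = par q" by (rule pokD[OF par_ok_default_col])
qed (use ext in blast)+

lemma solvable_no_internal:
  fixes Z :: "'v item"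
  assumes IH: "smaller_solvable par V"
    and wf_cons: "wf_cons par C V" and sp: "splits_off C V Co q Z" and Z: "Z = Node y l r"
    and n: "tgt Z \<inter> lab Z = {}" and np: "\<not> caterpillar Z" and l: "lab l = {} \<or>
        caterpillar l" and r: "lab r = {} \<or> caterpillar r"
  shows "solvable par C"
proof -
  note f = splits_off_facts[OF wf_cons sp]
  have "one_msg par q Z" unfolding Z
    by (rule one_msg[OF f(1)[unfolded Z] f(3)[unfolded Z] np[unfolded Z] l r])
  then obtain b mu where b: "par_ok par b" "even_col mu = par q"
    and m: "\<And>f. par_ok par f \<Longrightarrow> avoid b f q Z \<Longrightarrow> msg {} f Z \<in> {None, Some mu}"
    unfolding one_msg_def by blast
  show ?thesis
  proof (rule reduce_plain[OF IH wf_cons sp Z b])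
    fix g assume g: "par_ok par g" and av: "\<And>x w s. Link x w s \<in> cons q Z \<Longrightarrow> w \<notin> lab Z \<Longrightarrow>
        opp_if s (g w) \<noteq> b x"
      and mu: "g q \<noteq> mu"
    have "avoid b g q Z" unfolding avoid_def
      using av Link_cons n by (metis disjoint_iff)
    then have "msg {} g Z \<noteq> Some (g q)" using m[OF g] mu by auto
    then show "\<exists>f'. extends par g q Z {} f'" using msg_ext[OF f(1) n g f(2,3)] by blast
  qed
qed

text \<open>Since r has no ties within itself, the internal tie joins the stub of y to a vertex of
  r, which is the case of \<open>root_link_ext\<close>.\<close>

lemma solvable_stub_pure:
  fixes l r :: "'v item"
  assumes IH: "smaller_solvable par V"
    and wf_cons: "wf_cons par C V" and sp: "splits_off C V Co q (Node y l r)"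
    and int: "tgt (Node y l r) \<inter> lab (Node y l r) \<noteq> {}" and l: "lab l = {}" and r: "pure r"
  shows "solvable par C"
proof -
  note f = splits_off_facts[OF wf_cons sp]
  have pr: "caterpillar r" "tgt r \<inter> lab r = {}" using r by (auto simp: pure_def)
  have src: "x \<in> lab r" if "Link x w s \<in> cons y r" for x w s
    using caterpillar_Node[OF pr(1)] Link_cons_Node that by metis
  have yr: "y \<notin> lab r" using f(1) by auto
  have srcl: "x = y \<and> l = Tie w s" if "Link x w s \<in> cons y l" for x w s
  proof -
    have "x = y" using Link_cons[OF that] l by auto
    then show ?thesis using cons_stub_link[of y w s l] that l by auto
  qed
  obtain w where w: "w \<in> tgt (Node y l r)" "w \<in> lab (Node y l r)" using int by blast
  obtain x s where L: "Link x w s \<in> cons q (Node y l r)" using tgt_Link[OF w(1)] by blast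
  note R = splits_off_internal[OF wf_cons sp L w(2)]
  have "\<exists>x0 s0. l = Tie x0 s0 \<and> Link x0 y s0 \<in> cons y r"
  proof (cases "Link x w s \<in> cons y l")
    case True
    then have 1: "x = y" "l = Tie w s" using srcl by blast+
    then have "Link w y s \<in> cons y l \<or> Link w y s \<in> cons y r" using R(1) by auto
    then show ?thesis using 1 R(2) srcl by blast
  next
    case False
    then have 1: "Link x w s \<in> cons y r" using L by auto
    then have "w \<notin> lab r" using Link_cons[OF 1] pr by blast
    then have 2: "w = y" using w l by auto
    then have "Link y x s \<in> cons y l" using R(1) src yr by auto
    then show ?thesis using srcl 1 2 by blast
  qed
  then obtain x0 s0 where x0: "l = Tie x0 s0" "Link x0 y s0 \<in> cons y r" by blast
  show ?thesis
  proof (rule solvable_if_always_extends[OF IH wf_cons sp refl])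
    fix g assume "par_ok par g"
    then show "\<exists>f'. extends par g q (Node y l r) {} f'"
      using root_link_ext[OF f(1)[unfolded x0(1)] pr x0(2)] f(2,3) unfolding x0(1) by blast
  qed
qed

text \<open>As y has no stub, the internal ties run between l and r. If both are of type
  \<open>top_crossing\<close>, the only tie of l into r is also the only tie of r into l; so it
  joins the two roots, and the subtree is a cherry.\<close>

lemma solvable_pure_pure:
  fixes l r :: "'v item"
  assumes IH: "smaller_solvable par V"
    and wf_cons: "wf_cons par C V" and sp: "splits_off C V Co q (Node y l r)"
    and int: "tgt (Node y l r) \<inter> lab (Node y l r) \<noteq> {}" and l: "pure l" and r: "pure r"
  shows "solvable par C \<or> is_W C V"
proof -
  note f = splits_off_facts[OF wf_cons sp]
  have pl: "caterpillar l" "tgt l \<inter> lab l = {}" and pr: "caterpillar r" "tgt r \<inter> lab r = {}"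
      using l r by (auto simp: pure_def)
  have srcr: "x \<in> lab r" if "Link x w s \<in> cons y r" for x w s
    using caterpillar_Node[OF pr(1)] Link_cons_Node that by metis
  have srcl: "x \<in> lab l" if "Link x w s \<in> cons y l" for x w s
    using caterpillar_Node[OF pl(1)] Link_cons_Node that by metis
  have d: "y \<notin> lab l" "y \<notin> lab r" "lab l \<inter> lab r = {}" using f(1) by auto
  have csZ: "Link x w s \<in> cons q (Node y l r) \<longleftrightarrow>
      Link x w s \<in> cons y l \<or> Link x w s \<in> cons y r" for x w s
    by auto
  note R = splits_off_internal[OF wf_cons sp]
  have noy: "\<not> (Link x y s \<in> cons q (Node y l r))" for x s
  proof
    assume "Link x y s \<in> cons q (Node y l r)"
    then have "Link y x s \<in> cons q (Node y l r)" using R(1) by auto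
    then show False using csZ srcl srcr d by blast
  qed
  have yt: "y \<notin> tgt l" "y \<notin> tgt r" using noy tgt_Link[of y l y] tgt_Link[of y r y] csZ by blast+
  have lr: "Link w x s \<in> cons y r" if "Link x w s \<in> cons y l" "w \<in> lab r" for x w s
  proof -
    have "Link w x s \<in> cons q (Node y l r)" using R(1)[of x w s] that csZ by auto
    then show ?thesis using csZ srcl that(2) d by blast
  qed
  have rl: "Link w x s \<in> cons y l" if "Link x w s \<in> cons y r" "w \<in> lab l" for x w s
  proof -
    have "Link w x s \<in> cons q (Node y l r)" using R(1)[of x w s] that csZ by auto
    then show ?thesis using csZ srcr that(2) d by blast
  qed
  obtain w where w: "w \<in> tgt l \<union> tgt r" "w \<in> lab l \<union> lab r" using int yt by auto
  have cr: "tgt l \<inter> lab r \<noteq> {} \<and> tgt r \<inter> lab l \<noteq> {}"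
  proof (cases "w \<in> tgt l")
    case True
    then obtain x s where L: "Link x w s \<in> cons y l" using tgt_Link[of w l y] by blast
    have "w \<in> lab r" using True w pl by blast
    moreover from this have "x \<in> tgt r" using Link_cons[OF lr[OF L]] by blast
    ultimately show ?thesis using True srcl[OF L] by blast
  next
    case False
    then have wr: "w \<in> tgt r" using w by blast
    then obtain x s where L: "Link x w s \<in> cons y r" using tgt_Link[of w r y] by blast
    have "w \<in> lab l" using wr w pr by blast
    moreover from this have "x \<in> tgt l" using Link_cons[OF rl[OF L]] by blast
    ultimately show ?thesis using wr srcr[OF L] by blast
  qed
  have cross: "cross par g q y l r" if "par_ok par g" for g
    unfolding cross_def using pl pr f yt cr that lr rl by blast
  show ?thesis
  proof (cases "top_crossing (lab r) l \<and> top_crossing (lab l) r")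
    case False
    have "solvable par C"
    proof (rule solvable_if_always_extends[OF IH wf_cons sp refl])
      fix g assume "par_ok par g"
      then show "\<exists>f'. extends par g q (Node y l r) {} f'"
          using cross_ext[OF cross, of g] False by blast
    qed
    then show ?thesis ..
  next
    case True
    then obtain v w s t where L: "l = Node v (Tie w s) t \<or>
        l = Node v t (Tie w s)" "w \<in> lab r" "tgt t \<inter> lab r = {}"
      unfolding top_crossing_def by blast
    from True obtain v' w' s' t' where L': "r = Node v' (Tie w' s') t' \<or>
        r = Node v' t' (Tie w' s')" "w' \<in> lab l"
      "tgt t' \<inter> lab l = {}"
      unfolding top_crossing_def by blast
    have "Link v w s \<in> cons y l" using L(1) by auto
    then have "Link w v s \<in> cons y r" using lr L(2) by blast
    moreover have "Link w v s \<notin> cons v' t'"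
    proof
      assume "Link w v s \<in> cons v' t'"
      then have "v \<in> tgt t'" using Link_cons by fastforce
      then show False using L(1) L'(3) by auto
    qed
    ultimately have e: "w = v'" "w' = v" "s' = s" using L'(1) by auto
    have cl: "cons q l = cons q (Node v (Tie v' s) t)" "lab l = lab (Node v (Tie v' s) t)"
        "dist_lab l = dist_lab (Node v (Tie v' s) t)"
      "tgt l = tgt (Node v (Tie v' s) t)" for q
      using L(1) e by auto
    have cr: "cons q r = cons q (Node v' (Tie v s) t')" "lab r = lab (Node v' (Tie v s) t')"
        "dist_lab r = dist_lab (Node v' (Tie v s) t')"
      "tgt r = tgt (Node v' (Tie v s) t')" for q
      using L'(1) e by auto
    let ?Z = "cherry y v v' s t t'"
    have Z: "cons q ?Z = cons q (Node y l r)" "lab ?Z = lab (Node y l r)"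
        "dist_lab ?Z = dist_lab (Node y l r)"
      by (simp_all only: cherry_def cons.simps(3)[of _ y] lab.simps(1)[of y]
          dist_lab.simps(1)[of y] cl cr)
    have sp': "splits_off C V Co q ?Z" by (rule splits_off_item_cong[OF sp Z])
    have labs: "lab ?Z = insert y (lab l \<union> lab r)" using Z(2) by simp
    have tt: "tgt t \<inter> lab ?Z = {}" "tgt t' \<inter> lab ?Z = {}"
      unfolding labs using L(3) L'(3) pl pr yt cl(4) cr(4) by auto
    have pt: "caterpillar t \<or> is_tie t" "caterpillar t' \<or>
        is_tie t'" using pl(1) pr(1) L(1) L'(1) by auto
    have dt: "\<exists>c s. t = Tie c s" if "is_tie t" for t :: "'v item" using that by (cases t) auto
    show ?thesis
    proof (cases "caterpillar t'")
      case True
      then have "solvable par C" using solvable_caterpillar_right[OF IH wf_cons refl sp' tt] pt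
          dt by blast
      then show ?thesis ..
    next
      case nt': False
      then obtain c' s2 where t': "t' = Tie c' s2" using pt dt by blast
      show ?thesis
      proof (cases "caterpillar t")
        case True
        have sp'': "splits_off C V Co q (cherry y v' v s t' t)"
            by (rule splits_off_item_cong[OF sp' cherry_sym])
        have "solvable par C"
          by (rule solvable_caterpillar_right[OF IH wf_cons refl sp''])
             (use tt cherry_sym(2)[of y v' v s t' t] True t' in auto)
        then show ?thesis ..
      next
        case False
        then obtain c s1 where "t = Tie c s1" using pt dt by blast
        then show ?thesis using solvable_cherry[OF IH wf_cons refl sp' tt] t' by blast
      qed
    qed
  qed
qed

theorem tree_solvable: "wf_cons par C V \<Longrightarrow> solvable par C \<or> is_W C V"
proof (induction "card V" arbitrary: C V rule: less_induct)
  case (less V C)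
  note wf_cons = less.prems
  have IH: "smaller_solvable par V" unfolding smaller_solvable_def using less.hyps by blast
  have "is_tree C V" using wf_cons unfolding wf_cons_def by blast
  \<comment> \<open>Rooted at a leaf, the rest of the tree is a single item c, in which a minimal
    subtree can be sought.\<close>
  then obtain v a b c where c: "rooted v a b c C V" and st: "lab a = {}" "lab b = {}"
    using reroot_leaf by blast
  consider "lab c = {}" | "pure c" | k y l r
      where "item_equiv c (plug k (Node y l r))" "\<not> pure (Node y l r)"
     "lab l = {} \<or> pure l" "lab r = {} \<or> pure r"
    using minimal_nonpure[of c] by blast
  then show ?case
  proof cases
    case 1
    then show ?thesis using solvable_single[OF wf_cons c st] by blast
  next
    case 2
    then show ?thesis using not_pure_root[OF wf_cons c st] by blast
  next
    case 3
    have "rooted v a b (plug k (Node y l r)) C V"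
      using c 3(1) unfolding rooted_def item_equiv_def by simp
    from splits_off_plug[OF this st]
    obtain Co q where sp: "splits_off C V Co q (Node y l r)" by blast
    have pp: "lab l = {} \<or> caterpillar l" "lab r = {} \<or>
        caterpillar r" using 3 by (auto simp: pure_def)
    show ?thesis
    proof (cases "tgt (Node y l r) \<inter> lab (Node y l r) = {}")
      case True
      then have "\<not> caterpillar (Node y l r)" using 3(2) by (simp add: pure_def)
      then show ?thesis using solvable_no_internal[OF IH wf_cons sp refl True _ pp] by blast
    next
      case int: False
      have sp': "splits_off C V Co q (Node y r l)" by (rule splits_off_item_cong[OF sp]) auto
      have int': "tgt (Node y r l) \<inter> lab (Node y r l) \<noteq> {}" using int by (simp add: Un_commute)
      consider "lab l = {}" "lab r = {}" | "lab l = {}" "pure r" | "pure l"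
          "lab r = {}" | "pure l" "pure r"
        using 3 by blast
      then show ?thesis
      proof cases
        case 1
        obtain w where w: "w \<in> tgt (Node y l r)" "w \<in> lab (Node y l r)" using int by blast
        obtain x s where L: "Link x w s \<in> cons q (Node y l r)" using tgt_Link[OF w(1)] by blast
        then show ?thesis using splits_off_internal(2,3)[OF wf_cons sp L w(2)] w(2) 1 by auto
      next
        case 2 then show ?thesis using solvable_stub_pure[OF IH wf_cons sp int] by blast
      next
        case 3 then show ?thesis using solvable_stub_pure[OF IH wf_cons sp' int'] by blast
      next
        case 4 then show ?thesis using solvable_pure_pure[OF IH wf_cons sp int] by blast
      qed
    qed
  qed
qed

section \<open>Homomorphisms as colourings, and counting\<close>

abbreviation sgneg :: "'a signed_graph \<Rightarrow> 'a \<Rightarrow> 'a \<Rightarrow> bool" where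
  "sgneg G u v \<equiv> sgn_of G {u, v} = Negative"

definition colours_graph :: "'a signed_graph \<Rightarrow> ('a \<Rightarrow> col) \<Rightarrow> bool" where
  "colours_graph G \<phi> \<longleftrightarrow> (\<forall>u v. {u, v} \<in> edges G \<longrightarrow> near (\<phi> u) (opp_if (sgneg G u v) (\<phi> v)))"

lemma switch_sign_pair:
  "u \<noteq> v \<Longrightarrow> switch_sign X s {u, v} = Negative \<longleftrightarrow> ((s {u, v} = Negative) \<noteq> ((u \<in> X) \<noteq> (v \<in> X)))"
  by (cases "s {u, v}"; cases "u \<in> X"; cases "v \<in> X") (auto simp: switch_sign_def Int_insert_left)

lemma sign_eqI: "(a = Negative \<longleftrightarrow> b = Negative) \<Longrightarrow> a = b"
  by (cases a; cases b; simp)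

fun base_col :: "c4_vertex \<Rightarrow> col" where
  "base_col U1 = C0" | "base_col U2 = C1" | "base_col U3 = C2" | "base_col U4 = C3"

lemma C4_edges: "{a, b} \<in> edges C_minus_4 \<longleftrightarrow>
    (a, b) \<in> {(U1, U2), (U2, U1), (U2, U3), (U3, U2), (U3, U4), (U4, U3), (U4, U1), (U1, U4)}"
  by (cases a; cases b; simp add: C_minus_4_def graph_of_signed_edges_def doubleton_eq_iff)

lemma C4_sign: "sgn_of C_minus_4 {a, b} = Negative \<longleftrightarrow> (a, b) \<in> {(U4, U1), (U1, U4)}"
  by (cases a; cases b; simp add: C_minus_4_def graph_of_signed_edges_def doubleton_eq_iff)

lemma base_near: "{a, b} \<in> edges C_minus_4 \<Longrightarrow>
    near (base_col a) (opp_if (sgn_of C_minus_4 {a, b} = Negative) (base_col b))"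
  by (cases a; cases b; simp add: C4_edges C4_sign near_def opp_if_def del: insert_absorb2)

lemma simple_edge:
  assumes "simple_signed_graph G" "{u, v} \<in> edges G"
  shows "u \<noteq> v" "u \<in> verts G" "v \<in> verts G"
  using assms by (fastforce simp: simple_signed_graph_def)+

lemma homomorphic_imp_colours_graph:
  assumes s: "simple_signed_graph G" and h: "homomorphic G C_minus_4"
  shows "\<exists>\<phi>. colours_graph G \<phi>"
proof -
  obtain s' f where sw: "switching_equivalent G (sgn_of G) s'"
    and f: "\<And>u v. {u, v} \<in> edges G \<Longrightarrow>
        {f u, f v} \<in> edges C_minus_4 \<and> sgn_of C_minus_4 {f u, f v} = s' {u, v}"
    using h unfolding homomorphic_def by blast
  obtain X where X: "\<And>e. e \<in> edges G \<Longrightarrow> s' e = switch_sign X (sgn_of G) e"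
    using sw unfolding switching_equivalent_def by blast
  \<comment> \<open>Vertices of the switching set X use the second copy, 4 further on.\<close>
  have "colours_graph G (\<lambda>u. opp_if (u \<in> X) (base_col (f u)))"
    unfolding colours_graph_def
  proof (intro allI impI)
    fix u v assume e: "{u, v} \<in> edges G"
    have ne: "u \<noteq> v" using simple_edge[OF s e] by blast
    have "sgn_of C_minus_4 {f u, f v} = Negative \<longleftrightarrow> (sgneg G u v \<noteq> ((u \<in> X) \<noteq> (v \<in> X)))"
      using f[OF e] X[OF e] switch_sign_pair[OF ne] by simp
    then have "near (base_col (f u)) (opp_if (sgneg G u v \<noteq> ((u \<in> X) \<noteq> (v \<in> X))) (base_col (f v)))"
      using base_near[of "f u" "f v"] f[OF e] by simp
    then show "near (opp_if (u \<in> X) (base_col (f u))) (opp_if (sgneg G u v) (opp_if (v \<in> X)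
        (base_col (f v))))"
      by (cases "u \<in> X"; cases "v \<in> X"; cases "sgneg G u v") (simp_all add: near_opp_if_swap)
  qed
  then show ?thesis by blast
qed

text \<open>The colour modulo 4 tells the vertex of the cycle; the half it lies in tells whether to
  switch.\<close>

fun c4_of :: "col \<Rightarrow> c4_vertex" where
  "c4_of C0 = U1" | "c4_of C1 = U2" | "c4_of C2 = U3" | "c4_of C3 = U4"
| "c4_of C4 = U1" | "c4_of C5 = U2" | "c4_of C6 = U3" | "c4_of C7 = U4"

fun upper_half :: "col \<Rightarrow> bool" where
  "upper_half C0 = False" | "upper_half C1 = False" | "upper_half C2 = False" | "upper_half C3 =
      False"
| "upper_half C4 = True" | "upper_half C5 = True" | "upper_half C6 = True" | "upper_half C7 = True"

lemma near_c4_of: "near a (opp_if n b) \<Longrightarrow> {c4_of a, c4_of b} \<in> edges C_minus_4 \<and>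
    (sgn_of C_minus_4 {c4_of a, c4_of b} = Negative \<longleftrightarrow> (n \<noteq> (upper_half a \<noteq> upper_half b)))"
  by (cases a; cases b; cases n; simp add: near_def opp_if_def C4_edges C4_sign del: insert_absorb2)

lemma colours_graph_imp_homomorphic:
  assumes s: "simple_signed_graph G" and g: "colours_graph G \<phi>"
  shows "homomorphic G C_minus_4"
  unfolding homomorphic_def
proof (intro exI conjI allI impI)
  let ?X = "{u \<in> verts G. upper_half (\<phi> u)}"
  show "switching_equivalent G (sgn_of G) (switch_sign ?X (sgn_of G))"
    unfolding switching_equivalent_def by (rule exI[of _ ?X]) auto
  show "(\<lambda>u. c4_of (\<phi> u)) ` verts G \<subseteq> verts C_minus_4"
    using c4_vertex.exhaust by (auto simp: C_minus_4_def graph_of_signed_edges_def)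
  fix u v assume e: "{u, v} \<in> edges G"
  note n = near_c4_of[of "\<phi> u" "sgneg G u v" "\<phi> v"] simple_edge[OF s e]
  have ne: "near (\<phi> u) (opp_if (sgneg G u v) (\<phi> v))" using g e unfolding colours_graph_def by blast
  then show "{c4_of (\<phi> u), c4_of (\<phi> v)} \<in> edges C_minus_4" using n by blast
  have "sgn_of C_minus_4 {c4_of (\<phi> u), c4_of (\<phi> v)} = Negative \<longleftrightarrow>
      switch_sign ?X (sgn_of G) {u, v} = Negative"
    using n(1)[OF ne] switch_sign_pair[OF n(2), of ?X "sgn_of G"] n(3,4) by simp
  then show "sgn_of C_minus_4 {c4_of (\<phi> u), c4_of (\<phi> v)} = switch_sign ?X (sgn_of G) {u, v}"
    by (rule sign_eqI)
qed

text \<open>This is the whole effect of a 2-vertex: it can be coloured unless its two edges, signs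
  included, ask for opposite colours.\<close>

lemma common_near: "even_col a = even_col b \<Longrightarrow> b \<noteq> opp a \<Longrightarrow> \<exists>d. near d a \<and> near d b"
  by (rule exI[of _ "if b = up (up a) \<or> b = a then up a else up b"])
     (cases a; cases b; simp add: near_def)

lemma near_up: "near a (opp_if n b) \<Longrightarrow> near (up a) (opp_if n (up b))"
  by (cases a; cases b; cases n; simp add: near_def opp_if_def)

lemma card_2_other:
  assumes "card A = 2" "w \<in> A"
  obtains x where "A = {x, w}" "x \<noteq> w"
proof -
  obtain a b where ab: "A = {a, b}" "a \<noteq> b" using assms(1) by (auto simp: card_2_iff)
  show ?thesis
  proof (cases "w = a")
    case True then show ?thesis using that[of b] ab by auto
  next
    case False then show ?thesis using that[of a] ab assms(2) by auto
  qed
qed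

lemma sum_card_incident:
  assumes F: "finite F" "\<And>e. e \<in> F \<Longrightarrow> card e = 2" and P: "finite P"
  shows "(\<Sum>v\<in>P. card {u. {v, u} \<in> F}) = (\<Sum>e\<in>F. card (e \<inter> P))"
proof -
  have 1: "card {u. {v, u} \<in> F} = (\<Sum>e\<in>F. of_bool (v \<in> e))" for v
  proof -
    have "bij_betw (\<lambda>u. {v, u}) {u. {v, u} \<in> F} {e \<in> F. v \<in> e}"
      unfolding bij_betw_def
    proof
      show "inj_on (\<lambda>u. {v, u}) {u. {v, u} \<in> F}" by (auto simp: inj_on_def doubleton_eq_iff)
      show "(\<lambda>u. {v, u}) ` {u. {v, u} \<in> F} = {e \<in> F. v \<in> e}"
      proof
        show "{e \<in> F. v \<in> e} \<subseteq> (\<lambda>u. {v, u}) ` {u. {v, u} \<in> F}"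
        proof
          fix e assume "e \<in> {e \<in> F. v \<in> e}"
          then have e: "e \<in> F" "v \<in> e" by auto
          then obtain a b where "e = {a, b}" using F(2)[OF e(1)] by (auto simp: card_2_iff)
          then have "\<exists>u. e = {v, u}" using e(2) by auto
          then show "e \<in> (\<lambda>u. {v, u}) ` {u. {v, u} \<in> F}" using e(1) by blast
        qed
      qed auto
    qed
    then have "card {u. {v, u} \<in> F} = card {e \<in> F. v \<in> e}" by (rule bij_betw_same_card)
    also have "\<dots> = (\<Sum>e\<in>F. of_bool (v \<in> e))" using F(1) by (simp add: Int_def)
    finally show ?thesis .
  qed
  have "(\<Sum>v\<in>P. card {u. {v, u} \<in> F}) = (\<Sum>v\<in>P. \<Sum>e\<in>F. of_bool (v \<in> e))" by (simp only: 1)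
  also have "\<dots> = (\<Sum>e\<in>F. \<Sum>v\<in>P. of_bool (v \<in> e))" by (rule sum.swap)
  also have "\<dots> = (\<Sum>e\<in>F. card (e \<inter> P))" using P by (simp add: Int_def conj_commute)
  finally show ?thesis .
qed

section \<open>Critical graphs and the count of edges\<close>

locale crit =
  fixes G :: "'a signed_graph" and par :: "'a \<Rightarrow> bool"
  assumes crit: "C_minus_4_critical G"
    and par: "\<And>u v. {u, v} \<in> edges G \<Longrightarrow> par u \<noteq> par v"
begin

abbreviation "V \<equiv> verts G"
abbreviation "E \<equiv> edges G"
abbreviation "sg \<equiv> sgneg G"

definition nbrs :: "'a \<Rightarrow> 'a set" where "nbrs v = {u. {v, u} \<in> E}"

lemma simple: "simple_signed_graph G" using crit by (simp add: C_minus_4_critical_def)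

lemma finV: "finite V" using simple by (simp add: simple_signed_graph_def)

lemma finE: "finite E"
proof -
  have "E \<subseteq> Pow V" using simple by (auto simp: simple_signed_graph_def)
  then show ?thesis using finV by (meson finite_Pow_iff finite_subset)
qed

lemma card_edge: "e \<in> E \<Longrightarrow> card e = 2" using simple by (simp add: simple_signed_graph_def)

lemma nbrs_sym: "u \<in> nbrs v \<longleftrightarrow> v \<in> nbrs u" by (simp add: nbrs_def insert_commute)

lemma nbrs_V: "u \<in> nbrs v \<Longrightarrow> u \<in> V \<and> v \<in> V \<and> u \<noteq> v"
  using simple_edge[OF simple, of v u] by (auto simp: nbrs_def)

lemma nbrs_par: "u \<in> nbrs v \<Longrightarrow> par u \<noteq> par v" using par[of v u] by (auto simp: nbrs_def)

lemma fin_nbrs: "finite (nbrs v)"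
  by (rule finite_subset[OF _ finV]) (use nbrs_V in blast)

lemma sg_sym: "sg u v = sg v u" by (simp add: insert_commute)

definition colors :: "('a \<Rightarrow> col) \<Rightarrow> 'a set \<Rightarrow> bool" where
  "colors \<phi> W \<longleftrightarrow> par_ok par \<phi> \<and> (\<forall>u\<in>W. \<forall>v\<in>W. v \<in> nbrs u \<longrightarrow> near (\<phi> u) (opp_if (sg u v) (\<phi> v)))"

lemma not_colors: "\<not> colors \<phi> V"
proof
  assume "colors \<phi> V"
  then have "colours_graph G \<phi>" unfolding colours_graph_def colors_def nbrs_def
      using simple_edge[OF simple] by auto
  then show False using colours_graph_imp_homomorphic[OF simple] crit
      by (auto simp: C_minus_4_critical_def)
qed

lemma colors_delete:
  assumes "W \<inter> V \<noteq> {}"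
  shows "\<exists>\<phi>. colors \<phi> (V - W)"
proof -
  define H where "H = \<lparr>verts = V - W, edges = {e \<in> E. e \<subseteq> V - W}, sgn_of = sgn_of G\<rparr>"
  have sH: "simple_signed_graph H" using simple by (auto simp: simple_signed_graph_def H_def)
  have "proper_signed_subgraph H G"
    unfolding proper_signed_subgraph_def signed_subgraph_def
    using sH assms by (auto simp: H_def)
  then have "homomorphic H C_minus_4" using crit by (simp add: C_minus_4_critical_def)
  then obtain \<phi> where g: "colours_graph H \<phi>" using homomorphic_imp_colours_graph[OF sH] by blast
  \<comment> \<open>The colouring of H need not follow \<open>par\<close>: along each edge both ends
    have the right parity or both the wrong one, so vertices of wrong parity fill whole components
    and can be shifted by 1 together.\<close>
  define \<psi> where "\<psi> u = (if even_col (\<phi> u) = par u then \<phi> u else up (\<phi> u))" for u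
  have evn: "even_col (up c) = (\<not> even_col c)" for c by (cases c) auto
  have "colors \<psi> (V - W)"
    unfolding colors_def
  proof (intro conjI ballI impI)
    show "par_ok par \<psi>" unfolding par_ok_def \<psi>_def by (auto simp: evn)
    fix u v assume uv: "u \<in> V - W" "v \<in> V - W" "v \<in> nbrs u"
    then have "{u, v} \<in> edges H" by (auto simp: H_def nbrs_def)
    from g[unfolded colours_graph_def, rule_format, OF this]
    have n: "near (\<phi> u) (opp_if (sg u v) (\<phi> v))" by (simp add: H_def)
    then have "even_col (\<phi> v) \<noteq> even_col (\<phi> u)" using near_even_col[OF n] by simp
    moreover have "par u \<noteq> par v" using nbrs_par uv by blast
    ultimately have "even_col (\<phi> u) = par u \<longleftrightarrow> even_col (\<phi> v) = par v" by auto
    then show "near (\<psi> u) (opp_if (sg u v) (\<psi> v))"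
      using n near_up[OF n] by (auto simp: \<psi>_def)
  qed
  then show ?thesis by blast
qed

lemma colors_vertex:
  assumes c: "colors \<phi> (V - W)" and w: "w \<in> W" and d: "even_col d = par w"
    "\<And>u. u \<in> nbrs w \<Longrightarrow> u \<in> V - W \<Longrightarrow> near d (opp_if (sg w u) (\<phi> u))"
  shows "colors (\<phi>(w := d)) (V - (W - {w}))"
  unfolding colors_def
proof (intro conjI ballI impI)
  show "par_ok par (\<phi>(w := d))" using c d(1) by (auto simp: colors_def par_ok_def)
  fix u v assume uv: "u \<in> V - (W - {w})" "v \<in> V - (W - {w})" "v \<in> nbrs u"
  have ne: "u \<noteq> v" using uv nbrs_V by blast
  consider "u \<in> V - W" "v \<in> V - W" "u \<noteq> w" "v \<noteq> w" | "u = w" "v \<in> V - W" "v \<noteq> w" | "v = w"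
      "u \<in> V - W" "u \<noteq> w"
    using uv ne w by blast
  then show "near ((\<phi>(w := d)) u) (opp_if (sg u v) ((\<phi>(w := d)) v))"
  proof cases
    case 1 then show ?thesis using c uv by (auto simp: colors_def)
  next
    case 2 then show ?thesis using d(2)[of v] uv by simp
  next
    case 3
    then have "near d (opp_if (sg w u) (\<phi> u))" using d(2)[of u] uv nbrs_sym by blast
    then have "near (\<phi> u) (opp_if (sg w u) d)" using near_opp_if_swap near_sym by metis
    then show ?thesis using 3 sg_sym[of u w] by simp
  qed
qed

lemma card_nbrs_ge2:
  assumes v: "v \<in> V"
  shows "2 \<le> card (nbrs v)"
proof (rule ccontr)
  assume "\<not> 2 \<le> card (nbrs v)"
  then have "card (nbrs v) = 0 \<or> card (nbrs v) = 1" by auto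
  then have "\<exists>x. nbrs v \<subseteq> {x}"
  proof
    assume "card (nbrs v) = 0"
    then show ?thesis using fin_nbrs[of v] by simp
  next
    assume "card (nbrs v) = 1"
    then obtain x where "nbrs v = {x}" by (rule card_1_singletonE)
    then show ?thesis by blast
  qed
  then obtain x where x: "nbrs v \<subseteq> {x}" by blast
  obtain \<phi> where c: "colors \<phi> (V - {v})" using colors_delete[of "{v}"] v by blast
  have "\<exists>d. even_col d = par v \<and> (\<forall>u\<in>nbrs v. near d (opp_if (sg v u) (\<phi> u)))"
  proof (cases "nbrs v = {}")
    case True
    then show ?thesis using pokD[OF par_ok_default_col, of par v]
        by (intro exI[of _ "default_col par v"]) simp
  next
    case False
    then have nbx: "nbrs v = {x}" using x by blast
    obtain d where d: "near (opp_if (sg v x) (\<phi> x)) d" using near_choice by blast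
    have "par x \<noteq> par v" using nbrs_par nbx by blast
    then have "even_col d = par v" using near_even_col[OF d] c by (simp add: colors_def par_ok_def)
    then show ?thesis using nbx d near_sym by auto
  qed
  then obtain d where "even_col d = par v" "\<And>u. u \<in> nbrs v \<Longrightarrow>
      near d (opp_if (sg v u) (\<phi> u))" by blast
  from colors_vertex[OF c, of v d] this have "colors (\<phi>(v := d)) (V - ({v} - {v}))" by blast
  then show False using not_colors by simp
qed

definition "V2 = {v \<in> V. card (nbrs v) = 2}"
definition "V3 = {v \<in> V. card (nbrs v) = 3}"

text \<open>Given the colour of z there are two colours for w, and at most one of them leaves no
  colour for u.\<close>

lemma V2_not_adjacent:
  assumes u: "u \<in> V2" and w: "w \<in> V2"
  shows "w \<notin> nbrs u"
proof
  assume adj: "w \<in> nbrs u"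
  have uw: "u \<in> V" "w \<in> V" "u \<noteq> w" using adj nbrs_V by blast+
  obtain x where x: "nbrs u = {x, w}" "x \<noteq> w"
    using card_2_other[of "nbrs u" w] u adj unfolding V2_def by blast
  have wu: "u \<in> nbrs w" using adj nbrs_sym by blast
  obtain z where z: "nbrs w = {z, u}" "z \<noteq> u"
    using card_2_other[of "nbrs w" u] w wu unfolding V2_def by blast
  obtain \<phi> where c: "colors \<phi> (V - {u, w})" using colors_delete[of "{u, w}"] uw by blast
  have pk: "even_col (\<phi> t) = par t" for t using c by (simp add: colors_def par_ok_def)
  have pr: "par x \<noteq> par u" "par w \<noteq> par u" "par z \<noteq> par w" using nbrs_par x z by blast+
  let ?A = "opp_if (sg u x) (\<phi> x)" and ?B = "opp_if (sg w z) (\<phi> z)"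
  \<comment> \<open>The excluded colour is the one by which w would ask u for the opposite of what x
    asks for.\<close>
  obtain b where b: "near ?B b" "b \<noteq> opp_if (sg u w) (opp ?A)" by (rule near_choice)
  have "even_col b = even_col ?A" using near_even_col[OF b(1)] pk pr by auto
  moreover have "opp_if (sg u w) b \<noteq> opp ?A" using b(2) opp_if_eq_iff by metis
  ultimately obtain a where a: "near a ?A" "near a (opp_if (sg u w) b)"
    using common_near[of ?A "opp_if (sg u w) b"] by auto
  have eb: "even_col b = par w" using near_even_col[OF b(1)] pk pr by auto
  have ea: "even_col a = par u" using near_even_col[OF a(1)] pk pr by auto
  have "colors (\<phi>(w := b)) (V - ({u, w} - {w}))"
    by (rule colors_vertex[OF c]) (use eb z b near_sym in auto)
  then have c2: "colors (\<phi>(w := b)) (V - {u})" using uw by (simp add: insert_Diff_if)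
  have "colors ((\<phi>(w := b))(u := a)) (V - ({u} - {u}))"
    by (rule colors_vertex[OF c2]) (use ea x a in auto)
  then show False using not_colors by simp
qed

lemma sum_card_nbrs: "P \<subseteq> V \<Longrightarrow> (\<Sum>v\<in>P. card (nbrs v)) = (\<Sum>e\<in>E. card (e \<inter> P))"
  unfolding nbrs_def
  by (rule sum_card_incident[OF finE card_edge]) (use finV finite_subset in auto)

definition star :: "'a set \<Rightarrow> 'a set set" where
  "star S = {e \<in> E. e \<inter> S \<noteq> {} \<and> e \<inter> V2 = {}}"

definition inner :: "'a set \<Rightarrow> 'a set set" where
  "inner R = {e \<in> E. e \<subseteq> R}"

text \<open>For S within V3 this says that S is a union of components of the graph without
  V2.\<close>

definition nbr_closed :: "'a set \<Rightarrow> bool" where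
  "nbr_closed S \<longleftrightarrow> (\<forall>v\<in>S. nbrs v \<subseteq> S \<union> V2)"

text \<open>A vertex of S with a neighbour outside S and V2 is paid for by the edge to it, which is
  lost from \<open>star\<close> on removing the vertex; a set R with at least as many inner edges as
  vertices is paid for by these. If neither exists, S is closed and induces a forest, which
  \<open>key\<close> refutes.\<close>

lemma count_from_key:
  assumes key: "\<And>S. S \<subseteq> V3 \<Longrightarrow> S \<noteq> {} \<Longrightarrow> nbr_closed S \<Longrightarrow>
      (\<And>R. R \<subseteq> S \<Longrightarrow> R \<noteq> {} \<Longrightarrow> card (inner R) < card R) \<Longrightarrow> False"
  shows "S \<subseteq> V3 \<Longrightarrow> card S \<le> card (star S)"
proof (induction "card S" arbitrary: S rule: less_induct)
  case less
  have finS: "finite S" using less.prems finV finite_subset unfolding V3_def by fastforce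
  have fe: "finite (star A)" "finite (inner A)" for A
      using finE by (simp_all add: star_def inner_def)
  have V23: "V2 \<inter> V3 = {}" by (auto simp: V2_def V3_def)
  show ?case
  proof (cases "nbr_closed S")
    case False
    then obtain v w where v: "v \<in> S" "w \<in> nbrs v" "w \<notin> S" "w \<notin> V2" by (auto simp: nbr_closed_def)
    have "card (S - {v}) \<le> card (star (S - {v}))"
    proof (rule less.hyps)
      show "card (S - {v}) < card S" using v finS by (intro psubset_card_mono) auto
      show "S - {v} \<subseteq> V3" using less.prems by blast
    qed
    also have "star (S - {v}) \<subset> star S"
    proof
      show "star (S - {v}) \<subseteq> star S" by (auto simp: star_def)
      have "{v, w} \<in> star S" using v less.prems V23 by (auto simp: star_def nbrs_def)
      moreover have "{v, w} \<notin> star (S - {v})" using v by (auto simp: star_def)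
      ultimately show "star (S - {v}) \<noteq> star S" by blast
    qed
    then have "card (star (S - {v})) < card (star S)" using fe psubset_card_mono by blast
    finally show ?thesis using v finS by (simp add: card_Diff_singleton)
  next
    case cl: True
    show ?thesis
    proof (cases "S = {}")
      case False
      then obtain R where R: "R \<subseteq> S" "R \<noteq> {}" "card R \<le> card (inner R)"
        using key[OF less.prems False cl] not_less by blast
      have ine: "inner R \<subseteq> star S"
      proof
        fix e assume e: "e \<in> inner R"
        then have "card e = 2" "e \<subseteq> S" "e \<in> E" using card_edge R by (auto simp: inner_def)
        moreover from this have "e \<noteq> {}" by auto
        ultimately show "e \<in> star S" using less.prems V23 by (auto simp: star_def)
      qed
      have "card (S - R) \<le> card (star (S - R))"
      proof (rule less.hyps)
        show "card (S - R) < card S" using R finS by (intro psubset_card_mono) auto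
      qed (use less.prems in auto)
      moreover have "inner R \<inter> star (S - R) = {}" by (auto simp: inner_def star_def)
      then have "card (inner R \<union> star (S - R)) = card (inner R) + card (star (S - R))"
        using fe by (intro card_Un_disjoint) auto
      moreover have "inner R \<union> star (S - R) \<subseteq> star S" using ine by (auto simp: star_def)
      then have "card (inner R \<union> star (S - R)) \<le> card (star S)" using fe card_mono by blast
      moreover have "card S = card R + card (S - R)"
        using R finS by (metis card_Diff_subset card_mono finite_subset le_add_diff_inverse)
      ultimately show ?thesis using R by linarith
    qed simp
  qed
qed

text \<open>Every edge has total weight at most 3 when an end in \<open>V2\<close> counts 2, any other end counts 1, and
  edges meeting \<open>V3\<close> but not \<open>V2\<close> count 1 more.\<close>

lemma density:
  assumes "card V3 \<le> card (star V3)"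
  shows "4 * card V \<le> 3 * card E"
proof -
  define V4 where "V4 = V - V2 - V3"
  have sub: "V2 \<subseteq> V" "V3 \<subseteq> V" "V4 \<subseteq> V" by (auto simp: V2_def V3_def V4_def)
  have fin: "finite V2" "finite V3" "finite V4" using sub finV finite_subset by blast+
  have dj: "V2 \<inter> V3 = {}" "V2 \<inter> V4 = {}" "V3 \<inter> V4 = {}" by (auto simp: V2_def V3_def V4_def)
  have V: "V = V2 \<union> V3 \<union> V4" using sub by (auto simp: V4_def)
  have cV: "card V = card V2 + card V3 + card V4"
    using fin dj by (simp add: V card_Un_disjoint Int_Un_distrib2)
  have s2: "(\<Sum>e\<in>E. card (e \<inter> V2)) = 2 * card V2"
    using sum_card_nbrs[OF sub(1)] by (simp add: V2_def)
  have s3: "(\<Sum>e\<in>E. card (e \<inter> V3)) = 3 * card V3"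
    using sum_card_nbrs[OF sub(2)] by (simp add: V3_def)
  have "(\<Sum>v\<in>V4. 4) \<le> (\<Sum>v\<in>V4. card (nbrs v))"
  proof (rule sum_mono)
    fix v assume "v \<in> V4"
    then have "v \<in> V" "card (nbrs v) \<noteq> 2" "card (nbrs v) \<noteq> 3" by (auto simp: V4_def V2_def V3_def)
    then show "4 \<le> card (nbrs v)" using card_nbrs_ge2[of v] by linarith
  qed
  then have s4: "4 * card V4 \<le> (\<Sum>e\<in>E. card (e \<inter> V4))" using sum_card_nbrs[OF sub(3)] by simp
  have s5: "card (star V3) = (\<Sum>e\<in>E. of_bool (e \<inter> V3 \<noteq> {} \<and> e \<inter> V2 = {}))"
    using finE by (simp add: star_def Int_def)
  have "(\<Sum>e\<in>E. 2 * card (e \<inter> V2) + card (e \<inter> V3) + card (e \<inter> V4) +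
       of_bool (e \<inter> V3 \<noteq> {} \<and> e \<inter> V2 = {})) \<le> (\<Sum>e\<in>E. 3)"
  proof (rule sum_mono)
    fix e assume e: "e \<in> E"
    then obtain a b where ab: "e = {a, b}" "a \<noteq> b" using card_edge[OF e] by (auto simp: card_2_iff)
    have "b \<in> nbrs a" using e ab by (simp add: nbrs_def)
    then have n2: "\<not> (a \<in> V2 \<and> b \<in> V2)" and V': "a \<in> V" "b \<in> V"
        using V2_not_adjacent nbrs_V by blast+
    have c: "card (e \<inter> P) = of_bool (a \<in> P) + of_bool (b \<in> P)" for P
      using ab by (cases "a \<in> P"; cases "b \<in> P") (auto simp: Int_insert_left)
    have t: "x \<in> V2 \<and> x \<notin> V3 \<and> x \<notin> V4 \<or> x \<notin> V2 \<and> x \<in> V3 \<and> x \<notin> V4 \<or> x \<notin> V2 \<and> x \<notin> V3 \<and> x \<in> V4"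
      if "x \<in> V" for x using that V dj by blast
    show "2 * card (e \<inter> V2) + card (e \<inter> V3) + card (e \<inter> V4) +
       of_bool (e \<inter> V3 \<noteq> {} \<and> e \<inter> V2 = {}) \<le> 3"
      unfolding c using t[OF V'(1)] t[OF V'(2)] n2 ab by auto
  qed
  \<comment> \<open>Each vertex of V2 contributes 2 twice, each vertex of V3 contributes 3, topped
    up to 4 by the edges in \<open>star V3\<close>, and each vertex of V4 contributes at least
    4.\<close>
  then have "2 * (2 * card V2) + 3 * card V3 + (\<Sum>e\<in>E. card (e \<inter> V4)) + card (star V3) \<le> 3 * card E"
    by (simp add: sum.distrib s2 s3 s5 sum_distrib_left[symmetric])
  then show ?thesis using s4 assms cV by linarith
qed

end

section \<open>A tree of vertices of degree 3\<close>

text \<open>\<open>sw\<close> switches the edges inside \<open>S\<close> to positive ones, and \<open>K\<close> consists of the 2-vertices at \<open>S\<close>.\<close>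

locale tree_part = crit G par for G :: "'a signed_graph" and par +
  fixes S :: "'a set" and sw :: "'a \<Rightarrow> bool" and \<phi> :: "'a \<Rightarrow> col" and K :: "'a set"
  assumes S3: "S \<subseteq> V3" and Sne: "S \<noteq> {}" and cl: "nbr_closed S"
    and minimal: "\<And>T. T \<subseteq> S \<Longrightarrow> T \<noteq> {} \<Longrightarrow> nbr_closed T \<Longrightarrow> T = S"
    and peel: "\<And>R. R \<subseteq> S \<Longrightarrow> R \<noteq> {} \<Longrightarrow> \<exists>v\<in>R. card (nbrs v \<inter> R) \<le> 1"
    and sw: "\<And>u v. u \<in> S \<Longrightarrow> v \<in> S \<Longrightarrow> v \<in> nbrs u \<Longrightarrow> sg u v \<longleftrightarrow> (sw u \<noteq> sw v)"
    and K: "K = {k \<in> V2. nbrs k \<inter> S \<noteq> {}}"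
    and \<phi>: "colors \<phi> (V - (S \<union> K))"
begin

lemma S_V2: "S \<inter> V2 = {}" using S3 by (auto simp: V2_def V3_def)

definition other_end :: "'a \<Rightarrow> 'a \<Rightarrow> 'a" where
  "other_end k v = (SOME z. nbrs k = {z, v} \<and> z \<noteq> v)"

lemma other_end: "k \<in> V2 \<Longrightarrow> v \<in> nbrs k \<Longrightarrow> nbrs k = {other_end k v, v} \<and> other_end k v \<noteq> v"
proof -
  assume "k \<in> V2" "v \<in> nbrs k"
  then have "\<exists>z. nbrs k = {z, v} \<and>
      z \<noteq> v" using card_2_other[of "nbrs k" v] unfolding V2_def by blast
  then show ?thesis unfolding other_end_def by (rule someI_ex)
qed

lemma other_end_other_end: "k \<in> V2 \<Longrightarrow> v \<in> nbrs k \<Longrightarrow>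
    other_end k v \<in> nbrs k \<and> other_end k (other_end k v) = v"
proof -
  assume k: "k \<in> V2" "v \<in> nbrs k"
  have a: "nbrs k = {other_end k v, v}" "other_end k v \<noteq> v" using other_end[OF k] by blast+
  then have w: "other_end k v \<in> nbrs k" by blast
  have "nbrs k = {other_end k (other_end k v), other_end k v}"
      "other_end k (other_end k v) \<noteq> other_end k v" using other_end[OF k(1) w] by blast+
  then have "other_end k (other_end k v) = v" using a by (metis doubleton_eq_iff)
  then show ?thesis using w by blast
qed

text \<open>By \<open>common_near\<close>, k forbids opposite colours of its two neighbours if its
  edges have equal signs, and equal colours if the signs differ.\<close>

definition twist :: "'a \<Rightarrow> 'a \<Rightarrow> bool" where
  "twist k v \<longleftrightarrow> (sg k v = sg k (other_end k v))"

text \<open>Colours in S are meant after switching by \<open>sw\<close>, whereas \<phi> is not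
  switched; so only ends in S contribute \<open>sw\<close>.\<close>

definition stub :: "'a \<Rightarrow> 'a \<Rightarrow> 'a item" where
  "stub k v = (if other_end k v \<in> S then Tie (other_end k v) (twist k v \<noteq> (sw v \<noteq> sw (other_end
      k v)))
     else Ban (opp_if (sw v \<noteq> twist k v) (\<phi> (other_end k v))))"

lemma lab_stub [simp]: "lab (stub k v) = {}" "dist_lab (stub k v)" by (simp_all add: stub_def)

definition stub_cons :: "'a \<Rightarrow> 'a con set" where
  "stub_cons v = (\<Union>k\<in>nbrs v \<inter> V2. cons v (stub k v))"

definition edge_cons :: "'a set \<Rightarrow> 'a con set" where
  "edge_cons U = {k. \<exists>x y. k = Near x y \<and> x \<in> S \<and> y \<in> S \<and> y \<in> nbrs x \<and> (x \<in> U \<or> y \<in> U)}"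

definition cons_on :: "'a set \<Rightarrow> 'a con set" where
  "cons_on U = edge_cons U \<union> (\<Union>x\<in>U. stub_cons x)"

lemma cons_on_Un: "cons_on (A \<union> B) = cons_on A \<union> cons_on B"
  unfolding cons_on_def edge_cons_def by blast

lemma cons_on_UN: "cons_on (\<Union>n\<in>N. A n) = (\<Union>n\<in>N. cons_on (A n))"
  unfolding cons_on_def edge_cons_def by blast

lemma cons_on_empty [simp]: "cons_on {} = {}" by (auto simp: cons_on_def edge_cons_def)

text \<open>The vertices outside \<open>R\<close> have been peeled off and form trees hanging from vertices of \<open>R\<close>.\<close>

definition planted :: "'a set \<Rightarrow> ('a \<Rightarrow> 'a item) \<Rightarrow> bool" where
  "planted R tt \<longleftrightarrow> (\<forall>u\<in>S - R. \<forall>p\<in>R. p \<in> nbrs u \<longrightarrow> u \<in> lab (tt u) \<and> lab (tt u) \<subseteq> S - R \<and>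
       dist_lab (tt u) \<and> cons p (tt u) = cons_on (lab (tt u))) \<and>
     (\<forall>u\<in>S - R. \<forall>u'\<in>S - R. nbrs u \<inter> R \<noteq> {} \<longrightarrow> nbrs u' \<inter> R \<noteq> {} \<longrightarrow> u \<noteq> u' \<longrightarrow>
         lab (tt u) \<inter> lab (tt u') = {})"

lemma Near_cons: "Near x y \<in> cons q t \<Longrightarrow> x \<in> insert q (lab t) \<and> y \<in> insert q (lab t)"
  using vars_nonlink[of "Near x y" q t] by auto

text \<open>The edge from u to a second neighbour p' in R would occur in the constraints of the
  hanging tree, which mention only p and the labels of that tree.\<close>

lemma planted_unique:
  assumes "planted R tt" "R \<subseteq> S" "u \<in> S - R" "p \<in> R" "p \<in> nbrs u" "p' \<in> R" "p' \<in> nbrs u"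
  shows "p' = p"
proof -
  have t: "u \<in> lab (tt u)" "lab (tt u) \<subseteq> S - R" "cons p (tt u) = cons_on (lab (tt u))"
    using assms unfolding planted_def by blast+
  have "Near u p' \<in> cons_on (lab (tt u))" using assms t by (auto simp: cons_on_def edge_cons_def)
  then have "p' \<in> insert p (lab (tt u))" using t(3) Near_cons by metis
  then show ?thesis using t(2) assms by blast
qed

definition item :: "('a \<Rightarrow> 'a item) \<Rightarrow> 'a \<Rightarrow> 'a \<Rightarrow> 'a item" where
  "item tt v n = (if n \<in> V2 then stub n v else tt n)"

lemma item_facts:
  assumes I: "planted R tt" and R: "R \<subseteq> S" and v: "v \<in> R" and n: "n \<in> nbrs v - R"
  shows "lab (item tt v n) \<subseteq> S - R" "dist_lab (item tt v n)"
    "n \<in> V2 \<or> n \<in> S - R \<and> n \<in> lab (tt n) \<and> cons v (tt n) = cons_on (lab (tt n))"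
    "n' \<in> nbrs v - R \<Longrightarrow> n' \<noteq> n \<Longrightarrow> lab (item tt v n) \<inter> lab (item tt v n') = {}"
proof -
  have sub: "m \<in> V2 \<or> m \<in> S - R \<and> v \<in> nbrs m" if "m \<in> nbrs v - R" for m
    using that cl v R nbrs_sym unfolding nbr_closed_def by blast
  have t: "m \<in> V2 \<or> m \<in> lab (tt m) \<and> lab (tt m) \<subseteq> S - R \<and> dist_lab (tt m) \<and>
      cons v (tt m) = cons_on (lab (tt m))"
    if "m \<in> nbrs v - R" for m
    using sub[OF that] I v unfolding planted_def by blast
  show "lab (item tt v n) \<subseteq> S - R" "dist_lab (item tt v n)" using t[OF n] by (auto simp: item_def)
  show "n \<in> V2 \<or> n \<in> S - R \<and> n \<in> lab (tt n) \<and> cons v (tt n) = cons_on (lab (tt n))"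
    using t[OF n] sub[OF n] by blast
  assume n': "n' \<in> nbrs v - R" "n' \<noteq> n"
  show "lab (item tt v n) \<inter> lab (item tt v n') = {}"
  proof (cases "n \<in> V2 \<or> n' \<in> V2")
    case True then show ?thesis by (auto simp: item_def)
  next
    case False
    then have "n \<in> S - R" "v \<in> nbrs n" "n' \<in> S - R" "v \<in> nbrs n'"
        using sub[OF n] sub[OF n'(1)] by auto
    then have "lab (tt n) \<inter> lab (tt n') = {}" using I v n'(2) unfolding planted_def by blast
    then show ?thesis using False by (simp add: item_def)
  qed
qed

text \<open>Peeling needs this in two situations: a vertex with one neighbour left in R, where the
  extra constraints are the edge to its parent, and the last vertex, where there are none.\<close>

lemma cons_on_item:
  assumes I: "planted R tt" and R: "R \<subseteq> S" and v: "v \<in> R"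
  shows "cons_on (insert v (\<Union>n\<in>nbrs v - R. lab (item tt v n))) =
     (\<Union>n\<in>nbrs v - R. cons v (item tt v n)) \<union> (\<Union>p\<in>nbrs v \<inter> R. {Near p v, Near v p})"
    (is "cons_on (insert v ?L) = ?A \<union> ?B")
proof -
  note f = item_facts[OF I R v]
  have vS: "v \<in> S" using v R by blast
  have "cons_on (insert v ?L) = cons_on {v} \<union> (\<Union>n\<in>nbrs v - R. cons_on (lab (item tt v n)))"
    using cons_on_Un[of "{v}" ?L] unfolding cons_on_UN by simp
  also have "\<dots> = ?A \<union> ?B"
  proof
    have cv: "stub_cons v \<subseteq> ?A"
    proof
      fix k assume "k \<in> stub_cons v"
      then obtain n where n: "n \<in> nbrs v" "n \<in> V2" "k \<in> cons v (stub n v)"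
          by (auto simp: stub_cons_def)
      then have "n \<in> nbrs v - R" using R S_V2 by blast
      then show "k \<in> ?A" using n by (auto simp: item_def)
    qed
    have itemcs: "cons_on (lab (item tt v n)) \<subseteq> cons v (item tt v n)" if "n \<in> nbrs v - R" for n
      using f(3)[OF that] by (auto simp: item_def)
    have "edge_cons {v} \<subseteq> ?A \<union> ?B"
    proof
      fix k assume "k \<in> edge_cons {v}"
      then obtain y where y: "y \<in> S" "y \<in> nbrs v" "k = Near v y \<or> k = Near y v"
        unfolding edge_cons_def using nbrs_sym by blast
      show "k \<in> ?A \<union> ?B"
      proof (cases "y \<in> R")
        case True then show ?thesis using y by blast
      next
        case False
        then have n: "y \<in> nbrs v - R" using y by blast
        have nv: "y \<notin> V2" using y S_V2 by blast
        then have "y \<in> lab (tt y)" "cons v (tt y) = cons_on (lab (tt y))" using f(3)[OF n] by blast+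
        moreover have "k \<in> cons_on (lab (tt y))"
          using y vS \<open>y \<in> lab (tt y)\<close> nbrs_sym unfolding cons_on_def edge_cons_def by blast
        ultimately have "k \<in> cons v (item tt v y)" using nv by (simp add: item_def)
        then show ?thesis using n by blast
      qed
    qed
    then show "cons_on {v} \<union> (\<Union>n\<in>nbrs v - R. cons_on (lab (item tt v n))) \<subseteq> ?A \<union> ?B"
    proof (intro Un_least UN_least)
      have "cons_on {v} = edge_cons {v} \<union> stub_cons v" by (simp add: cons_on_def)
      then show "cons_on {v} \<subseteq> ?A \<union> ?B" using le_supI1[OF cv] \<open>edge_cons {v} \<subseteq> ?A \<union> ?B\<close> by simp
      fix n assume "n \<in> nbrs v - R"
      then show "cons_on (lab (item tt v n)) \<subseteq> ?A \<union> ?B" using itemcs by blast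
    qed
  next
    have "cons v (item tt v n) \<subseteq> cons_on {v} \<union>
        cons_on (lab (item tt v n))" if n: "n \<in> nbrs v - R" for n
    proof (cases "n \<in> V2")
      case True
      then have "cons v (item tt v n) \<subseteq> stub_cons v" using n by (auto simp: item_def stub_cons_def)
      then show ?thesis by (auto simp: cons_on_def)
    next
      case False then show ?thesis using f(3)[OF n] by (auto simp: item_def)
    qed
    then have "?A \<subseteq> cons_on {v} \<union> (\<Union>n\<in>nbrs v - R. cons_on (lab (item tt v n)))"
      by (intro UN_least) blast
    moreover have "?B \<subseteq> cons_on {v}"
    proof (intro UN_least)
      fix p assume "p \<in> nbrs v \<inter> R"
      then have "p \<in> S" "p \<in> nbrs v" "v \<in> nbrs p" using R nbrs_sym by blast+
      then show "{Near p v, Near v p} \<subseteq> cons_on {v}"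
          using vS by (simp add: cons_on_def edge_cons_def)
    qed
    ultimately show "?A \<union> ?B \<subseteq> cons_on {v} \<union> (\<Union>n\<in>nbrs v - R. cons_on (lab (item tt v n)))"
      by (intro Un_least) auto
  qed
  finally show ?thesis .
qed

lemma planted_complete:
  assumes I: "planted R tt" and R: "R \<subseteq> S" and v: "v \<in> R" and e: "nbrs v \<inter> R = {}"
  shows "\<exists>U. U \<subseteq> S \<and> is_tree (cons_on U) U"
proof -
  note f = item_facts[OF I R v]
  have "card (nbrs v) = 3" using v R S3 by (auto simp: V3_def)
  then obtain n1 n2 n3 where n: "nbrs v = {n1, n2, n3}" "n1 \<noteq> n2" "n1 \<noteq> n3" "n2 \<noteq> n3"
    by (auto simp: card_3_iff)
  have nR: "nbrs v - R = {n1, n2, n3}" using e n by blast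
  then have m: "n1 \<in> nbrs v - R" "n2 \<in> nbrs v - R" "n3 \<in> nbrs v - R" by auto
  let ?i = "item tt v"
  define U where "U = insert v (lab (?i n1) \<union> lab (?i n2) \<union> lab (?i n3))"
  have "cons_on U = cons v (?i n1) \<union> cons v (?i n2) \<union> cons v (?i n3)"
    using cons_on_item[OF I R v] unfolding nR e U_def by (simp add: Un_assoc)
  moreover have "lab (?i n1) \<inter> lab (?i n2) = {}" "lab (?i n1) \<inter> lab (?i n3) = {}"
      "lab (?i n2) \<inter> lab (?i n3) = {}"
    using f(4)[OF m(1) m(2)] f(4)[OF m(1) m(3)] f(4)[OF m(2) m(3)] n by auto
  moreover have "v \<notin> lab (?i n1) \<union> lab (?i n2) \<union> lab (?i n3)"
    using f(1)[OF m(1)] f(1)[OF m(2)] f(1)[OF m(3)] v by blast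
  ultimately have "rooted v (?i n1) (?i n2) (?i n3) (cons_on U) U"
    unfolding rooted_def U_def using f(2)[OF m(1)] f(2)[OF m(2)] f(2)[OF m(3)] by blast
  moreover have "U \<subseteq> S" unfolding U_def using f(1)[OF m(1)] f(1)[OF m(2)] f(1)[OF m(3)] v R by blast
  ultimately show ?thesis unfolding is_tree_def by blast
qed

lemma planted_step:
  assumes I: "planted R tt" and R: "R \<subseteq> S" and v: "v \<in> R" and e: "nbrs v \<inter> R = {p}"
  shows "\<exists>t. planted (R - {v}) (tt(v := t))"
proof -
  note f = item_facts[OF I R v]
  have c3: "card (nbrs v) = 3" using v R S3 by (auto simp: V3_def)
  have p: "p \<in> nbrs v" "p \<in> R" using e by auto
  have "nbrs v - R = nbrs v - {p}" using e by blast
  then have "card (nbrs v - R) = 2" using c3 p fin_nbrs by (simp add: card_Diff_singleton)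
  then obtain n1 n2 where n: "nbrs v - R = {n1, n2}" "n1 \<noteq> n2" by (auto simp: card_2_iff)
  then have m: "n1 \<in> nbrs v - R" "n2 \<in> nbrs v - R" by auto
  have pv: "p \<noteq> v" using p nbrs_V by blast
  let ?i = "item tt v"
  define t where "t = Node v (?i n1) (?i n2)"
  have labt: "lab t = insert v (\<Union>n\<in>nbrs v - R. lab (?i n))" unfolding t_def n by simp
  have "cons_on (lab t) = cons v (?i n1) \<union> cons v (?i n2) \<union> {Near p v, Near v p}"
    unfolding labt cons_on_item[OF I R v] e unfolding n by simp
  then have ct: "cons p t = cons_on (lab t)" unfolding t_def by auto
  have lt: "lab t \<subseteq> S - (R - {v})" unfolding t_def using f(1)[OF m(1)] f(1)[OF m(2)] v R by auto
  have dt: "dist_lab t" unfolding t_def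
      using f(1)[OF m(1)] f(1)[OF m(2)] f(2)[OF m(1)] f(2)[OF m(2)]
      f(4)[OF m(1) m(2)] n v by auto
  have vt: "v \<in> lab t" by (simp add: t_def)
  have un: "p' = p" if "p' \<in> nbrs v" "p' \<in> R" for p' using e that by blast
  have dis: "lab t \<inter> lab (tt u) = {}" if u: "u \<in> S - R" "nbrs u \<inter> (R - {v}) \<noteq> {}" for u
  proof -
    obtain p' where p': "p' \<in> nbrs u" "p' \<in> R" "p' \<noteq> v" using u by blast
    have nv: "v \<notin> nbrs u" using planted_unique[OF I R u(1) p'(2,1) v] p'(3) by blast
    then have "u \<notin> nbrs v" using nbrs_sym by blast
    have "lab (tt u) \<subseteq> S - R" using I u p' unfolding planted_def by blast
    then have "v \<notin> lab (tt u)" using v by blast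
    moreover have "lab (?i m) \<inter> lab (tt u) = {}" if mm: "m \<in> nbrs v - R" for m
    proof (cases "m \<in> V2")
      case True then show ?thesis by (simp add: item_def)
    next
      case False
      then have "m \<in> S - R" using f(3)[OF mm] by blast
      moreover have "v \<in> nbrs m" using mm nbrs_sym by blast
      moreover have "m \<noteq> u" using mm \<open>u \<notin> nbrs v\<close> by blast
      ultimately have "lab (tt m) \<inter> lab (tt u) = {}" using I u p' v unfolding planted_def by blast
      then show ?thesis using False by (simp add: item_def)
    qed
    ultimately show ?thesis unfolding labt by blast
  qed
  have "planted (R - {v}) (tt(v := t))"
    unfolding planted_def
  proof (intro conjI ballI impI)
    fix u p' assume u: "u \<in> S - (R - {v})" "p' \<in> R - {v}" "p' \<in> nbrs u"
    have "u \<in> lab ((tt(v := t)) u) \<and> lab ((tt(v := t)) u) \<subseteq> S - (R - {v}) \<and>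
        dist_lab ((tt(v := t)) u) \<and>
       cons p' ((tt(v := t)) u) = cons_on (lab ((tt(v := t)) u))"
    proof (cases "u = v")
      case True
      then have "p' = p" using un u by blast
      then show ?thesis using True vt lt dt ct by simp
    next
      case False
      then have "u \<in> S - R" using u by blast
      then have "u \<in> lab (tt u) \<and> lab (tt u) \<subseteq> S - R \<and> dist_lab (tt u) \<and>
          cons p' (tt u) = cons_on (lab (tt u))"
        using I u unfolding planted_def by blast
      then show ?thesis using False by auto
    qed
    then show "u \<in> lab ((tt(v := t)) u)" "lab ((tt(v := t)) u) \<subseteq> S - (R - {v})"
        "dist_lab ((tt(v := t)) u)"
       "cons p' ((tt(v := t)) u) = cons_on (lab ((tt(v := t)) u))" by blast+
  next
    fix u u' assume u: "u \<in> S - (R - {v})" "u' \<in> S - (R - {v})" "nbrs u \<inter> (R - {v}) \<noteq> {}"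
      "nbrs u' \<inter> (R - {v}) \<noteq> {}" "u \<noteq> u'"
    consider "u = v" "u' \<in> S - R" "u' \<noteq> v" | "u' = v" "u \<in> S - R" "u \<noteq> v" | "u \<in> S - R"
        "u' \<in> S - R" "u \<noteq> v" "u' \<noteq> v"
      using u v by blast
    then show "lab ((tt(v := t)) u) \<inter> lab ((tt(v := t)) u') = {}"
    proof cases
      case 1 then show ?thesis using dis[of u'] u by simp
    next
      case 2 then show ?thesis using dis[of u] u by (simp add: Int_commute)
    next
      case 3
      then have "lab (tt u) \<inter> lab (tt u') = {}" using I u unfolding planted_def by blast
      then show ?thesis using 3 by simp
    qed
  qed
  then show ?thesis by blast
qed

lemma finS: "finite S" using S3 finV finite_subset unfolding V3_def by fastforce

text \<open>By \<open>peel\<close> some vertex has at most one neighbour left in R. If it has one,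
  its tree is hung there; if it has none, a whole component has been assembled.\<close>

lemma planted_tree:
  "planted R tt \<Longrightarrow> R \<subseteq> S \<Longrightarrow> R \<noteq> {} \<Longrightarrow> \<exists>U. U \<subseteq> S \<and> is_tree (cons_on U) U"
proof (induction "card R" arbitrary: R tt rule: less_induct)
  case less
  obtain v where v: "v \<in> R" "card (nbrs v \<inter> R) \<le> 1" using peel[OF less.prems(2,3)] by blast
  show ?case
  proof (cases "nbrs v \<inter> R = {}")
    case True then show ?thesis using planted_complete[OF less.prems(1,2) v(1)] by blast
  next
    case False
    then have "card (nbrs v \<inter> R) \<noteq> 0" using fin_nbrs by simp
    then have "card (nbrs v \<inter> R) = 1" using v(2) by linarith
    then obtain p where p: "nbrs v \<inter> R = {p}" by (rule card_1_singletonE)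
    obtain t where I: "planted (R - {v}) (tt(v := t))"
        using planted_step[OF less.prems(1,2) v(1) p] by blast
    have "p \<noteq> v" using p nbrs_V by blast
    then have "R - {v} \<noteq> {}" using p by blast
    moreover have "card (R - {v}) < card R"
      using v(1) finS less.prems(2) finite_subset by (intro psubset_card_mono) auto
    ultimately show ?thesis using less.hyps[OF _ I] less.prems(2) by blast
  qed
qed

text \<open>The tree found contains all neighbours of its vertices that lie in S, since its
  constraints include these edges; so minimality makes it all of S.\<close>

lemma tree_S: "is_tree (cons_on S) S"
proof -
  have "planted S (\<lambda>_. undefined)" by (simp add: planted_def)
  then obtain U where U: "U \<subseteq> S" "is_tree (cons_on U) U" using planted_tree Sne by blast
  then obtain v a b c where c: "rooted v a b c (cons_on U) U" unfolding is_tree_def by blast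
  have "U \<noteq> {}" using c by (auto simp: rooted_def)
  moreover have "nbr_closed U" unfolding nbr_closed_def
  proof (intro ballI subsetI)
    fix x y assume x: "x \<in> U" "y \<in> nbrs x"
    have "y \<in> S \<union> V2" using cl x U unfolding nbr_closed_def by blast
    moreover have "y \<in> U" if "y \<in> S"
    proof -
      have "Near x y \<in> cons_on U" using x U that unfolding cons_on_def edge_cons_def by blast
      then have "Near x y \<in> cons v a \<or> Near x y \<in> cons v b \<or>
          Near x y \<in> cons v c" using c by (auto simp: rooted_def)
      then have "y \<in> insert v (lab a \<union> lab b \<union> lab c)"
        using Near_cons[of x y v a] Near_cons[of x y v b] Near_cons[of x y v c] by blast
      then show ?thesis using c by (simp add: rooted_def)
    qed
    ultimately show "y \<in> U \<union> V2" by blast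
  qed
  ultimately have "U = S" using minimal U by blast
  then show ?thesis using U by blast
qed

section \<open>From tree constraints back to the graph\<close>

lemma Link_Con: "Link x z s \<in> cons_on S \<longleftrightarrow>
   (x \<in> S \<and> (\<exists>k\<in>nbrs x \<inter> V2. z = other_end k x \<and> z \<in> S \<and> s = (twist k x \<noteq> (sw x \<noteq> sw z))))"
proof -
  have "Link x z s \<in> cons v (stub k v) \<longleftrightarrow>
      x = v \<and> z = other_end k v \<and> z \<in> S \<and> s = (twist k x \<noteq> (sw x \<noteq> sw z))" for v k
    by (auto simp: stub_def)
  then show ?thesis unfolding cons_on_def edge_cons_def stub_cons_def by auto
qed

lemma Exc_Con: "Exc x g \<in> cons_on S \<longleftrightarrow>
   (x \<in> S \<and> (\<exists>k\<in>nbrs x \<inter> V2. other_end k x \<notin> S \<and>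
       g = opp_if (sw x \<noteq> twist k x) (\<phi> (other_end k x))))"
proof -
  have "Exc x g \<in> cons v (stub k v) \<longleftrightarrow>
      x = v \<and> other_end k v \<notin> S \<and> g = opp_if (sw x \<noteq> twist k x) (\<phi> (other_end k x))" for v k
    by (auto simp: stub_def)
  then show ?thesis unfolding cons_on_def edge_cons_def stub_cons_def by auto
qed

lemma Near_Con: "Near x y \<in> cons_on S \<longleftrightarrow> x \<in> S \<and> y \<in> S \<and> y \<in> nbrs x"
proof -
  have "Near x y \<notin> cons v (stub k v)" for v k by (auto simp: stub_def)
  then show ?thesis unfolding cons_on_def edge_cons_def stub_cons_def by auto
qed

lemma par_other_end: "k \<in> V2 \<Longrightarrow> v \<in> nbrs k \<Longrightarrow> par (other_end k v) = par v"
  using other_end_other_end[of k v] nbrs_par[of v k] nbrs_par[of "other_end k v" k] by auto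

lemma wf_cons_S: "wf_cons par (cons_on S) S"
  unfolding wf_cons_def
proof (intro conjI tree_S ballI allI impI)
  fix k assume k: "k \<in> cons_on S"
  show "par_con par k"
  proof (cases k)
    case (Near x y) then show ?thesis using k Near_Con nbrs_par by auto
  next
    case (Link x z s)
    then show ?thesis using k Link_Con par_other_end nbrs_sym
        by (metis IntD1 IntD2 par_con.simps(2))
  next
    case (Exc x g)
    then obtain k' where "k' \<in> nbrs x" "k' \<in> V2"
        "g = opp_if (sw x \<noteq> twist k' x) (\<phi> (other_end k' x))"
      using k Exc_Con by blast
    moreover from this have "par (other_end k' x) = par x" using par_other_end nbrs_sym by blast
    ultimately show ?thesis using Exc \<phi> by (simp add: colors_def par_ok_def)
  qed
next
  fix x w s assume "Link x w s \<in> cons_on S"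
  then obtain k where k: "x \<in> S" "k \<in> nbrs x" "k \<in> V2" "w = other_end k x" "w \<in> S"
    "s = (twist k x \<noteq> (sw x \<noteq> sw w))" unfolding Link_Con by blast
  have xk: "x \<in> nbrs k" using k nbrs_sym by blast
  have o: "w \<in> nbrs k" "other_end k w = x" using other_end_other_end[OF k(3) xk] k(4) by auto
  then have kw: "k \<in> nbrs w" using nbrs_sym by blast
  have "twist k w = twist k x" unfolding twist_def o(2) k(4)[symmetric] by (rule eq_commute)
  then have eq: "s = (twist k w \<noteq> (sw w \<noteq> sw x))" using k(6) by blast
  show "Link w x s \<in> cons_on S" unfolding Link_Con
  proof (intro conjI bexI[of _ k])
    show "x = other_end k w" using o(2) by (rule sym)
    show "k \<in> nbrs w \<inter> V2" using kw k(3) by blast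
  qed (rule k(5) k(1) eq)+
  show "x \<noteq> w" using other_end[OF k(3) xk] k(4) by auto
qed

lemma K_independent: "k \<in> K \<Longrightarrow> nbrs k \<inter> K = {}"
  using V2_not_adjacent K by blast

text \<open>A solution, with the switching undone, and \<phi> leave only K to be coloured. K is
  independent, and the stub of each of its vertices is just what \<open>common_near\<close>
  requires.\<close>

lemma not_solvable: "\<not> solvable par (cons_on S)"
proof
  assume "solvable par (cons_on S)"
  then obtain f where f: "par_ok par f" "\<And>k. k \<in> cons_on S \<Longrightarrow>
      sat f k" unfolding solvable_def by blast
  define g where "g x = (if x \<in> S then opp_if (sw x) (f x) else \<phi> x)" for x
  have pg: "even_col (g x) = par x" for x using f(1) \<phi> by (simp add: g_def colors_def par_ok_def)
  have "\<exists>d. \<forall>u\<in>nbrs k. near d (opp_if (sg k u) (g u))" if k: "k \<in> K" for k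
  proof -
    obtain v where v: "v \<in> S" "v \<in> nbrs k" and k2: "k \<in> V2" using k K by blast
    let ?z = "other_end k v"
    have nbk: "nbrs k = {?z, v}" and kv: "k \<in> nbrs v"
        using other_end[OF k2 v(2)] v(2) nbrs_sym by blast+
    have ne: "g v \<noteq> opp_if (twist k v) (g ?z)"
    proof (cases "?z \<in> S")
      case True
      then have "Link v ?z (twist k v \<noteq> (sw v \<noteq> sw ?z)) \<in> cons_on S"
          unfolding Link_Con using v kv k2 by blast
      then have "f v \<noteq> opp_if (twist k v \<noteq> (sw v \<noteq> sw ?z)) (f ?z)" using f(2) by fastforce
      then show ?thesis using True v opp_if_eq_iff[of "sw v" "f v"
          "opp_if (twist k v) (opp_if (sw ?z) (f ?z))"]
        by (cases "sw v"; cases "sw ?z"; cases "twist k v") (simp_all add: g_def)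
    next
      case False
      then have "Exc v (opp_if (sw v \<noteq> twist k v) (\<phi> ?z)) \<in> cons_on S"
          unfolding Exc_Con using v kv k2 by blast
      then have "f v \<noteq> opp_if (sw v \<noteq> twist k v) (\<phi> ?z)" using f(2) by fastforce
      then show ?thesis using False v opp_if_eq_iff[of "sw v" "f v" "opp_if (twist k v) (\<phi> ?z)"]
          by (simp add: g_def)
    qed
    have "even_col (opp_if (sg k ?z) (g ?z)) = even_col (opp_if (sg k v) (g v))"
        using pg par_other_end[OF k2 v(2)] by simp
    moreover have "opp_if (sg k v) (g v) \<noteq> opp (opp_if (sg k ?z) (g ?z))"
    proof
      assume a: "opp_if (sg k v) (g v) = opp (opp_if (sg k ?z) (g ?z))"
      have "opp c = opp_if True c" for c by (simp add: opp_if_def)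
      then have "g v = opp_if (sg k v) (opp_if True (opp_if (sg k ?z) (g ?z)))"
          using a opp_if_eq_iff by metis
      also have "\<dots> = opp_if (twist k v) (g ?z)"
          unfolding twist_def opp_if_opp_if by (cases "sg k v"; cases "sg k ?z") simp_all
      finally show False using ne by blast
    qed
    ultimately obtain d where "near d (opp_if (sg k ?z) (g ?z))" "near d (opp_if (sg k v) (g v))"
      using common_near by blast
    then show ?thesis unfolding nbk by blast
  qed
  then obtain h where h: "\<And>k u. k \<in> K \<Longrightarrow> u \<in> nbrs k \<Longrightarrow> near (h k) (opp_if (sg k u) (g u))" by metis
  define \<psi> where "\<psi> x = (if x \<in> K then h x else g x)" for x
  have "colors \<psi> V" unfolding colors_def
  proof (intro conjI ballI impI)
    show "par_ok par \<psi>" unfolding par_ok_def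
    proof
      fix x show "even_col (\<psi> x) = par x"
      proof (cases "x \<in> K")
        case True
        then obtain u where u: "u \<in> nbrs x" using K by blast
        have "even_col (opp_if (sg x u) (g u)) = (\<not> even_col (h x))"
            using near_even_col[OF h[OF True u]] .
        then show ?thesis using True nbrs_par[OF u] pg by (simp add: \<psi>_def)
      qed (simp add: \<psi>_def pg)
    qed
    fix u v assume uv: "u \<in> V" "v \<in> V" "v \<in> nbrs u"
    have vu: "u \<in> nbrs v" using uv nbrs_sym by blast
    show "near (\<psi> u) (opp_if (sg u v) (\<psi> v))"
    proof (cases "u \<in> K")
      case True
      then have "v \<notin> K" using uv K_independent by blast
      then show ?thesis using h[OF True uv(3)] True by (simp add: \<psi>_def)
    next
      case u: False
      show ?thesis
      proof (cases "v \<in> K")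
        case True
        have "near (h v) (opp_if (sg u v) (g u))" using h[OF True vu] sg_sym[of u v] by simp
        then show ?thesis using True u near_opp_if_swap near_sym by (metis \<psi>_def)
      next
        case False
        have SS: "b \<in> S" if "a \<in> S" "b \<in> nbrs a" "b \<notin> K" for a b
          using that cl K nbrs_sym unfolding nbr_closed_def by blast
        consider "u \<in> S" "v \<in> S" | "u \<notin> S" "v \<notin> S" using SS uv vu u False by blast
        then show ?thesis
        proof cases
          case 1
          then have "near (f u) (f v)" using f(2) Near_Con uv by fastforce
          then show ?thesis using 1 u False sw[OF 1 uv(3)]
            by (cases "sw u"; cases "sw v") (simp_all add: \<psi>_def g_def near_opp_if_swap)
        next
          case 2
          then show ?thesis using \<phi> uv u False unfolding colors_def by (simp add: \<psi>_def g_def)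
        qed
      qed
    qed
  qed
  then show False using not_colors by blast
qed

lemma is_W_S: "is_W (cons_on S) S"
  using tree_solvable[OF wf_cons_S] not_solvable by blast

end

section \<open>The exception and the bound\<close>

lemma W_edges: "{a, b} \<in> edges W_hat \<longleftrightarrow>
    (a, b) \<in> {(X1, Y1), (X1, Y2), (X1, Y3), (X2, Y2), (X3, Y3), (X4, Y1), (X2, Y1), (X3, Y2),
        (X4, Y3),
      (Y1, X1), (Y2, X1), (Y3, X1), (Y2, X2), (Y3, X3), (Y1, X4), (Y1, X2), (Y2, X3), (Y3, X4)}"
  by (cases a; cases b; simp add: W_hat_def graph_of_signed_edges_def doubleton_eq_iff)

lemma W_sign: "sgn_of W_hat {a, b} =
    (if (a, b) \<in> {(X2, Y1), (X3, Y2), (X4, Y3), (Y1, X2), (Y2, X3), (Y3, X4)}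
    then Negative else Positive)"
  by (cases a; cases b; simp add: W_hat_def graph_of_signed_edges_def doubleton_eq_iff)

text \<open>G is connected, because colourings of a union of components and of the rest
  combine.\<close>

lemma (in crit) component_UNIV:
  assumes T: "T \<subseteq> V" "T \<noteq> {}" "\<And>x. x \<in> T \<Longrightarrow> nbrs x \<subseteq> T"
  shows "T = V"
proof (rule ccontr)
  assume "T \<noteq> V"
  then obtain \<phi> where 1: "colors \<phi> (V - (V - T))" using colors_delete[of "V - T"] T(1) by blast
  obtain \<psi> where 2: "colors \<psi> (V - T)" using colors_delete[of T] T by blast
  have "colors (\<lambda>x. if x \<in> T then \<phi> x else \<psi> x) V"
    unfolding colors_def
  proof (intro conjI ballI impI)
    show "par_ok par (\<lambda>x. if x \<in> T then \<phi> x else \<psi> x)"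
      using 1 2 by (simp add: colors_def par_ok_def)
    fix u v assume uv: "u \<in> V" "v \<in> V" "v \<in> nbrs u"
    then have "u \<in> T \<longleftrightarrow> v \<in> T" using T(3) nbrs_sym by blast
    then show "near (if u \<in> T then \<phi> u else \<psi> u) (opp_if (sg u v) (if v \<in> T then \<phi> v else \<psi> v))"
      using 1 2 uv unfolding colors_def by auto
  qed
  then show False using not_colors by blast
qed

text \<open>After switching at x and z the two edges at k have different signs, as at
  \<open>X2\<close>, \<open>X3\<close> and \<open>X4\<close> in \<open>W_hat\<close>.\<close>

lemma (in tree_part) Link_middle:
  assumes "Link x z False \<in> cons_on S"
  shows "\<exists>k\<in>V2. nbrs k = {x, z} \<and> x \<noteq> z \<and> (sg k x \<noteq> sw x) \<noteq> (sg k z \<noteq> sw z)"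
proof -
  obtain k where k: "k \<in> nbrs x" "k \<in> V2" "z = other_end k x" "twist k x = (sw x \<noteq> sw z)"
    using assms unfolding Link_Con by blast
  have x: "x \<in> nbrs k" using k nbrs_sym by blast
  have "nbrs k = {x, z}" "x \<noteq> z" using other_end[OF k(2) x] k(3) by auto
  moreover have "(sg k x \<noteq> sw x) \<noteq> (sg k z \<noteq> sw z)"
    using k(4) unfolding twist_def k(3)[symmetric] by blast
  ultimately show ?thesis using k(2) by blast
qed

lemma (in crit) nbrs_three:
  "v \<in> V3 \<Longrightarrow> {a, b, c} \<subseteq> nbrs v \<Longrightarrow> a \<noteq> b \<Longrightarrow> a \<noteq> c \<Longrightarrow> b \<noteq> c \<Longrightarrow> nbrs v = {a, b, c}"
  using card_subset_eq[OF fin_nbrs, of "{a, b, c}" v] by (simp add: V3_def)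

lemma (in tree_part) iso_W: "switching_isomorphic G W_hat"
proof -
  obtain q p u u' where dis: "distinct [q, p, u, u']" and S: "S = {q, p, u, u'}"
    and C: "{Near p q, Near p u, Near p u', Link q u False, Link q u' False,
        Link u u' False} \<subseteq> cons_on S"
    using conjunct2[OF is_W_S[unfolded is_W_def]] by (elim exE conjE) (rule that)
  have CL: "Link q u False \<in> cons_on S" "Link q u' False \<in> cons_on S" "Link u u' False \<in> cons_on S"
    and CN: "Near p q \<in> cons_on S" "Near p u \<in> cons_on S" "Near p u' \<in> cons_on S"
    using C by simp_all
  obtain k1 where k1: "k1 \<in> V2" "nbrs k1 = {q, u}" "(sg k1 q \<noteq> sw q) \<noteq> (sg k1 u \<noteq> sw u)"
    using Link_middle[OF CL(1)] by blast
  obtain k2 where k2: "k2 \<in> V2" "nbrs k2 = {q, u'}" "(sg k2 q \<noteq> sw q) \<noteq> (sg k2 u' \<noteq> sw u')"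
    using Link_middle[OF CL(2)] by blast
  obtain k3 where k3: "k3 \<in> V2" "nbrs k3 = {u, u'}" "(sg k3 u \<noteq> sw u) \<noteq> (sg k3 u' \<noteq> sw u')"
    using Link_middle[OF CL(3)] by blast
  have S3': "q \<in> V3" "p \<in> V3" "u \<in> V3" "u' \<in> V3" using S S3 by auto
  have kS: "k1 \<notin> S" "k2 \<notin> S" "k3 \<notin> S" using k1 k2 k3 S_V2 by auto
  have kk: "k1 \<noteq> k2" "k1 \<noteq> k3" "k2 \<noteq> k3"
      using k1(2) k2(2) k3(2) dis by (auto simp: doubleton_eq_iff)
  have d: "distinct [q, p, u, u', k1, k2, k3]" using dis kS kk S by auto
  have pn: "q \<in> nbrs p" "u \<in> nbrs p" "u' \<in> nbrs p" using CN Near_Con by blast+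
  have np: "nbrs p = {q, u, u'}" by (rule nbrs_three) (use S3' pn dis in auto)
  have nq: "nbrs q = {p, k1, k2}"
    by (rule nbrs_three) (use S3' d nbrs_sym[of _ q] pn k1(2) k2(2) in auto)
  have nu: "nbrs u = {p, k1, k3}"
    by (rule nbrs_three) (use S3' d nbrs_sym[of _ u] pn k1(2) k3(2) in auto)
  have nu': "nbrs u' = {p, k2, k3}"
    by (rule nbrs_three) (use S3' d nbrs_sym[of _ u'] pn k2(2) k3(2) in auto)
  have V: "V = {q, p, u, u', k1, k2, k3}"
  proof (rule component_UNIV[symmetric])
    show "{q, p, u, u', k1, k2, k3} \<subseteq> V"
      using S3' k1(1) k2(1) k3(1) unfolding V2_def V3_def by blast
    show "nbrs x \<subseteq> {q, p, u, u', k1, k2, k3}" if "x \<in> {q, p, u, u', k1, k2, k3}" for x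
      using that np nq nu nu' k1(2) k2(2) k3(2) by auto
  qed simp
  define f where "f x = (if x = p then X1 else if x = q then Y1 else if x = u then Y2 else if x =
      u' then Y3
     else if x = k1 then X2 else if x = k3 then X3 else X4)" for x
  have f: "f p = X1" "f q = Y1" "f u = Y2" "f u' = Y3" "f k1 = X2" "f k3 = X3" "f k2 = X4"
    using d by (auto simp: f_def)
  \<comment> \<open>On S this is the given switching; k1, k3 and k2 are switched so that their edges
    to u, u' and q become positive. Their other edges are then negative by
    \<open>Link_middle\<close>.\<close>
  define \<tau> where "\<tau> x = (if x = k1 then sg k1 u \<noteq> sw u else if x = k3 then sg k3 u' \<noteq> sw u'
     else if x = k2 then sg k2 q \<noteq> sw q else sw x)" for x
  have \<tau>: "\<tau> p = sw p" "\<tau> q = sw q" "\<tau> u = sw u" "\<tau> u' = sw u'" "\<tau> k1 = (sg k1 u \<noteq> sw u)"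
    "\<tau> k3 = (sg k3 u' \<noteq> sw u')" "\<tau> k2 = (sg k2 q \<noteq> sw q)"
    using d by (auto simp: \<tau>_def)
  define s' where "s' = switch_sign {v \<in> V. \<tau> v} (sgn_of G)"
  have s'N: "s' {a, b} = (if sg a b \<noteq> (\<tau> a \<noteq> \<tau> b) then Negative else Positive)"
    if "a \<in> V" "b \<in> V" "a \<noteq> b" for a b
    using switch_sign_pair[OF that(3), of "{v \<in> V. \<tau> v}"
        "sgn_of G"] that(1,2) sign.exhaust[of "s' {a, b}"]
    unfolding s'_def[symmetric] by auto
  have inV: "q \<in> V" "p \<in> V" "u \<in> V" "u' \<in> V" "k1 \<in> V" "k2 \<in> V" "k3 \<in> V" using V by auto
  have sp: "sg p q = (sw p \<noteq> sw q)" "sg p u = (sw p \<noteq> sw u)" "sg p u' = (sw p \<noteq> sw u')"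
    by (rule sw; use S pn in auto)+
  have dd: "q \<noteq> p" "q \<noteq> u" "q \<noteq> u'" "q \<noteq> k1" "q \<noteq> k2" "q \<noteq> k3" "p \<noteq> u" "p \<noteq> u'" "p \<noteq> k1" "p \<noteq> k2"
      "p \<noteq> k3"
    "u \<noteq> u'" "u \<noteq> k1" "u \<noteq> k2" "u \<noteq> k3" "u' \<noteq> k1" "u' \<noteq> k2" "u' \<noteq> k3" "k1 \<noteq> k2" "k1 \<noteq> k3" "k2 \<noteq> k3"
    using d by auto
  have "\<not> (sg p q \<noteq> (\<tau> p \<noteq> \<tau> q))" unfolding \<tau> using sp(1) by argo
  then have s1: "s' {p, q} = Positive" using s'N[of p q] inV dd by simp
  have "\<not> (sg p u \<noteq> (\<tau> p \<noteq> \<tau> u))" unfolding \<tau> using sp(2) by argo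
  then have s2: "s' {p, u} = Positive" using s'N[of p u] inV dd by simp
  have "\<not> (sg p u' \<noteq> (\<tau> p \<noteq> \<tau> u'))" unfolding \<tau> using sp(3) by argo
  then have s3: "s' {p, u'} = Positive" using s'N[of p u'] inV dd by simp
  have "\<not> (sg k1 u \<noteq> (\<tau> k1 \<noteq> \<tau> u))" unfolding \<tau> using TrueI by argo
  then have s4: "s' {k1, u} = Positive" using s'N[of k1 u] inV dd by simp
  have "\<not> (sg k3 u' \<noteq> (\<tau> k3 \<noteq> \<tau> u'))" unfolding \<tau> using TrueI by argo
  then have s5: "s' {k3, u'} = Positive" using s'N[of k3 u'] inV dd by simp
  have "\<not> (sg k2 q \<noteq> (\<tau> k2 \<noteq> \<tau> q))" unfolding \<tau> using TrueI by argo
  then have s6: "s' {k2, q} = Positive" using s'N[of k2 q] inV dd by simp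
  have "(sg k1 q \<noteq> (\<tau> k1 \<noteq> \<tau> q))" unfolding \<tau> using k1(3) by argo
  then have s7: "s' {k1, q} = Negative" using s'N[of k1 q] inV dd by simp
  have "(sg k3 u \<noteq> (\<tau> k3 \<noteq> \<tau> u))" unfolding \<tau> using k3(3) by argo
  then have s8: "s' {k3, u} = Negative" using s'N[of k3 u] inV dd by simp
  have "(sg k2 u' \<noteq> (\<tau> k2 \<noteq> \<tau> u'))" unfolding \<tau> using k2(3) by argo
  then have s9: "s' {k2, u'} = Negative" using s'N[of k2 u'] inV dd by simp
  have s: "s' {p, q} = Positive" "s' {p, u} = Positive" "s' {p, u'} = Positive"
    "s' {k1, u} = Positive" "s' {k3, u'} = Positive" "s' {k2, q} = Positive"
    "s' {k1, q} = Negative" "s' {k3, u} = Negative" "s' {k2, u'} = Negative"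
    "s' {q, p} = Positive" "s' {u, p} = Positive" "s' {u', p} = Positive"
    "s' {u, k1} = Positive" "s' {u', k3} = Positive" "s' {q, k2} = Positive"
    "s' {q, k1} = Negative" "s' {u, k3} = Negative" "s' {u', k2} = Negative"
    using s1 s2 s3 s4 s5 s6 s7 s8 s9 by (simp_all add: insert_commute)
  have E: "{a, b} \<in> E \<longleftrightarrow> b \<in> nbrs a" for a b by (simp add: nbrs_def)
  show ?thesis
    unfolding switching_isomorphic_def
  proof (intro exI[of _ s'] exI[of _ f] conjI)
    show "switching_equivalent G (sgn_of G) s'"
      unfolding switching_equivalent_def by (rule exI[of _ "{v \<in> V. \<tau> v}"]) (auto simp: s'_def)
    have "verts W_hat = {X1, X2, X3, X4, Y1, Y2, Y3}"
        by (simp add: W_hat_def graph_of_signed_edges_def)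
    then show "bij_betw f V (verts W_hat)"
      unfolding bij_betw_def V by (auto simp: inj_on_def f)
    have "({a, b} \<in> E \<longleftrightarrow> {f a, f b} \<in> edges W_hat) \<and> ({a, b} \<in> E \<longrightarrow>
        sgn_of W_hat {f a, f b} = s' {a, b})"
      if "a \<in> {q, p, u, u', k1, k2, k3}" "b \<in> {q, p, u, u', k1, k2, k3}" for a b
      using that unfolding E W_edges W_sign insert_iff empty_iff
      by (elim disjE FalseE)
         (simp_all only: f np nq nu nu' k1(2) k2(2) k3(2), simp_all add: dd dd[symmetric] s)
    then show "\<forall>u\<in>V. \<forall>v\<in>V. ({u, v} \<in> E \<longleftrightarrow> {f u, f v} \<in> edges W_hat) \<and>
        ({u, v} \<in> E \<longrightarrow> sgn_of W_hat {f u, f v} = s' {u, v})"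
      unfolding V by blast
  qed
qed

section \<open>Sets of 3-vertices that induce a forest\<close>

context crit
begin

text \<open>If every vertex of R had two neighbours in R, counting incidences would give at least as
  many inner edges as vertices.\<close>

lemma forest_peel:
  assumes R: "R \<subseteq> V" "card (inner R) < card R"
  shows "\<exists>v\<in>R. card (nbrs v \<inter> R) \<le> 1"
proof (rule ccontr)
  assume "\<not> (\<exists>v\<in>R. card (nbrs v \<inter> R) \<le> 1)"
  then have "\<And>v. v \<in> R \<Longrightarrow> 2 \<le> card (nbrs v \<inter> R)" by fastforce
  then have "(\<Sum>v\<in>R. 2) \<le> (\<Sum>v\<in>R. card (nbrs v \<inter> R))" by (rule sum_mono)
  also have "\<dots> = (\<Sum>v\<in>R. card {u. {v, u} \<in> inner R})"
  proof (rule sum.cong[OF refl])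
    fix v assume "v \<in> R"
    then have "nbrs v \<inter> R = {u. {v, u} \<in> inner R}" by (auto simp: nbrs_def inner_def)
    then show "card (nbrs v \<inter> R) = card {u. {v, u} \<in> inner R}" by simp
  qed
  also have "\<dots> = (\<Sum>e\<in>inner R. card (e \<inter> R))"
    by (rule sum_card_incident) (use finE card_edge R finV finite_subset in \<open>auto simp: inner_def\<close>)
  also have "\<dots> = (\<Sum>e\<in>inner R. 2)"
    by (rule sum.cong) (auto simp: inner_def card_edge Int_absorb2)
  finally show False using R(2) by simp
qed

text \<open>A vertex with at most one neighbour in R can have its switching value chosen after all
  others.\<close>

lemma forest_switch:
  assumes peel: "\<And>R. R \<subseteq> S \<Longrightarrow> R \<noteq> {} \<Longrightarrow> \<exists>v\<in>R. card (nbrs v \<inter> R) \<le> 1" and fin: "finite S"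
  shows "R \<subseteq> S \<Longrightarrow> \<exists>\<sigma> :: 'a \<Rightarrow> bool. \<forall>u\<in>R. \<forall>v\<in>R. v \<in> nbrs u \<longrightarrow> (sg u v \<longleftrightarrow> \<sigma> u \<noteq> \<sigma> v)"
proof (induction "card R" arbitrary: R rule: less_induct)
  case less
  show ?case
  proof (cases "R = {}")
    case False
    obtain v where v: "v \<in> R" "card (nbrs v \<inter> R) \<le> 1" using peel[OF less.prems False] by blast
    have "card (R - {v}) < card R"
      using v(1) fin less.prems finite_subset by (intro psubset_card_mono) auto
    from less.hyps[OF this] less.prems
    have "\<exists>\<sigma> :: 'a \<Rightarrow> bool. \<forall>u\<in>R - {v}. \<forall>w\<in>R - {v}. w \<in> nbrs u \<longrightarrow> (sg u w \<longleftrightarrow> \<sigma> u \<noteq> \<sigma> w)"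
      by (simp add: subset_iff)
    then obtain \<sigma> :: "'a \<Rightarrow> bool" where \<sigma>: "\<And>u w. u \<in> R - {v} \<Longrightarrow> w \<in> R - {v} \<Longrightarrow> w \<in> nbrs u \<Longrightarrow> sg u w \<longleftrightarrow>
        \<sigma> u \<noteq> \<sigma> w"
      by blast
    have "\<exists>c. \<forall>w\<in>nbrs v \<inter> R. sg v w \<longleftrightarrow> c \<noteq> \<sigma> w"
    proof (cases "nbrs v \<inter> R = {}")
      case False
      then have "card (nbrs v \<inter> R) = 1" using v(2) fin_nbrs
        by (metis One_nat_def card_0_eq finite_Int le_Suc_eq le_zero_eq)
      then obtain p where "nbrs v \<inter> R = {p}" by (rule card_1_singletonE)
      then show ?thesis by (intro exI[of _ "sg v p \<noteq> \<sigma> p"]) auto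
    qed simp
    then obtain c where c: "\<And>w. w \<in> nbrs v \<Longrightarrow> w \<in> R \<Longrightarrow> sg v w \<longleftrightarrow> c \<noteq> \<sigma> w" by blast
    have "\<forall>u\<in>R. \<forall>w\<in>R. w \<in> nbrs u \<longrightarrow> (sg u w \<longleftrightarrow> (\<sigma>(v := c)) u \<noteq> (\<sigma>(v := c)) w)"
    proof (intro ballI impI)
      fix u w assume uw: "u \<in> R" "w \<in> R" "w \<in> nbrs u"
      have ne: "u \<noteq> w" using uw nbrs_V by blast
      have "u \<in> nbrs w" using uw nbrs_sym by blast
      then show "sg u w \<longleftrightarrow> (\<sigma>(v := c)) u \<noteq> (\<sigma>(v := c)) w"
        using c[of w] c[of u] \<sigma>[of u w] uw ne sg_sym[of u w]
        by (cases "u = v"; cases "w = v") auto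
    qed
    then show ?thesis by blast
  qed simp
qed

lemma forest_imp_W:
  assumes S0: "S0 \<subseteq> V3" "S0 \<noteq> {}" "nbr_closed S0"
    and forest: "\<And>R. R \<subseteq> S0 \<Longrightarrow> R \<noteq> {} \<Longrightarrow> card (inner R) < card R"
  shows "switching_isomorphic G W_hat"
proof -
  let ?P = "\<lambda>T. T \<subseteq> S0 \<and> T \<noteq> {} \<and> nbr_closed T"
  \<comment> \<open>A closed set of least size is a single component, which gives the minimality
    that \<open>tree_part\<close> asks for.\<close>
  have "\<exists>S. ?P S \<and> (\<forall>T. ?P T \<longrightarrow> card S \<le> card T)"
    using ex_has_least_nat[of ?P S0 card] S0 by blast
  then obtain S where S: "S \<subseteq> S0" "S \<noteq> {}" "nbr_closed S" and least: "\<And>T. ?P T \<Longrightarrow> card S \<le> card T"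
    by blast
  have SV: "S \<subseteq> V" using S S0 by (auto simp: V3_def)
  then have finS: "finite S" using finV finite_subset by blast
  have peel: "\<exists>v\<in>R. card (nbrs v \<inter> R) \<le> 1" if "R \<subseteq> S" "R \<noteq> {}" for R
    by (rule forest_peel) (use that S SV forest in auto)
  obtain \<sigma> :: "'a \<Rightarrow> bool" where \<sigma>: "\<forall>u\<in>S. \<forall>v\<in>S. v \<in> nbrs u \<longrightarrow> (sg u v \<longleftrightarrow> \<sigma> u \<noteq> \<sigma> v)"
    using forest_switch[OF peel finS] by blast
  define K where "K = {k \<in> V2. nbrs k \<inter> S \<noteq> {}}"
  obtain \<phi> where \<phi>: "colors \<phi> (V - (S \<union> K))"
    using colors_delete[of "S \<union> K"] S SV by blast
  interpret tree_part G par S \<sigma> \<phi> K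
  proof
    show "S \<subseteq> V3" using S S0 by blast
    show "T = S" if "T \<subseteq> S" "T \<noteq> {}" "nbr_closed T" for T
      using card_seteq[OF finS that(1)] least[of T] that S by blast
  qed (use S peel \<sigma> K_def \<phi> in blast)+
  show ?thesis by (rule iso_W)
qed

end

theorem theorem3p8:
  fixes G :: "'a signed_graph"
  assumes "C_minus_4_critical G"
    and "\<not> switching_isomorphic G W_hat"
  shows "real (card (edges G)) \<ge> 4 * real (card (verts G)) / 3"
proof -
  have "bipartite G" using assms(1) by (simp add: C_minus_4_critical_def)
  then obtain A B where AB: "A \<inter> B = {}" "\<forall>e\<in>edges G. \<exists>a\<in>A. \<exists>b\<in>B. e = {a, b}"
    unfolding bipartite_def by (elim exE conjE) (rule that)
  interpret crit G "\<lambda>v. v \<in> A"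
  proof
    show "C_minus_4_critical G" by (rule assms(1))
    fix u v assume "{u, v} \<in> edges G"
    then obtain a b where "a \<in> A" "b \<in> B" "{u, v} = {a, b}" using AB(2) by blast
    then show "(u \<in> A) \<noteq> (v \<in> A)" using AB(1) by (auto simp: doubleton_eq_iff)
  qed
  have "card V3 \<le> card (star V3)"
  proof (rule count_from_key[OF _ subset_refl])
    fix S assume S: "S \<subseteq> V3" "S \<noteq> {}" "nbr_closed S"
      and R: "\<And>R. R \<subseteq> S \<Longrightarrow> R \<noteq> {} \<Longrightarrow> card (inner R) < card R"
    have "switching_isomorphic G W_hat" by (rule forest_imp_W[OF S R])
    then show False using assms(2) by contradiction
  qed
  then have "4 * card (verts G) \<le> 3 * card (edges G)" by (rule density)
  then show ?thesis by linarith
qed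

end
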